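(* Let $u_0\in\mathcal U$ and let $u$ be the entropy solution of the problem in the context. For every $K\in\mathbb N$ there exist a LRNR $H_r$ with rank $r=2$, degrees of freedom $K$, width $\sim K^2$ and depth $L=5$, and coefficient functions $\gamma(t),\theta(t)$, each linear or constant in $t$, such that $h(t):=h(\gamma(t),\theta(t))\in H_r$ satisfies, for all $t\in\Omega_t$, $$\|u(\cdot,t)-h(t)\|_{L^1(\Omega_x)}\lesssim\frac1K|u_0|_{TV(\Omega_x)}\big(1+|u_0|_{TV(\Omega_x)}\big)\big(1+T\|F''\|_{L^\infty(u_0(\Omega_x))}\big),$$ with an implicit constant independent of $K$, $u_0$, $F$ and $T$.
   Context: $\Omega_x=(0,1)$, $\Omega_t=(0,T)$, $F\in C^\infty(\mathbb{R})$ strictly convex; $\mathcal U$ is the set of functions of bounded variation on $\Omega_x$ with compact support in $\Omega_x$. $u$ is the entropy solution of $\partial_t u+\partial_x(F(u))=0$ on $\Omega_x\times\Omega_t$, $u(\cdot,0)=u_0$, $u(0,t)=u(1,t)=0$, with $T$ small enough that the zero boundary conditions hold for all $t\in\Omega_t$. LRNR (low rank neural representation): fix depth $L$ and widths $M_0=1,M_1,\dots,M_{L-1},M_L=1$, width $M=\max_\ell M_\ell$. A feedforward network is $h(x;W,B)=A^L\circ\sigma\odot A^{L-1}\circ\cdots\circ\sigma\odot A^1(x)$ with $A^\ell(z)=W^\ell z+B^\ell$, $W^\ell\in\mathbb{R}^{M_\ell\times M_{\ell-1}}$, $B^\ell\in\mathbb{R}^{M_\ell}$, and $\sigma(x)=\max\{0,x\}$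 applied entrywise. A LRNR of rank $r$ is given by fixed $U_1^\ell,\dots,U_r^\ell$ (weight-shaped) and $V_1^\ell,\dots,V_r^\ell$ (bias-shaped) for each layer $\ell$, each a product $a\bullet b$ of two vectors with $\bullet\in\{\otimes,\otimes_d,{}_d\otimes\}$, where $\otimes$ is the Kronecker product, $a\otimes_d b:=a\otimes\mathrm{diag}(b)$, $a\,{}_d\!\otimes b:=\mathrm{diag}(a)\otimes b$; and coefficient sets $C^\ell,D^\ell\subset\mathbb{R}^r$. Its members are $h(\gamma,\theta):=h(\cdot;W,B)$ with $W^\ell=\sum_{i=1}^r\gamma_i^\ell U_i^\ell$, $B^\ell=\sum_{i=1}^r\theta_i^\ell V_i^\ell$. The spatial variable $x$ is the only network input; time $t$ enters only through the coefficients. The degrees of freedom $K$ is the number of stored (unconstrained) real parameters defining the $U_i^\ell,V_i^\ell$. *)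

theory Defs
  imports "HOL-Analysis.Analysis"
begin

definition variation_sums :: "(real \<Rightarrow> real) \<Rightarrow> real set \<Rightarrow> real set" where
  "variation_sums f S = {(\<Sum>i<n. \<bar>f (xs (Suc i)) - f (xs i)\<bar>) | n xs.
      (\<forall>i\<le>n. xs i \<in> S) \<and> (\<forall>i<n. xs i < xs (Suc i))}"

definition has_bv_on :: "(real \<Rightarrow> real) \<Rightarrow> real set \<Rightarrow> bool" where
  "has_bv_on f S \<longleftrightarrow> bdd_above (variation_sums f S)"

definition total_variation :: "(real \<Rightarrow> real) \<Rightarrow> real set \<Rightarrow> real" where
  "total_variation f S = Sup (variation_sums f S)"

text \<open>The class U: BV on (0,1) with compact support in (0,1); u0 is taken extended by 0 to all of R.\<close>
definition in_U :: "(real \<Rightarrow> real) \<Rightarrow> bool" where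
  "in_U u0 \<longleftrightarrow> has_bv_on u0 {0<..<1} \<and>
     (\<exists>a b. 0 < a \<and> a \<le> b \<and> b < 1 \<and> (\<forall>x. x \<notin> {a..b} \<longrightarrow> u0 x = 0))"

definition smooth_fun :: "(real \<Rightarrow> real) \<Rightarrow> bool" where
  "smooth_fun F \<longleftrightarrow> (\<forall>n x. ((deriv ^^ n) F) differentiable (at x))"

definition strictly_convex :: "(real \<Rightarrow> real) \<Rightarrow> bool" where
  "strictly_convex F \<longleftrightarrow> (\<forall>x y s. x \<noteq> y \<longrightarrow> 0 < s \<longrightarrow> s < 1 \<longrightarrow>
      F ((1 - s) * x + s * y) < (1 - s) * F x + s * F y)"

definition F2_norm :: "(real \<Rightarrow> real) \<Rightarrow> (real \<Rightarrow> real) \<Rightarrow> real" where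
  "F2_norm F u0 = Sup ((\<lambda>v. \<bar>deriv (deriv F) v\<bar>) ` (u0 ` {0<..<1}))"

definition dx :: "(real \<Rightarrow> real \<Rightarrow> real) \<Rightarrow> real \<Rightarrow> real \<Rightarrow> real" where
  "dx \<phi> x t = deriv (\<lambda>y. \<phi> y t) x"

definition dt :: "(real \<Rightarrow> real \<Rightarrow> real) \<Rightarrow> real \<Rightarrow> real \<Rightarrow> real" where
  "dt \<phi> x t = deriv (\<lambda>s. \<phi> x s) t"

definition test_fun :: "real \<Rightarrow> (real \<Rightarrow> real \<Rightarrow> real) \<Rightarrow> bool" where
  "test_fun T \<phi> \<longleftrightarrow>
     (\<forall>p. (\<lambda>q. \<phi> (fst q) (snd q)) differentiable (at p)) \<and>
     continuous_on UNIV (\<lambda>p. dx \<phi> (fst p) (snd p)) \<and>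
     continuous_on UNIV (\<lambda>p. dt \<phi> (fst p) (snd p)) \<and>
     (\<exists>R \<delta>. 0 < R \<and> 0 < \<delta> \<and> (\<forall>x t. (\<bar>x\<bar> \<ge> R \<or> t \<ge> T - \<delta>) \<longrightarrow> \<phi> x t = 0))"

text \<open>Kruzhkov entropy solution (with initial datum) of u_t + F(u)_x = 0 on R x (0,T), u(.,0) = u0.
  u x t is the value at position x and time t.\<close>
definition entropy_solution ::
  "(real \<Rightarrow> real) \<Rightarrow> (real \<Rightarrow> real) \<Rightarrow> real \<Rightarrow> (real \<Rightarrow> real \<Rightarrow> real) \<Rightarrow> bool" where
  "entropy_solution F u0 T u \<longleftrightarrow>
     (\<lambda>p. u (fst p) (snd p)) \<in> borel_measurable borel \<and>
     (\<exists>B. AE p in lborel. snd p \<in> {0<..<T} \<longrightarrow> \<bar>u (fst p) (snd p)\<bar> \<le> B) \<and>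
     (\<forall>k \<phi>. test_fun T \<phi> \<and> (\<forall>x t. 0 \<le> \<phi> x t) \<longrightarrow>
        0 \<le> (\<integral>p. indicator (UNIV \<times> {0<..<T}) p *
                  (\<bar>u (fst p) (snd p) - k\<bar> * dt \<phi> (fst p) (snd p)
                   + sgn (u (fst p) (snd p) - k) * (F (u (fst p) (snd p)) - F k)
                       * dx \<phi> (fst p) (snd p)) \<partial>lborel)
             + (\<integral>x. \<bar>u0 x - k\<bar> * \<phi> x 0 \<partial>lborel))"

definition L1_time_continuous :: "real \<Rightarrow> (real \<Rightarrow> real \<Rightarrow> real) \<Rightarrow> bool" where
  "L1_time_continuous T u \<longleftrightarrow> (\<forall>t0\<in>{0<..<T}. integrable lborel (\<lambda>x. u x t0) \<and>
      ((\<lambda>t. \<integral>x. \<bar>u x t - u x t0\<bar> \<partial>lborel) \<longlongrightarrow> 0) (at t0 within {0<..<T}))"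

text \<open>Zero boundary conditions: u(.,t) vanishes outside Omega_x = (0,1) for every t in Omega_t.\<close>
definition zero_outside :: "real \<Rightarrow> (real \<Rightarrow> real \<Rightarrow> real) \<Rightarrow> bool" where
  "zero_outside T u \<longleftrightarrow> (\<forall>t\<in>{0<..<T}. AE x in lborel. x \<notin> {0<..<1} \<longrightarrow> u x t = 0)"

type_synonym mat = "nat \<times> nat \<times> (nat \<Rightarrow> nat \<Rightarrow> real)"

definition mrows :: "mat \<Rightarrow> nat" where "mrows A = fst A"
definition mcols :: "mat \<Rightarrow> nat" where "mcols A = fst (snd A)"
definition ment :: "mat \<Rightarrow> nat \<Rightarrow> nat \<Rightarrow> real" where "ment A = snd (snd A)"

definition is_vec :: "mat \<Rightarrow> bool" where "is_vec A \<longleftrightarrow> mrows A = 1 \<or> mcols A = 1"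
definition vlen :: "mat \<Rightarrow> nat" where "vlen A = mrows A * mcols A"
definition vent :: "mat \<Rightarrow> nat \<Rightarrow> real" where
  "vent A i = (if mcols A = 1 then ment A i 0 else ment A 0 i)"

definition kron :: "mat \<Rightarrow> mat \<Rightarrow> mat" where
  "kron A B = (mrows A * mrows B, mcols A * mcols B,
     \<lambda>i j. ment A (i div mrows B) (j div mcols B) * ment B (i mod mrows B) (j mod mcols B))"

definition diagv :: "mat \<Rightarrow> mat" where
  "diagv a = (vlen a, vlen a, \<lambda>i j. if i = j then vent a i else 0)"

datatype kprod = Kron | KronD | DKron

type_synonym factor = "kprod \<times> mat \<times> mat"

definition factor_mat :: "factor \<Rightarrow> mat" where
  "factor_mat f = (case f of (k, a, b) \<Rightarrow>
     (case k of Kron \<Rightarrow> kron a b | KronD \<Rightarrow> kron a (diagv b) | DKron \<Rightarrow> kron (diagv a) b))"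

definition valid_factor :: "factor \<Rightarrow> bool" where
  "valid_factor f = (case f of (k, a, b) \<Rightarrow> is_vec a \<and> is_vec b)"

definition factor_dof :: "factor \<Rightarrow> nat" where
  "factor_dof f = (case f of (k, a, b) \<Rightarrow> vlen a + vlen b)"

definition lrnr_basis :: "nat \<Rightarrow> (nat \<Rightarrow> nat) \<Rightarrow> nat \<Rightarrow> (nat \<Rightarrow> nat \<Rightarrow> factor) \<Rightarrow>
    (nat \<Rightarrow> nat \<Rightarrow> factor) \<Rightarrow> bool" where
  "lrnr_basis L M r U V \<longleftrightarrow> M 0 = 1 \<and> M L = 1 \<and> (\<forall>l\<le>L. 0 < M l) \<and>
     (\<forall>l\<in>{1..L}. \<forall>i<r.
        valid_factor (U l i) \<and> mrows (factor_mat (U l i)) = M l \<and>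
          mcols (factor_mat (U l i)) = M (l - 1) \<and>
        valid_factor (V l i) \<and> mrows (factor_mat (V l i)) = M l \<and>
          mcols (factor_mat (V l i)) = 1)"

definition lrnr_dof :: "nat \<Rightarrow> nat \<Rightarrow> (nat \<Rightarrow> nat \<Rightarrow> factor) \<Rightarrow> (nat \<Rightarrow> nat \<Rightarrow> factor) \<Rightarrow> nat" where
  "lrnr_dof L r U V = (\<Sum>l\<in>{1..L}. \<Sum>i<r. factor_dof (U l i) + factor_dof (V l i))"

definition net_width :: "nat \<Rightarrow> (nat \<Rightarrow> nat) \<Rightarrow> nat" where
  "net_width L M = Max (M ` {..L})"

definition relu :: "real \<Rightarrow> real" where "relu z = max 0 z"

primrec hidden :: "(nat \<Rightarrow> nat) \<Rightarrow> (nat \<Rightarrow> nat \<Rightarrow> nat \<Rightarrow> real) \<Rightarrow> (nat \<Rightarrow> nat \<Rightarrow> real) \<Rightarrow>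
    real \<Rightarrow> nat \<Rightarrow> nat \<Rightarrow> real" where
  "hidden M W B x 0 = (\<lambda>_. x)"
| "hidden M W B x (Suc l) =
     (\<lambda>i. relu ((\<Sum>j<M l. W (Suc l) i j * hidden M W B x l j) + B (Suc l) i))"

definition net :: "nat \<Rightarrow> (nat \<Rightarrow> nat) \<Rightarrow> (nat \<Rightarrow> nat \<Rightarrow> nat \<Rightarrow> real) \<Rightarrow> (nat \<Rightarrow> nat \<Rightarrow> real) \<Rightarrow>
    real \<Rightarrow> real" where
  "net L M W B x = (\<Sum>j<M (L - 1). W L 0 j * hidden M W B x (L - 1) j) + B L 0"

definition lrnr_eval :: "nat \<Rightarrow> (nat \<Rightarrow> nat) \<Rightarrow> nat \<Rightarrow> (nat \<Rightarrow> nat \<Rightarrow> factor) \<Rightarrow>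
    (nat \<Rightarrow> nat \<Rightarrow> factor) \<Rightarrow> (nat \<Rightarrow> nat \<Rightarrow> real) \<Rightarrow> (nat \<Rightarrow> nat \<Rightarrow> real) \<Rightarrow> real \<Rightarrow> real" where
  "lrnr_eval L M r U V \<gamma> \<theta> x =
     net L M (\<lambda>l i j. \<Sum>q<r. \<gamma> l q * ment (factor_mat (U l q)) i j)
             (\<lambda>l i. \<Sum>q<r. \<theta> l q * ment (factor_mat (V l q)) i 0) x"

end

theory Submission
  imports Defs
begin

text \<open>
  Let \<open>V\<close> be the total variation of the datum. Sample it on \<open>K\<close> cells, round to multiples of \<open>V / K\<close>, and
  replace the flux by its linear interpolant on these levels: the solution becomes a finite system of fronts.
  Fronts only merge, so \<open>O(K)\<close> straight segments describe it for all times, and each segment costs a bounded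
  number of neurons, with time entering through the biases of the first layer.

  For the error, a direct Kruzhkov estimate against front tracking loses a term proportional to \<open>T\<close> times the
  second derivative on the whole convex hull of the range of the datum, which is not available here. It is used
  only to identify the entropy solution as the limit of front tracking on finer and finer levels. The coarse and the
  fine front tracking are both Hopf-Lax solutions, and the derivatives of two Hopf-Lax
  functions differ in \<open>L\<^sup>1\<close> by the difference of the data plus a constant times \<open>V / K\<close>, as long as the minimisers
  stay in a bounded set. The latter follows from the zero boundary conditions.
\<close>

section \<open>Kruzhkov's inequality against piecewise constant functions\<close>

text \<open>A $C^1$ quadratic spline rising from 0 to 1 on the unit interval; \<open>dstep\<close> is its derivative.\<close>

definition sstep :: "real \<Rightarrow> real" where
  "sstep z = 2 * (relu z)\<^sup>2 - 4 * (relu (z - 1/2))\<^sup>2 + 2 * (relu (z - 1))\<^sup>2"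

definition dstep :: "real \<Rightarrow> real" where
  "dstep z = 4 * relu z - 8 * relu (z - 1/2) + 4 * relu (z - 1)"

definition heav :: "real \<Rightarrow> real" where "heav z = (if z > 0 then 1 else 0)"

lemma relu_sq_deriv: "((\<lambda>z. (relu z)\<^sup>2) has_real_derivative 2 * relu z) (at z)"
proof (cases "z = 0")
  case True
  have "(\<lambda>h. ((relu (0 + h))\<^sup>2 - (relu 0)\<^sup>2) / h) \<midarrow>0\<rightarrow> 0"
  proof (rule Lim_null_comparison)
    show "\<forall>\<^sub>F h in at 0. norm (((relu (0 + h))\<^sup>2 - (relu 0)\<^sup>2) / h) \<le> \<bar>h\<bar>"
      by (auto simp: eventually_at_filter relu_def max_def power2_eq_square divide_simps)
    show "((\<lambda>h::real. \<bar>h\<bar>) \<longlongrightarrow> 0) (at 0)" by (rule tendsto_eq_intros | simp)+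
  qed
  then show ?thesis using True by (simp add: DERIV_def relu_def)
next
  case False
  show ?thesis
  proof (cases "z > 0")
    case True
    have "((\<lambda>z. z\<^sup>2) has_real_derivative 2 * relu z) (at z)"
      using True by (auto intro!: derivative_eq_intros simp: relu_def)
    moreover have "\<forall>\<^sub>F y in nhds z. y\<^sup>2 = (relu y)\<^sup>2"
      using eventually_nhds_in_open[of "{0<..}" z] True
      by (auto elim!: eventually_mono simp: relu_def)
    ultimately show ?thesis using DERIV_cong_ev[OF refl _ refl] by fast
  next
    case neg: False
    have "((\<lambda>z::real. 0) has_real_derivative 2 * relu z) (at z)"
      using neg by (auto intro!: derivative_eq_intros simp: relu_def)
    moreover have "\<forall>\<^sub>F y in nhds z. 0 = (relu y)\<^sup>2"
      using eventually_nhds_in_open[of "{..<0}" z] neg False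
      by (auto elim!: eventually_mono simp: relu_def)
    ultimately show ?thesis using DERIV_cong_ev[OF refl _ refl] by fast
  qed
qed

lemma continuous_on_relu [continuous_intros]:
  "continuous_on S f \<Longrightarrow> continuous_on S (\<lambda>x. relu (f x))"
  unfolding relu_def by (intro continuous_intros)

lemma borel_measurable_relu [measurable]: "relu \<in> borel_measurable borel"
  by (intro borel_measurable_continuous_onI continuous_intros)

lemma borel_measurable_heav [measurable]: "heav \<in> borel_measurable borel"
  unfolding heav_def by measurable

lemma sstep_deriv: "(sstep has_real_derivative dstep z) (at z)"
proof -
  have r: "((\<lambda>z. (relu (z - c))\<^sup>2) has_real_derivative 2 * relu (z - c)) (at z)" for c
  proof -
    have "((\<lambda>z. z - c) has_real_derivative 1) (at z)" by (auto intro!: derivative_eq_intros)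
    from DERIV_chain2[OF relu_sq_deriv this] show ?thesis by simp
  qed
  show ?thesis
    unfolding sstep_def dstep_def
    by (rule derivative_eq_intros r relu_sq_deriv refl | simp)+
qed

lemma dstep_nonneg: "0 \<le> dstep z" by (auto simp: dstep_def relu_def max_def)

lemma dstep_outside: "z \<le> 0 \<or> 1 \<le> z \<Longrightarrow> dstep z = 0" by (auto simp: dstep_def relu_def max_def)

lemma sstep_0: "z \<le> 0 \<Longrightarrow> sstep z = 0" by (auto simp: sstep_def relu_def max_def)

lemma sstep_1: "1 \<le> z \<Longrightarrow> sstep z = 1"
  by (auto simp: sstep_def relu_def max_def power2_eq_square algebra_simps)

lemma sstep_mono: "x \<le> y \<Longrightarrow> sstep x \<le> sstep y"
  using DERIV_nonneg_imp_nondecreasing[of x y sstep] sstep_deriv dstep_nonneg by blast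

lemma sstep_ge_0: "0 \<le> sstep z" and sstep_le_1: "sstep z \<le> 1"
  using sstep_mono[of "min z 0" z] sstep_mono[of z "max z 1"] by (auto simp: sstep_0 sstep_1)

lemma continuous_on_dstep [continuous_intros]:
  "continuous_on S f \<Longrightarrow> continuous_on S (\<lambda>x. dstep (f x))"
  unfolding dstep_def by (intro continuous_intros)

lemma continuous_on_sstep [continuous_intros]:
  "continuous_on S f \<Longrightarrow> continuous_on S (\<lambda>x. sstep (f x))"
  unfolding sstep_def by (intro continuous_intros)

lemma measurable_sstep [measurable]: "sstep \<in> borel_measurable borel"
  and measurable_dstep [measurable]: "dstep \<in> borel_measurable borel"
  by (auto intro!: borel_measurable_continuous_onI continuous_intros)

lemma has_bochner_integral_dstep:
  assumes e: "0 < e"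
  shows "has_bochner_integral lborel (\<lambda>x. dstep ((x - a) / e) / e) 1"
proof -
  have d: "((\<lambda>x. sstep ((x - a) / e)) has_real_derivative dstep ((x - a) / e) / e) (at x)" for x
  proof -
    have "((\<lambda>x. (x - a) / e) has_real_derivative 1 / e) (at x)"
      using e by (auto intro!: derivative_eq_intros)
    from DERIV_chain2[OF sstep_deriv this] show ?thesis by simp
  qed
  have c: "continuous_on {a..a+e} (\<lambda>x. dstep ((x - a) / e) / e)"
    using e by (intro continuous_intros) auto
  have "has_bochner_integral lborel (\<lambda>x. indicator {a..a+e} x *\<^sub>R (dstep ((x - a) / e) / e))
       (sstep ((a + e - a) / e) - sstep ((a - a) / e))"
    using e by (intro has_bochner_integral_FTC_Icc c)
      (auto intro: d has_field_derivative_at_within simp flip: has_real_derivative_iff_has_vector_derivative)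
  moreover have "indicator {a..a+e} x *\<^sub>R (dstep ((x - a) / e) / e) = dstep ((x - a) / e) / e" for x
    using e dstep_outside[of "(x - a) / e"] by (cases "x \<in> {a..a+e}") (auto simp: field_simps)
  ultimately have "has_bochner_integral lborel (\<lambda>x. dstep ((x - a) / e) / e)
       (sstep ((a + e - a) / e) - sstep ((a - a) / e))" by (simp only:)
  then show ?thesis using e by (simp add: sstep_0 sstep_1)
qed

lemma ramp_test_fun:
  fixes \<eta> \<eta>' :: "real \<Rightarrow> real" and a b a' b' e R \<delta> T :: real
  assumes d: "\<And>t. (\<eta> has_real_derivative \<eta>' t) (at t)" and c: "continuous_on UNIV \<eta>'"
    and e: "0 < e" and \<delta>: "0 < \<delta>" "\<And>t. T - \<delta> \<le> t \<Longrightarrow> \<eta> t = 0"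
    and R: "0 \<le> R" "\<And>t. \<eta> t \<noteq> 0 \<Longrightarrow> \<bar>a + b * t\<bar> \<le> R \<and> \<bar>a' + b' * t\<bar> \<le> R"
  defines "\<phi> \<equiv> \<lambda>x t. \<eta> t * (sstep ((x - a - b * t) / e) - sstep ((x - a' - b' * t) / e))"
  shows "test_fun T \<phi>"
    and "dx \<phi> x t = \<eta> t * (dstep ((x - a - b * t) / e) / e - dstep ((x - a' - b' * t) / e) / e)"
    and "dt \<phi> x t = \<eta>' t * (sstep ((x - a - b * t) / e) - sstep ((x - a' - b' * t) / e))
           + \<eta> t * (b' * (dstep ((x - a' - b' * t) / e) / e) - b * (dstep ((x - a - b * t) / e) / e))"
    and "\<bar>x\<bar> > R + e \<Longrightarrow> \<phi> x t = 0"
proof -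
  have sx: "((\<lambda>x. sstep ((x - a - b * t) / e)) has_real_derivative dstep ((x - a - b * t) / e) / e) (at x)"
    for x t a b
  proof -
    have "((\<lambda>x. (x - a - b * t) / e) has_real_derivative 1 / e) (at x)"
      using e by (auto intro!: derivative_eq_intros)
    from DERIV_chain2[OF sstep_deriv this] show ?thesis by simp
  qed
  have st: "((\<lambda>t. sstep ((x - a - b * t) / e)) has_real_derivative - b * (dstep ((x - a - b * t) / e) / e)) (at t)"
    for x t a b
  proof -
    have "((\<lambda>t. (x - a - b * t) / e) has_real_derivative - b / e) (at t)"
      using e by (auto intro!: derivative_eq_intros)
    from DERIV_chain2[OF sstep_deriv this] show ?thesis by (simp add: mult_ac)
  qed
  have dx: "dx \<phi> x t = \<eta> t * (dstep ((x - a - b * t) / e) / e - dstep ((x - a' - b' * t) / e) / e)" for x t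
    unfolding dx_def \<phi>_def
    by (rule DERIV_imp_deriv) (intro DERIV_cmult DERIV_diff sx)
  have dt: "dt \<phi> x t = \<eta>' t * (sstep ((x - a - b * t) / e) - sstep ((x - a' - b' * t) / e))
           + \<eta> t * (b' * (dstep ((x - a' - b' * t) / e) / e) - b * (dstep ((x - a - b * t) / e) / e))" for x t
    unfolding dt_def \<phi>_def
    by (rule DERIV_imp_deriv)
      (rule DERIV_cong[OF DERIV_mult[OF d DERIV_diff[OF st st]]], simp add: algebra_simps)
  have dsj: "(\<lambda>q. sstep ((fst q - a - b * snd q) / e)) differentiable (at p)" for a b and p :: "real \<times> real"
  proof -
    have "(\<lambda>q::real\<times>real. (fst q - a - b * snd q) / e) differentiable (at p)"
      using e bounded_linear_imp_differentiable[OF bounded_linear_fst]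
        bounded_linear_imp_differentiable[OF bounded_linear_snd]
      by (intro derivative_intros) auto
    moreover have "sstep differentiable at z" for z
      using sstep_deriv real_differentiable_def by blast
    ultimately show ?thesis using differentiable_compose[of sstep] by blast
  qed
  have dchi: "(\<lambda>q. \<eta> (snd q)) differentiable (at p)" for p :: "real \<times> real"
  proof -
    have "snd differentiable (at p)" by (rule bounded_linear_imp_differentiable[OF bounded_linear_snd])
    moreover have "\<eta> differentiable at z" for z using d real_differentiable_def by blast
    ultimately show ?thesis using differentiable_compose[of \<eta>] by blast
  qed
  have c\<eta>: "continuous_on UNIV \<eta>"
    using d by (meson DERIV_continuous continuous_at_imp_continuous_on)
  have z: "\<phi> x t = 0" if "\<bar>x\<bar> > R + e" for x t
  proof (cases "\<eta> t = 0")
    case False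
    with R have r: "\<bar>a + b * t\<bar> \<le> R" "\<bar>a' + b' * t\<bar> \<le> R" by auto
    show ?thesis
    proof (cases "x > 0")
      case True
      then have "1 \<le> (x - a - b * t) / e" "1 \<le> (x - a' - b' * t) / e"
        using that r e R(1) by (auto simp: field_simps)
      then show ?thesis by (simp add: \<phi>_def sstep_1)
    next
      case False
      then have "(x - a - b * t) / e \<le> 0" "(x - a' - b' * t) / e \<le> 0"
        using that r e R(1) by (auto simp: field_simps)
      then show ?thesis by (simp add: \<phi>_def sstep_0)
    qed
  qed (simp add: \<phi>_def)
  show "test_fun T \<phi>"
    unfolding test_fun_def dx dt
  proof (intro conjI allI)
    show "(\<lambda>q. \<phi> (fst q) (snd q)) differentiable (at p)" for p
      unfolding \<phi>_def by (intro derivative_intros dsj dchi)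
    show "continuous_on UNIV (\<lambda>p. \<eta> (snd p) * (dstep ((fst p - a - b * snd p) / e) / e - dstep ((fst p - a' - b' * snd p) / e) / e))"
      using e by (intro continuous_intros continuous_on_compose2[OF c\<eta>]) auto
    show "continuous_on UNIV (\<lambda>p. \<eta>' (snd p) * (sstep ((fst p - a - b * snd p) / e) - sstep ((fst p - a' - b' * snd p) / e))
           + \<eta> (snd p) * (b' * (dstep ((fst p - a' - b' * snd p) / e) / e) - b * (dstep ((fst p - a - b * snd p) / e) / e)))"
      using e by (intro continuous_intros continuous_on_compose2[OF c\<eta>] continuous_on_compose2[OF c]) auto
    show "\<exists>R \<delta>. 0 < R \<and> 0 < \<delta> \<and> (\<forall>x t. R \<le> \<bar>x\<bar> \<or> T - \<delta> \<le> t \<longrightarrow> \<phi> x t = 0)"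
      using z \<delta> R(1) e by (intro exI[of _ "R + e + 1"] exI[of _ \<delta>]) (auto simp: \<phi>_def)
  qed
  show "dx \<phi> x t = \<eta> t * (dstep ((x - a - b * t) / e) / e - dstep ((x - a' - b' * t) / e) / e)"
    by (rule dx)
  show "dt \<phi> x t = \<eta>' t * (sstep ((x - a - b * t) / e) - sstep ((x - a' - b' * t) / e))
           + \<eta> t * (b' * (dstep ((x - a' - b' * t) / e) / e) - b * (dstep ((x - a - b * t) / e) / e))"
    by (rule dt)
  show "\<phi> x t = 0" if "\<bar>x\<bar> > R + e" using z that .
qed

lemma measurable_fst_snd_real [measurable]:
  "fst \<in> borel_measurable (borel :: (real \<times> real) measure)"
  "snd \<in> borel_measurable (borel :: (real \<times> real) measure)"
  by (auto intro!: borel_measurable_continuous_onI continuous_intros)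

lemma abel_sum:
  fixes a :: "nat \<Rightarrow> nat \<Rightarrow> real"
  shows "(\<Sum>i\<le>n. a i i - a i (Suc i)) = a 0 0 - a n (Suc n) + (\<Sum>j=1..n. a j j - a (j - 1) j)"
  by (induction n) auto

locale entropy_setting =
  fixes F u0 :: "real \<Rightarrow> real" and T :: real and u :: "real \<Rightarrow> real \<Rightarrow> real"
  assumes F_cont: "continuous_on UNIV F" and T_pos: "0 < T"
    and ent: "entropy_solution F u0 T u" and tcont: "L1_time_continuous T u"
    and zout: "zero_outside T u"
    and u0_int: "integrable lborel u0" and u0_out: "\<And>x. x \<notin> {0<..<1} \<Longrightarrow> u0 x = 0"
begin

abbreviation U :: "real \<times> real \<Rightarrow> real" where "U q \<equiv> u (fst q) (snd q)"
abbreviation Q :: "(real \<times> real) set" where "Q \<equiv> UNIV \<times> {0<..<T}"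

lemma U_meas [measurable]: "(\<lambda>q. U q) \<in> borel_measurable borel"
  using ent by (simp add: entropy_solution_def)

lemma u_slice_meas [measurable]: "(\<lambda>x. u x t) \<in> borel_measurable borel"
  using measurable_compose[of "\<lambda>x. (x, t)" borel borel U borel] U_meas by simp

lemma F_meas [measurable]: "F \<in> borel_measurable borel"
  using F_cont by (rule borel_measurable_continuous_onI)

lemma Q_sets [measurable]: "Q \<in> sets borel"
  by (auto intro!: borel_open open_Times)

lemma U_bound: obtains B where "0 \<le> B" "AE q in lborel. q \<in> Q \<longrightarrow> \<bar>U q\<bar> \<le> B"
proof -
  obtain B where B: "AE q in lborel. snd q \<in> {0<..<T} \<longrightarrow> \<bar>U q\<bar> \<le> B"
    using ent by (auto simp: entropy_solution_def)
  have "AE q in lborel. q \<in> Q \<longrightarrow> \<bar>U q\<bar> \<le> max B 0"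
    using B by eventually_elim auto
  then show ?thesis using that[of "max B 0"] by simp
qed

lemma U_outside: "AE q in lborel. q \<in> Q \<longrightarrow> fst q \<notin> {0<..<1} \<longrightarrow> U q = 0"
proof -
  let ?P = "\<lambda>x t. t \<in> {0<..<T} \<longrightarrow> x \<notin> {0<..<1::real} \<longrightarrow> u x t = 0"
  have m: "{q \<in> space (lborel \<Otimes>\<^sub>M lborel). ?P (fst q) (snd q)} \<in> sets (lborel \<Otimes>\<^sub>M lborel)"
    unfolding lborel_prod by (simp, measurable)
  have "AE t in lborel. AE x in lborel. ?P x t"
    using zout by (auto simp: zero_outside_def intro!: AE_I2)
  then have "AE x in lborel. AE t in lborel. ?P x t"
    using lborel_pair.AE_commute[OF m] by simp
  then have "AE q in lborel \<Otimes>\<^sub>M lborel. ?P (fst q) (snd q)"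
    using lborel_pair.AE_pair_iff[OF m] by simp
  then show ?thesis unfolding lborel_prod by eventually_elim auto
qed

lemma strip_integrable:
  fixes f g :: "real \<times> real \<Rightarrow> real"
  assumes [measurable]: "f \<in> borel_measurable borel" "g \<in> borel_measurable borel"
    and g: "AE q in lborel. q \<in> Q \<longrightarrow> \<bar>g q\<bar> \<le> C"
    and f: "\<And>q. q \<in> Q \<Longrightarrow> \<bar>f q\<bar> \<le> D" "\<And>q. q \<in> Q \<Longrightarrow> \<bar>fst q\<bar> > R \<Longrightarrow> f q = 0"
  shows "integrable lborel (\<lambda>q. indicator Q q * (g q * f q))"
proof (rule integrableI_bounded_set[where A="cbox (-R, 0) (R, T)" and B="\<bar>C\<bar> * \<bar>D\<bar>"])
  show "AE q in lborel. q \<in> cbox (-R, 0) (R, T) \<longrightarrow> norm (indicator Q q * (g q * f q)) \<le> \<bar>C\<bar> * \<bar>D\<bar>"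
    using g
  proof eventually_elim
    case (elim q)
    show ?case
    proof (cases "q \<in> Q")
      case True
      then have "\<bar>g q\<bar> \<le> \<bar>C\<bar>" "\<bar>f q\<bar> \<le> \<bar>D\<bar>" using elim f(1)[of q] by auto
      then show ?thesis using True by (auto simp: abs_mult intro!: mult_mono)
    qed auto
  qed
  show "AE q in lborel. q \<notin> cbox (-R, 0) (R, T) \<longrightarrow> indicator Q q * (g q * f q) = 0"
  proof (intro AE_I2 impI)
    fix q assume q: "q \<notin> cbox (-R, 0) (R, T)"
    show "indicator Q q * (g q * f q) = 0"
    proof (cases "q \<in> Q")
      case True
      with q have "\<bar>fst q\<bar> > R" by (cases q) (auto simp: cbox_Pair_eq)
      then show ?thesis using f(2) True by simp
    qed auto
  qed
qed (auto simp: emeasure_lborel_cbox_eq)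

lemma strip_integrable_cont:
  fixes f g :: "real \<times> real \<Rightarrow> real"
  assumes cf: "continuous_on UNIV f" and mg: "g \<in> borel_measurable borel"
    and g: "AE q in lborel. q \<in> Q \<longrightarrow> \<bar>g q\<bar> \<le> C"
    and f: "\<And>q. q \<in> Q \<Longrightarrow> \<bar>fst q\<bar> > R \<Longrightarrow> f q = 0"
  shows "integrable lborel (\<lambda>q. indicator Q q * (g q * f q))"
proof -
  have "compact (f ` cbox (-R, 0) (R, T))"
    by (intro compact_continuous_image continuous_on_subset[OF cf]) auto
  then obtain D where D: "\<And>q. q \<in> cbox (-R, 0) (R, T) \<Longrightarrow> \<bar>f q\<bar> \<le> D"
    by (metis compact_imp_bounded bounded_iff imageI real_norm_def)
  show ?thesis
  proof (rule strip_integrable[where R=R and C=C and D="\<bar>D\<bar>"])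
    show "f \<in> borel_measurable borel" using cf by (rule borel_measurable_continuous_onI)
    show "\<bar>f q\<bar> \<le> \<bar>D\<bar>" if "q \<in> Q" for q
    proof (cases "\<bar>fst q\<bar> > R")
      case False
      then have "q \<in> cbox (-R, 0) (R, T)" using that by (cases q) (auto simp: cbox_Pair_eq)
      then show ?thesis using D by fastforce
    qed (use f that in auto)
  qed (use assms in auto)
qed

end

text \<open>The contribution of a front with speed \<open>s\<close> and left and right states \<open>a\<close>, \<open>b\<close> when Kruzhkov's inequality is
  used with constant \<open>a\<close> on its left and \<open>b\<close> on its right.\<close>

definition jmp :: "(real \<Rightarrow> real) \<Rightarrow> real \<Rightarrow> real \<Rightarrow> real \<Rightarrow> real \<Rightarrow> real" where
  "jmp F s a b w = (sgn (w - b) * (F w - F b) - s * \<bar>w - b\<bar>) - (sgn (w - a) * (F w - F a) - s * \<bar>w - a\<bar>)"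

context entropy_setting
begin

lemma F_bounded: obtains C where "\<And>w. \<bar>w\<bar> \<le> B \<Longrightarrow> \<bar>F w\<bar> \<le> C"
proof -
  have "compact (F ` {-B..B})"
    by (intro compact_continuous_image continuous_on_subset[OF F_cont]) auto
  then obtain C where "\<And>y. y \<in> F ` {-B..B} \<Longrightarrow> \<bar>y\<bar> \<le> C"
    by (metis compact_imp_bounded bounded_iff real_norm_def)
  moreover have "F w \<in> F ` {-B..B}" if "\<bar>w\<bar> \<le> B" for w using that by (intro imageI) auto
  ultimately show ?thesis by (intro that[of C]) blast
qed

lemma u0_bounded_box_integrable:
  fixes f :: "real \<Rightarrow> real"
  assumes [measurable]: "f \<in> borel_measurable borel"
    and f: "\<And>x. \<bar>f x\<bar> \<le> D" "\<And>x. \<bar>x\<bar> > R \<Longrightarrow> f x = 0"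
  shows "integrable lborel (\<lambda>x. \<bar>u0 x - k\<bar> * f x)"
proof -
  have [measurable]: "u0 \<in> borel_measurable borel" using u0_int by auto
  have D: "0 \<le> D" using f(1)[of 0] by simp
  have "integrable lborel (\<lambda>x. D * (\<bar>u0 x\<bar> + \<bar>k\<bar> * indicator {-R..R} x))"
    using u0_int by (intro integrable_mult_right Bochner_Integration.integrable_add integrable_abs) (auto simp: emeasure_lborel_Icc_eq)
  then show ?thesis
  proof (rule Bochner_Integration.integrable_bound)
    show "AE x in lborel. norm (\<bar>u0 x - k\<bar> * f x) \<le> norm (D * (\<bar>u0 x\<bar> + \<bar>k\<bar> * indicator {-R..R} x))"
    proof (intro AE_I2)
      fix x
      have "\<bar>u0 x - k\<bar> * \<bar>f x\<bar> \<le> (\<bar>u0 x\<bar> + \<bar>k\<bar>) * D" if "\<bar>x\<bar> \<le> R"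
        using f(1) by (intro mult_mono) auto
      moreover have "f x = 0" if "\<not> \<bar>x\<bar> \<le> R" using f(2) that by auto
      ultimately show "norm (\<bar>u0 x - k\<bar> * f x) \<le> norm (D * (\<bar>u0 x\<bar> + \<bar>k\<bar> * indicator {-R..R} x))"
        using D by (cases "\<bar>x\<bar> \<le> R") (auto simp: abs_mult indicator_def mult.commute)
    qed
  qed measurable
qed

text \<open>Kruzhkov's inequality for the constant \<open>v i\<close> is tested on the strip between the fronts \<open>i\<close> and \<open>Suc i\<close>,
  and the inequalities are added up. Abel summation collects one \<open>jmp\<close> term per front, so a piecewise
  constant comparison function needs no doubling of variables. The indices \<open>0\<close> and \<open>Suc n\<close> are artificial
  vertical fronts outside the support.\<close>

lemma kato_mollified:
  fixes p s v e :: "nat \<Rightarrow> real" and \<eta> \<eta>' :: "real \<Rightarrow> real"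
  assumes ends: "p 0 \<le> -1" "s 0 = 0" "1 \<le> p (Suc n)" "s (Suc n) = 0" "v 0 = 0" "v n = 0"
    and ord: "\<And>t i. t \<in> X \<Longrightarrow> i \<le> n \<Longrightarrow> p i + s i * t \<le> p (Suc i) + s (Suc i) * t"
    and \<eta>: "\<And>t. (\<eta> has_real_derivative \<eta>' t) (at t)" "continuous_on UNIV \<eta>'" "\<And>t. 0 \<le> \<eta> t"
       "\<And>t. t \<notin> X \<Longrightarrow> \<eta> t = 0 \<and> \<eta>' t = 0"
    and \<delta>: "0 < \<delta>" "\<And>t. T - \<delta> \<le> t \<Longrightarrow> \<eta> t = 0"
    and jump: "AE q in lborel. q \<in> Q \<longrightarrow> (\<forall>j\<in>{1..n}. jmp F (s j) (v (j - 1)) (v j) (U q) \<le> e j)"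
    and eps: "0 < \<epsilon>" "\<epsilon> \<le> 1"
  defines "\<sigma> \<equiv> \<lambda>j q. sstep ((fst q - p j - s j * snd q) / \<epsilon>)"
  shows "0 \<le> (\<integral>q. indicator Q q * (\<eta>' (snd q) * (\<Sum>i\<le>n. \<bar>U q - v i\<bar> * (\<sigma> i q - \<sigma> (Suc i) q))) \<partial>lborel)
     + (\<Sum>j=1..n. e j) * (\<integral>t. indicator {0<..<T} t * \<eta> t \<partial>lborel)
     + (\<integral>x. \<eta> 0 * (\<Sum>i\<le>n. \<bar>u0 x - v i\<bar> * (\<sigma> i (x, 0) - \<sigma> (Suc i) (x, 0))) \<partial>lborel)"
proof -
  define R where "R = max (- p 0) (p (Suc n))"
  have ord': "p i + s i * t \<le> p j + s j * t" if "t \<in> X" "i \<le> j" "j \<le> Suc n" for t i j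
    using that(2,3)
  proof (induction j)
    case (Suc j)
    then show ?case using ord[OF that(1), of j] by (cases "i = Suc j") auto
  qed simp
  have lR: "\<bar>p j + s j * t\<bar> \<le> R" if "t \<in> X" "j \<le> Suc n" for t j
    using ord'[OF that(1), of 0 j] ord'[OF that(1), of j "Suc n"] that(2) ends by (auto simp: R_def)
  have R: "1 \<le> R" using ends by (auto simp: R_def)
  have \<eta>X: "t \<in> X" if "\<eta> t \<noteq> 0 \<or> \<eta>' t \<noteq> 0" for t using \<eta>(4) that by blast
  have c\<eta>: "continuous_on UNIV \<eta>"
    using \<eta>(1) by (meson DERIV_continuous continuous_at_imp_continuous_on)
  have m\<eta> [measurable]: "\<eta> \<in> borel_measurable borel" "\<eta>' \<in> borel_measurable borel"
    using c\<eta> \<eta>(2) by (auto intro: borel_measurable_continuous_onI)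
  define \<rho> where "\<rho> = (\<lambda>j q. dstep ((fst q - p j - s j * snd q) / \<epsilon>) / \<epsilon>)"
  have c\<sigma>: "continuous_on UNIV (\<sigma> j)" and c\<rho>: "continuous_on UNIV (\<rho> j)" for j
    unfolding \<sigma>_def \<rho>_def using eps by (auto intro!: continuous_intros)
  define \<phi> where "\<phi> = (\<lambda>i x t. \<eta> t * (sstep ((x - p i - s i * t) / \<epsilon>) - sstep ((x - p (Suc i) - s (Suc i) * t) / \<epsilon>)))"
  have R0: "0 \<le> R" using R by simp
  have lR2: "\<bar>p i + s i * t\<bar> \<le> R \<and> \<bar>p (Suc i) + s (Suc i) * t\<bar> \<le> R" if "i \<le> n" "\<eta> t \<noteq> 0" for i t
    using lR[OF \<eta>X] that by auto
  have tf: "test_fun T (\<phi> i)"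
    and dx: "dx (\<phi> i) x t = \<eta> t * (\<rho> i (x, t) - \<rho> (Suc i) (x, t))"
    and dt: "dt (\<phi> i) x t = \<eta>' t * (\<sigma> i (x, t) - \<sigma> (Suc i) (x, t))
           + \<eta> t * (s (Suc i) * \<rho> (Suc i) (x, t) - s i * \<rho> i (x, t))"
    and \<phi>0: "\<bar>x\<bar> > R + \<epsilon> \<Longrightarrow> \<phi> i x t = 0" if "i \<le> n" for i x t
    unfolding \<phi>_def \<sigma>_def \<rho>_def fst_conv snd_conv
    by (rule ramp_test_fun[where \<delta>=\<delta> and R=R and \<eta>'=\<eta>'];
        use \<eta>(1,2) eps(1) \<delta> R0 lR2[OF that] in blast)+
  have out: "\<eta> (snd q) * \<rho> j q = 0" if "\<bar>fst q\<bar> > R + \<epsilon>" "j \<le> Suc n" for j q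
  proof (cases "\<eta> (snd q) = 0")
    case False
    then have "\<bar>p j + s j * snd q\<bar> \<le> R" using lR \<eta>X that by auto
    then have "fst q - p j - s j * snd q \<le> 0 \<or> \<epsilon> \<le> fst q - p j - s j * snd q"
      using that(1) eps by linarith
    then have "(fst q - p j - s j * snd q) / \<epsilon> \<le> 0 \<or> 1 \<le> (fst q - p j - s j * snd q) / \<epsilon>"
      using eps by (auto simp: field_simps)
    then show ?thesis by (auto simp: \<rho>_def dstep_outside)
  qed simp
  have out\<sigma>: "\<eta>' (snd q) * (\<sigma> i q - \<sigma> (Suc i) q) = 0" if "\<bar>fst q\<bar> > R + \<epsilon>" "i \<le> n" for i q
  proof (cases "\<eta>' (snd q) = 0")
    case False
    then have r: "\<bar>p i + s i * snd q\<bar> \<le> R" "\<bar>p (Suc i) + s (Suc i) * snd q\<bar> \<le> R"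
      using lR \<eta>X that by auto
    consider "fst q > 0" | "fst q \<le> 0" by linarith
    then have "\<sigma> i q = \<sigma> (Suc i) q"
    proof cases
      case 1
      then have "1 \<le> (fst q - p i - s i * snd q) / \<epsilon>" "1 \<le> (fst q - p (Suc i) - s (Suc i) * snd q) / \<epsilon>"
        using that(1) r eps by (auto simp: field_simps)
      then show ?thesis by (simp add: \<sigma>_def sstep_1)
    next
      case 2
      then have "(fst q - p i - s i * snd q) / \<epsilon> \<le> 0" "(fst q - p (Suc i) - s (Suc i) * snd q) / \<epsilon> \<le> 0"
        using that(1) r eps by (auto simp: field_simps)
      then show ?thesis by (simp add: \<sigma>_def sstep_0)
    qed
    then show ?thesis by simp
  qed simp
  have \<sigma>mono: "\<sigma> (Suc i) q \<le> \<sigma> i q" if "snd q \<in> X" "i \<le> n" for i q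
    unfolding \<sigma>_def using ord[OF that] eps by (intro sstep_mono divide_right_mono) auto
  have \<phi>pos: "0 \<le> \<phi> i x t" if "i \<le> n" for i x t
  proof (cases "t \<in> X")
    case True
    then show ?thesis using \<sigma>mono[of "(x, t)" i] \<eta>(3)[of t] that by (auto simp: \<phi>_def \<sigma>_def)
  qed (use \<eta>(4) in \<open>auto simp: \<phi>_def\<close>)
  define qf where "qf = (\<lambda>w k. sgn (w - k) * (F w - F k))"
  define G where "G = (\<lambda>i q. \<bar>U q - v i\<bar> * dt (\<phi> i) (fst q) (snd q) + qf (U q) (v i) * dx (\<phi> i) (fst q) (snd q))"
  define J where "J = (\<lambda>i x. \<bar>u0 x - v i\<bar> * \<phi> i x 0)"
  obtain B where B: "0 \<le> B" "AE q in lborel. q \<in> Q \<longrightarrow> \<bar>U q\<bar> \<le> B" using U_bound .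
  obtain C where C: "\<And>w. \<bar>w\<bar> \<le> B \<Longrightarrow> \<bar>F w\<bar> \<le> C" using F_bounded[of B] by blast
  have bU: "AE q in lborel. q \<in> Q \<longrightarrow> \<bar>\<bar>U q - k\<bar>\<bar> \<le> B + \<bar>k\<bar>" for k
    using B(2) by eventually_elim auto
  have bq: "AE q in lborel. q \<in> Q \<longrightarrow> \<bar>qf (U q) k\<bar> \<le> C + \<bar>F k\<bar>" for k
    using B(2)
  proof eventually_elim
    case (elim q)
    show ?case
    proof
      assume "q \<in> Q"
      then have "\<bar>F (U q)\<bar> \<le> C" using elim C by auto
      then show "\<bar>qf (U q) k\<bar> \<le> C + \<bar>F k\<bar>" by (auto simp: qf_def sgn_if)
    qed
  qed
  have mqf [measurable]: "(\<lambda>q. qf (U q) k) \<in> borel_measurable borel" for k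
    unfolding qf_def by measurable
  have cdt: "continuous_on UNIV (\<lambda>q. dt (\<phi> i) (fst q) (snd q))"
    and cdx: "continuous_on UNIV (\<lambda>q. dx (\<phi> i) (fst q) (snd q))" if "i \<le> n" for i
    using tf[OF that] by (auto simp: test_fun_def)
  have G_int: "integrable lborel (\<lambda>q. indicator Q q * G i q)" if i: "i \<le> n" for i
  proof -
    have "integrable lborel (\<lambda>q. indicator Q q * (\<bar>U q - v i\<bar> * dt (\<phi> i) (fst q) (snd q)))"
    proof (rule strip_integrable_cont[where R="R + \<epsilon>", OF cdt[OF i] _ bU])
      fix q :: "real \<times> real" assume "\<bar>fst q\<bar> > R + \<epsilon>"
      then show "dt (\<phi> i) (fst q) (snd q) = 0"
        using out\<sigma>[of q i] out[of q i] out[of q "Suc i"] i by (auto simp: dt algebra_simps)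
    qed measurable
    moreover have "integrable lborel (\<lambda>q. indicator Q q * (qf (U q) (v i) * dx (\<phi> i) (fst q) (snd q)))"
    proof (rule strip_integrable_cont[where R="R + \<epsilon>", OF cdx[OF i] _ bq])
      fix q :: "real \<times> real" assume "\<bar>fst q\<bar> > R + \<epsilon>"
      then show "dx (\<phi> i) (fst q) (snd q) = 0"
        using out[of q i] out[of q "Suc i"] i by (auto simp: dx algebra_simps)
    qed measurable
    ultimately show ?thesis
      unfolding G_def by (simp add: distrib_left)
  qed
  have J_int: "integrable lborel (J i)" if "i \<le> n" for i
    unfolding J_def
  proof (rule u0_bounded_box_integrable[where R="R + \<epsilon>" and D="\<eta> 0"])
    show "\<phi> i x 0 = 0" if "R + \<epsilon> < \<bar>x\<bar>" for x using \<phi>0[OF \<open>i \<le> n\<close>] that by auto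
    show "\<bar>\<phi> i x 0\<bar> \<le> \<eta> 0" for x
      using \<eta>(3)[of 0] sstep_ge_0[of "(x - p i) / \<epsilon>"] sstep_le_1[of "(x - p i) / \<epsilon>"]
        sstep_ge_0[of "(x - p (Suc i)) / \<epsilon>"] sstep_le_1[of "(x - p (Suc i)) / \<epsilon>"]
      by (auto simp: \<phi>_def abs_mult intro!: mult_left_le)
    show "(\<lambda>x. \<phi> i x 0) \<in> borel_measurable borel" unfolding \<phi>_def by measurable
  qed
  have kr: "0 \<le> (\<integral>q. indicator Q q * G i q \<partial>lborel) + (\<integral>x. J i x \<partial>lborel)" if i: "i \<le> n" for i
    using ent tf[OF i] \<phi>pos[OF i] unfolding entropy_solution_def G_def qf_def J_def by blast
  have sum: "0 \<le> (\<integral>q. indicator Q q * (\<Sum>i\<le>n. G i q) \<partial>lborel) + (\<integral>x. (\<Sum>i\<le>n. J i x) \<partial>lborel)"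
  proof -
    have "0 \<le> (\<Sum>i\<le>n. (\<integral>q. indicator Q q * G i q \<partial>lborel) + (\<integral>x. J i x \<partial>lborel))"
      using kr by (intro sum_nonneg) auto
    also have "\<dots> = (\<integral>q. (\<Sum>i\<le>n. indicator Q q * G i q) \<partial>lborel) + (\<integral>x. (\<Sum>i\<le>n. J i x) \<partial>lborel)"
    proof -
      have "(\<integral>q. (\<Sum>i\<le>n. indicator Q q * G i q) \<partial>lborel) = (\<Sum>i\<le>n. (\<integral>q. indicator Q q * G i q \<partial>lborel))"
        using G_int by (intro Bochner_Integration.integral_sum) auto
      moreover have "(\<integral>x. (\<Sum>i\<le>n. J i x) \<partial>lborel) = (\<Sum>i\<le>n. (\<integral>x. J i x \<partial>lborel))"
        using J_int by (intro Bochner_Integration.integral_sum) auto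
      ultimately show ?thesis by (simp only: sum.distrib)
    qed
    finally show ?thesis by (simp add: sum_distrib_left)
  qed
  define M where "M = (\<lambda>q. \<eta>' (snd q) * (\<Sum>i\<le>n. \<bar>U q - v i\<bar> * (\<sigma> i q - \<sigma> (Suc i) q)))"
  define E where "E = (\<lambda>q. \<Sum>j=1..n. e j * (\<eta> (snd q) * \<rho> j q))"
  have M_int: "integrable lborel (\<lambda>q. indicator Q q * M q)"
  proof -
    have "integrable lborel (\<lambda>q. \<Sum>i\<le>n. indicator Q q * (\<bar>U q - v i\<bar> * (\<eta>' (snd q) * (\<sigma> i q - \<sigma> (Suc i) q))))"
    proof (rule Bochner_Integration.integrable_sum)
      fix i assume "i \<in> {..n}"
      then show "integrable lborel (\<lambda>q. indicator Q q * (\<bar>U q - v i\<bar> * (\<eta>' (snd q) * (\<sigma> i q - \<sigma> (Suc i) q))))"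
        by (intro strip_integrable_cont[where R="R + \<epsilon>", OF _ _ bU] continuous_intros c\<sigma>
            continuous_on_compose2[OF \<eta>(2)] out\<sigma>) auto
    qed
    then show ?thesis by (simp add: M_def sum_distrib_left mult_ac)
  qed
  have \<rho>_int: "integrable lborel (\<lambda>q. indicator Q q * (\<eta> (snd q) * \<rho> j q))" if "j \<le> Suc n" for j
  proof -
    have "integrable lborel (\<lambda>q. indicator Q q * (1 * (\<eta> (snd q) * \<rho> j q)))"
      using that by (intro strip_integrable_cont[where R="R + \<epsilon>" and C=1] continuous_intros c\<rho>
            continuous_on_compose2[OF c\<eta>] out) auto
    then show ?thesis by simp
  qed
  have E_int: "integrable lborel (\<lambda>q. indicator Q q * E q)"
  proof -
    have "integrable lborel (\<lambda>q. \<Sum>j=1..n. e j * (indicator Q q * (\<eta> (snd q) * \<rho> j q)))"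
      by (intro Bochner_Integration.integrable_sum integrable_mult_right \<rho>_int) auto
    then show ?thesis by (simp add: E_def sum_distrib_left mult_ac)
  qed
  have key: "AE q in lborel. indicator Q q * (\<Sum>i\<le>n. G i q) \<le> indicator Q q * M q + indicator Q q * E q"
    using jump U_outside
  proof eventually_elim
    case (elim q)
    show ?case
    proof (cases "q \<in> Q")
      case True
      define a where "a = (\<lambda>i j. \<rho> j q * (qf (U q) (v i) - s j * \<bar>U q - v i\<bar>))"
      have jumps: "(\<Sum>j=1..n. a j j - a (j - 1) j) \<le> (\<Sum>j=1..n. e j * \<rho> j q)"
      proof (rule sum_mono)
        fix j assume "j \<in> {1..n}"
        then have "jmp F (s j) (v (j - 1)) (v j) (U q) \<le> e j" using elim True by auto
        then have "\<rho> j q * jmp F (s j) (v (j - 1)) (v j) (U q) \<le> \<rho> j q * e j"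
          using dstep_nonneg eps by (intro mult_left_mono) (auto simp: \<rho>_def)
        then show "a j j - a (j - 1) j \<le> e j * \<rho> j q"
          by (simp add: a_def jmp_def qf_def algebra_simps)
      qed
      have "(\<Sum>i\<le>n. G i q) = (\<Sum>i\<le>n. \<eta>' (snd q) * (\<bar>U q - v i\<bar> * (\<sigma> i q - \<sigma> (Suc i) q)) + \<eta> (snd q) * (a i i - a i (Suc i)))"
        by (intro sum.cong refl) (auto simp: G_def dx dt a_def algebra_simps)
      also have "\<dots> = M q + \<eta> (snd q) * (\<Sum>i\<le>n. a i i - a i (Suc i))"
        by (simp add: sum.distrib sum_distrib_left M_def)
      also have "(\<Sum>i\<le>n. a i i - a i (Suc i)) = a 0 0 - a n (Suc n) + (\<Sum>j=1..n. a j j - a (j - 1) j)"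
        by (rule abel_sum)
      also have "a 0 0 = 0"
      proof (cases "fst q \<in> {0<..<1}")
        case False
        then show ?thesis using elim True ends by (auto simp: a_def qf_def)
      next
        case True
        then have "1 \<le> (fst q - p 0 - s 0 * snd q) / \<epsilon>" using ends eps by (auto simp: field_simps)
        then show ?thesis by (simp add: a_def \<rho>_def dstep_outside)
      qed
      also have "a n (Suc n) = 0"
      proof (cases "fst q \<in> {0<..<1}")
        case False
        then show ?thesis using elim True ends by (auto simp: a_def qf_def)
      next
        case True
        then have "(fst q - p (Suc n) - s (Suc n) * snd q) / \<epsilon> \<le> 0" using ends eps by (auto simp: field_simps)
        then show ?thesis by (simp add: a_def \<rho>_def dstep_outside)
      qed
      also have "M q + \<eta> (snd q) * (0 - 0 + (\<Sum>j=1..n. a j j - a (j - 1) j))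
          \<le> M q + \<eta> (snd q) * (\<Sum>j=1..n. e j * \<rho> j q)"
        using jumps \<eta>(3) by (simp add: mult_left_mono)
      finally show ?thesis using True by (simp add: E_def sum_distrib_left mult_ac)
    qed auto
  qed
  have "(\<integral>q. indicator Q q * (\<Sum>i\<le>n. G i q) \<partial>lborel) \<le> (\<integral>q. indicator Q q * M q + indicator Q q * E q \<partial>lborel)"
  proof (rule integral_mono_AE[OF _ _ key])
    have "integrable lborel (\<lambda>q. \<Sum>i\<le>n. indicator Q q * G i q)"
      using G_int by (intro Bochner_Integration.integrable_sum) auto
    then show "integrable lborel (\<lambda>q. indicator Q q * (\<Sum>i\<le>n. G i q))" by (simp add: sum_distrib_left)
  qed (use M_int E_int in auto)
  also have "\<dots> = (\<integral>q. indicator Q q * M q \<partial>lborel) + (\<integral>q. indicator Q q * E q \<partial>lborel)"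
    using M_int E_int by simp
  also have "(\<integral>q. indicator Q q * E q \<partial>lborel) = (\<Sum>j=1..n. e j * (\<integral>q. indicator Q q * (\<eta> (snd q) * \<rho> j q) \<partial>lborel))"
  proof -
    have "(\<integral>q. indicator Q q * E q \<partial>lborel) = (\<integral>q. (\<Sum>j=1..n. e j * (indicator Q q * (\<eta> (snd q) * \<rho> j q))) \<partial>lborel)"
      by (simp add: E_def sum_distrib_left mult_ac)
    also have "\<dots> = (\<Sum>j=1..n. (\<integral>q. e j * (indicator Q q * (\<eta> (snd q) * \<rho> j q)) \<partial>lborel))"
      by (intro Bochner_Integration.integral_sum integrable_mult_right \<rho>_int) auto
    finally show ?thesis by simp
  qed
  also have "\<dots> = (\<Sum>j=1..n. e j * (\<integral>t. indicator {0<..<T} t * \<eta> t \<partial>lborel))"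
  proof (intro sum.cong refl arg_cong2[where f="(*)"])
    fix j assume j: "j \<in> {1..n}"
    let ?f = "\<lambda>x t. indicator Q (x, t) * (\<eta> t * \<rho> j (x, t))"
    have i: "integrable (lborel \<Otimes>\<^sub>M lborel) (case_prod ?f)"
      using \<rho>_int[of j] j unfolding lborel_prod by (simp add: case_prod_beta')
    have "(\<integral>q. indicator Q q * (\<eta> (snd q) * \<rho> j q) \<partial>lborel) = (\<integral>q. case_prod ?f q \<partial>(lborel \<Otimes>\<^sub>M lborel))"
      unfolding lborel_prod by (simp add: case_prod_beta')
    also have "\<dots> = (\<integral>t. (\<integral>x. ?f x t \<partial>lborel) \<partial>lborel)"
      using lborel_pair.integral_snd[OF i] by simp
    also have "(\<lambda>t. (\<integral>x. ?f x t \<partial>lborel)) = (\<lambda>t. indicator {0<..<T} t * \<eta> t)"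
    proof
      fix t
      have "(\<integral>x. ?f x t \<partial>lborel) = (\<integral>x. (indicator {0<..<T} t * \<eta> t) * (dstep ((x - (p j + s j * t)) / \<epsilon>) / \<epsilon>) \<partial>lborel)"
        by (intro Bochner_Integration.integral_cong refl) (auto simp: \<rho>_def indicator_def algebra_simps)
      also have "\<dots> = indicator {0<..<T} t * \<eta> t"
        using has_bochner_integral_integral_eq[OF has_bochner_integral_dstep[OF eps(1)]] by simp
      finally show "(\<integral>x. ?f x t \<partial>lborel) = indicator {0<..<T} t * \<eta> t" .
    qed
    finally show "(\<integral>q. indicator Q q * (\<eta> (snd q) * \<rho> j q) \<partial>lborel) = (\<integral>t. indicator {0<..<T} t * \<eta> t \<partial>lborel)" .
  qed
  finally have 1: "(\<integral>q. indicator Q q * (\<Sum>i\<le>n. G i q) \<partial>lborel) \<le> (\<integral>q. indicator Q q * M q \<partial>lborel)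
      + (\<Sum>j=1..n. e j) * (\<integral>t. indicator {0<..<T} t * \<eta> t \<partial>lborel)"
    by (simp add: sum_distrib_right)
  have 2: "(\<lambda>x. \<Sum>i\<le>n. J i x) = (\<lambda>x. \<eta> 0 * (\<Sum>i\<le>n. \<bar>u0 x - v i\<bar> * (\<sigma> i (x, 0) - \<sigma> (Suc i) (x, 0))))"
    by (auto simp: J_def \<phi>_def \<sigma>_def sum_distrib_left algebra_simps)
  show ?thesis using sum 1 unfolding 2 M_def by linarith
qed

end

definition stp :: "nat \<Rightarrow> (nat \<Rightarrow> real) \<Rightarrow> (nat \<Rightarrow> real) \<Rightarrow> (nat \<Rightarrow> real) \<Rightarrow> real \<Rightarrow> real \<Rightarrow> real" where
  "stp n p s v x t = (\<Sum>j=1..n. (v j - v (j - 1)) * heav (x - p j - s j * t))"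

lemma telescope_Suc:
  fixes v :: "nat \<Rightarrow> real"
  shows "(\<Sum>j=1..n. v j - v (j - 1)) = v n - v 0"
  by (induction n) auto

lemma region_sum:
  assumes ends: "p 0 \<le> -1" "s 0 = 0" "1 \<le> p (Suc n)" "s (Suc n) = 0" "v 0 = 0" "v n = 0"
    and ord: "\<And>i. i \<le> n \<Longrightarrow> p i + s i * t \<le> p (Suc i) + s (Suc i) * t"
    and w: "x \<notin> {0<..<1} \<Longrightarrow> w = 0"
  shows "(\<Sum>i\<le>n. \<bar>w - v i\<bar> * (heav (x - p i - s i * t) - heav (x - p (Suc i) - s (Suc i) * t)))
     = \<bar>w - stp n p s v x t\<bar>"
proof -
  define h where "h = (\<lambda>i. heav (x - p i - s i * t))"
  have h01: "h i = 0 \<or> h i = 1" for i by (auto simp: h_def heav_def)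
  have ord': "p i + s i * t \<le> p j + s j * t" if "i \<le> j" "j \<le> Suc n" for i j
    using that
  proof (induction j)
    case (Suc j)
    then show ?case using ord[of j] by (cases "i = Suc j") auto
  qed simp
  have hm: "h j \<le> h i" if "i \<le> j" "j \<le> Suc n" for i j
    using ord'[OF that] by (auto simp: h_def heav_def)
  consider "h 0 = 0" | "h (Suc n) = 1" | "h 0 = 1" "h (Suc n) = 0" using h01 by blast
  then have "(\<Sum>i\<le>n. \<bar>w - v i\<bar> * (h i - h (Suc i))) = \<bar>w - (\<Sum>j=1..n. (v j - v (j - 1)) * h j)\<bar>"
  proof cases
    case 1
    then have z: "h i = 0" if "i \<le> Suc n" for i using hm[of 0 i] h01[of i] that by auto
    have "x \<le> p 0" using 1 ends by (auto simp: h_def heav_def split: if_splits)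
    then have "w = 0" using w ends by auto
    then show ?thesis using z by simp
  next
    case 2
    then have z: "h i = 1" if "i \<le> Suc n" for i using hm[of i "Suc n"] h01[of i] that by auto
    have "x > p (Suc n)" using 2 ends by (auto simp: h_def heav_def split: if_splits)
    then have "w = 0" using w ends by auto
    then show ?thesis using z ends telescope_Suc[of v n] by simp
  next
    case 3
    define m where "m = (GREATEST i. i \<le> n \<and> h i = 1)"
    have m: "m \<le> n \<and> h m = 1"
      unfolding m_def by (rule GreatestI_nat[where b=n and k=0]) (use 3 in auto)
    have mm: "i \<le> m" if "i \<le> n" "h i = 1" for i
      unfolding m_def by (rule Greatest_le_nat[where b=n]) (use that in auto)
    have h1: "h i = 1" if "i \<le> m" for i using hm[of i m] h01[of i] that m by auto
    have h0: "h i = 0" if "m < i" "i \<le> Suc n" for i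
      using h01[of i] mm[of i] that 3 by (cases "i = Suc n") auto
    have "(\<Sum>i\<le>n. \<bar>w - v i\<bar> * (h i - h (Suc i))) = (\<Sum>i\<in>{m}. \<bar>w - v i\<bar> * (h i - h (Suc i)))"
    proof (rule sum.mono_neutral_right)
      show "\<forall>i\<in>{..n} - {m}. \<bar>w - v i\<bar> * (h i - h (Suc i)) = 0"
      proof
        fix i assume "i \<in> {..n} - {m}"
        then have "Suc i \<le> m \<or> m < i" "i \<le> n" by auto
        then show "\<bar>w - v i\<bar> * (h i - h (Suc i)) = 0" using h1[of i] h1[of "Suc i"] h0[of i] h0[of "Suc i"] by auto
      qed
    qed (use m in auto)
    also have "\<dots> = \<bar>w - v m\<bar>" using h1[of m] h0[of "Suc m"] m by simp
    also have "v m = (\<Sum>j=1..m. v j - v (j - 1))" using telescope_Suc[of v m] ends by simp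
    also have "\<dots> = (\<Sum>j=1..m. (v j - v (j - 1)) * h j)" using h1 by (intro sum.cong) auto
    also have "\<dots> = (\<Sum>j=1..n. (v j - v (j - 1)) * h j)"
      using m h0 by (intro sum.mono_neutral_left) auto
    finally show ?thesis .
  qed
  then show ?thesis by (simp add: h_def stp_def)
qed

lemma heav_shift_integral:
  "integrable lborel (\<lambda>x. heav (x - a) - heav (x - b))"
  "(\<integral>x. \<bar>heav (x - a) - heav (x - b)\<bar> \<partial>lborel) = \<bar>a - b\<bar>"
proof -
  have e: "(\<lambda>x. \<bar>heav (x - a) - heav (x - b)\<bar>) = (\<lambda>x. indicator {min a b<..max a b} x)"
    by (intro ext) (auto simp: heav_def indicator_def min_def max_def)
  have i: "integrable lborel (\<lambda>x. indicator {min a b<..max a b} x :: real)"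
    by (auto simp: emeasure_lborel_Ioc)
  show "integrable lborel (\<lambda>x. heav (x - a) - heav (x - b))"
    using i by (rule Bochner_Integration.integrable_bound)
      (auto simp: heav_def indicator_def intro!: AE_I2)
  show "(\<integral>x. \<bar>heav (x - a) - heav (x - b)\<bar> \<partial>lborel) = \<bar>a - b\<bar>"
    unfolding e by (simp add: measure_def emeasure_lborel_Ioc)
qed

lemma stp_meas [measurable]: "(\<lambda>q. stp n p s v (fst q) (snd q)) \<in> borel_measurable borel"
  "(\<lambda>x. stp n p s v x t) \<in> borel_measurable borel"
  unfolding stp_def by measurable

lemma stp_integrable:
  assumes "v 0 = 0" "v n = 0"
  shows "integrable lborel (\<lambda>x. stp n p s v x t)"
proof -
  have "stp n p s v x t = (\<Sum>j=1..n. (v j - v (j - 1)) * (heav (x - (p j + s j * t)) - heav (x - 0)))" for x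
    using telescope_Suc[of v n] assms
    by (simp add: stp_def right_diff_distrib sum_subtractf flip: sum_distrib_right) (simp add: algebra_simps)
  then show ?thesis
    by (simp only:) (intro Bochner_Integration.integrable_sum integrable_mult_right heav_shift_integral)
qed

lemma stp_time_diff:
  shows "integrable lborel (\<lambda>x. stp n p s v x t - stp n p s v x t')"
    and "(\<integral>x. \<bar>stp n p s v x t - stp n p s v x t'\<bar> \<partial>lborel) \<le> (\<Sum>j=1..n. \<bar>v j - v (j - 1)\<bar> * \<bar>s j\<bar>) * \<bar>t - t'\<bar>"
proof -
  have d: "stp n p s v x t - stp n p s v x t' = (\<Sum>j=1..n. (v j - v (j - 1)) * (heav (x - (p j + s j * t)) - heav (x - (p j + s j * t'))))" for x
    by (simp add: stp_def right_diff_distrib sum_subtractf diff_diff_eq)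
  show i: "integrable lborel (\<lambda>x. stp n p s v x t - stp n p s v x t')"
    unfolding d by (intro Bochner_Integration.integrable_sum integrable_mult_right heav_shift_integral)
  have "(\<integral>x. \<bar>stp n p s v x t - stp n p s v x t'\<bar> \<partial>lborel)
     \<le> (\<integral>x. (\<Sum>j=1..n. \<bar>v j - v (j - 1)\<bar> * \<bar>heav (x - (p j + s j * t)) - heav (x - (p j + s j * t'))\<bar>) \<partial>lborel)"
    using i
    by (intro integral_mono integrable_abs Bochner_Integration.integrable_sum integrable_mult_right heav_shift_integral)
      (auto simp: d abs_mult intro!: order_trans[OF sum_abs])
  also have "\<dots> = (\<Sum>j=1..n. \<bar>v j - v (j - 1)\<bar> * \<bar>(p j + s j * t) - (p j + s j * t')\<bar>)"
    by (subst Bochner_Integration.integral_sum)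
      (auto intro!: integrable_mult_right integrable_abs heav_shift_integral simp: heav_shift_integral)
  also have "\<dots> = (\<Sum>j=1..n. \<bar>v j - v (j - 1)\<bar> * \<bar>s j\<bar>) * \<bar>t - t'\<bar>"
    unfolding sum_distrib_right
  proof (intro sum.cong refl)
    fix j
    have "p j + s j * t - (p j + s j * t') = s j * (t - t')" by (simp add: algebra_simps)
    then show "\<bar>v j - v (j - 1)\<bar> * \<bar>p j + s j * t - (p j + s j * t')\<bar> = \<bar>v j - v (j - 1)\<bar> * \<bar>s j\<bar> * \<bar>t - t'\<bar>"
      by (simp only: abs_mult mult.assoc)
  qed
  finally show "(\<integral>x. \<bar>stp n p s v x t - stp n p s v x t'\<bar> \<partial>lborel) \<le> (\<Sum>j=1..n. \<bar>v j - v (j - 1)\<bar> * \<bar>s j\<bar>) * \<bar>t - t'\<bar>" .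
qed

lemma sstep_lim: "(\<lambda>k. sstep (z / inverse (real (Suc k)))) \<longlonglongrightarrow> heav z"
proof (cases "z > 0")
  case True
  obtain N where N: "1 / z < real N" using reals_Archimedean2 by blast
  have "\<forall>\<^sub>F k in sequentially. sstep (z / inverse (real (Suc k))) = heav z"
    using eventually_ge_at_top[of N]
  proof eventually_elim
    case (elim k)
    then have "1 / z \<le> real (Suc k)" using N by auto
    then have "1 \<le> z / inverse (real (Suc k))" using True by (simp add: field_simps)
    then show ?case using True by (simp add: sstep_1 heav_def)
  qed
  then show ?thesis by (rule tendsto_eventually)
next
  case False
  then have "z / inverse (real (Suc k)) \<le> 0" for k
    by (intro divide_nonpos_pos) auto
  then have "(\<lambda>k. sstep (z / inverse (real (Suc k)))) = (\<lambda>k. heav z)"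
    using False by (intro ext) (simp add: sstep_0 heav_def del: of_nat_Suc)
  then show ?thesis by simp
qed

lemma sstep_diff_outside:
  assumes "\<bar>a\<bar> \<le> R" "\<bar>b\<bar> \<le> R" "0 < \<epsilon>" "\<epsilon> \<le> 1" "\<bar>x\<bar> > R + 1"
  shows "sstep ((x - a) / \<epsilon>) = sstep ((x - b) / \<epsilon>)"
proof (cases "x > 0")
  case True
  then have "1 \<le> (x - a) / \<epsilon>" "1 \<le> (x - b) / \<epsilon>" using assms by (auto simp: field_simps)
  then show ?thesis by (simp add: sstep_1)
next
  case False
  then have "(x - a) / \<epsilon> \<le> 0" "(x - b) / \<epsilon> \<le> 0" using assms by (auto simp: field_simps)
  then show ?thesis by (simp add: sstep_0)
qed

context entropy_setting
begin

lemma u_integrable: "t \<in> {0<..<T} \<Longrightarrow> integrable lborel (\<lambda>x. u x t)"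
  using tcont by (auto simp: L1_time_continuous_def)

lemma kato_weak:
  fixes p s v e :: "nat \<Rightarrow> real" and \<eta> \<eta>' :: "real \<Rightarrow> real"
  assumes ends: "p 0 \<le> -1" "s 0 = 0" "1 \<le> p (Suc n)" "s (Suc n) = 0" "v 0 = 0" "v n = 0"
    and ord: "\<And>t i. t \<in> X \<Longrightarrow> i \<le> n \<Longrightarrow> p i + s i * t \<le> p (Suc i) + s (Suc i) * t"
    and \<eta>: "\<And>t. (\<eta> has_real_derivative \<eta>' t) (at t)" "continuous_on UNIV \<eta>'" "\<And>t. 0 \<le> \<eta> t"
       "\<And>t. t \<notin> X \<Longrightarrow> \<eta> t = 0 \<and> \<eta>' t = 0"
    and \<delta>: "0 < \<delta>" "\<And>t. T - \<delta> \<le> t \<Longrightarrow> \<eta> t = 0"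
    and jump: "AE q in lborel. q \<in> Q \<longrightarrow> (\<forall>j\<in>{1..n}. jmp F (s j) (v (j - 1)) (v j) (U q) \<le> e j)"
  defines "A \<equiv> \<lambda>t. \<integral>x. \<bar>u x t - stp n p s v x t\<bar> \<partial>lborel"
  shows "integrable lborel (\<lambda>t. indicator {0<..<T} t * (\<eta>' t * A t))"
    and "0 \<le> (\<integral>t. indicator {0<..<T} t * (\<eta>' t * A t) \<partial>lborel)
     + (\<Sum>j=1..n. e j) * (\<integral>t. indicator {0<..<T} t * \<eta> t \<partial>lborel)
     + \<eta> 0 * (\<integral>x. \<bar>u0 x - stp n p s v x 0\<bar> \<partial>lborel)"
proof -
  define R where "R = max (- p 0) (p (Suc n))"
  have ord': "p i + s i * t \<le> p j + s j * t" if "t \<in> X" "i \<le> j" "j \<le> Suc n" for t i j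
    using that(2,3)
  proof (induction j)
    case (Suc j)
    then show ?case using ord[OF that(1), of j] by (cases "i = Suc j") auto
  qed simp
  have lR: "\<bar>p j + s j * t\<bar> \<le> R" if "t \<in> X" "j \<le> Suc n" for t j
    using ord'[OF that(1), of 0 j] ord'[OF that(1), of j "Suc n"] that(2) ends by (auto simp: R_def)
  have \<eta>X: "t \<in> X" if "\<eta> t \<noteq> 0 \<or> \<eta>' t \<noteq> 0" for t using \<eta>(4) that by blast
  have m\<eta> [measurable]: "\<eta>' \<in> borel_measurable borel"
    using \<eta>(2) by (auto intro: borel_measurable_continuous_onI)
  have [measurable]: "u0 \<in> borel_measurable borel" using u0_int by auto
  define \<sigma> where "\<sigma> = (\<lambda>k j q. sstep ((fst q - p j - s j * snd q) / inverse (real (Suc k))))"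
  define H where "H = (\<lambda>j q. heav (fst q - p j - s j * snd q))"
  have [measurable]: "\<sigma> k j \<in> borel_measurable borel" "H j \<in> borel_measurable borel" for k j
    unfolding \<sigma>_def H_def by measurable
  have \<sigma>lim: "(\<lambda>k. \<sigma> k j q) \<longlonglongrightarrow> H j q" for j q
    unfolding \<sigma>_def H_def by (rule sstep_lim)
  have \<sigma>diff: "\<bar>\<sigma> k i q - \<sigma> k (Suc i) q\<bar> \<le> indicator {-(R+1)..R+1} (fst q)"
    if "snd q \<in> X" "i \<le> n" for k i q
  proof (cases "\<bar>fst q\<bar> > R + 1")
    case True
    have "inverse (real (Suc k)) \<le> 1" by (simp add: field_simps)
    then have "\<sigma> k i q = \<sigma> k (Suc i) q"
      using sstep_diff_outside[of "p i + s i * snd q" R "p (Suc i) + s (Suc i) * snd q" "inverse (real (Suc k))" "fst q"]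
        lR[OF that(1)] that(2) True by (auto simp: \<sigma>_def algebra_simps simp del: of_nat_Suc)
    then show ?thesis by simp
  next
    case False
    have "0 \<le> \<sigma> k j q" "\<sigma> k j q \<le> 1" for j unfolding \<sigma>_def by (rule sstep_ge_0 sstep_le_1)+
    from this[of i] this[of "Suc i"] False show ?thesis by (auto simp: indicator_def abs_le_iff)
  qed
  define f where "f = (\<lambda>k q. indicator Q q * (\<eta>' (snd q) * (\<Sum>i\<le>n. \<bar>U q - v i\<bar> * (\<sigma> k i q - \<sigma> k (Suc i) q))))"
  define f0 where "f0 = (\<lambda>q. indicator Q q * (\<eta>' (snd q) * (\<Sum>i\<le>n. \<bar>U q - v i\<bar> * (H i q - H (Suc i) q))))"
  define g where "g = (\<lambda>k x. \<eta> 0 * (\<Sum>i\<le>n. \<bar>u0 x - v i\<bar> * (\<sigma> k i (x, 0) - \<sigma> k (Suc i) (x, 0))))"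
  define g0 where "g0 = (\<lambda>x. \<eta> 0 * (\<Sum>i\<le>n. \<bar>u0 x - v i\<bar> * (H i (x, 0) - H (Suc i) (x, 0))))"
  have [measurable]: "f k \<in> borel_measurable borel" "f0 \<in> borel_measurable borel"
    "g k \<in> borel_measurable borel" "g0 \<in> borel_measurable borel" for k
    unfolding f_def f0_def g_def g0_def by measurable
  have ineq: "0 \<le> (\<integral>q. f k q \<partial>lborel) + (\<Sum>j=1..n. e j) * (\<integral>t. indicator {0<..<T} t * \<eta> t \<partial>lborel) + (\<integral>x. g k x \<partial>lborel)" for k
    unfolding f_def g_def \<sigma>_def
    by (rule kato_mollified[OF ends ord \<eta> \<delta> jump]) (auto simp: field_simps)
  have flim: "(\<lambda>k. f k q) \<longlonglongrightarrow> f0 q" for q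
    unfolding f_def f0_def by (intro tendsto_intros \<sigma>lim)
  have glim: "(\<lambda>k. g k x) \<longlonglongrightarrow> g0 x" for x
    unfolding g_def g0_def by (intro tendsto_intros \<sigma>lim)
  obtain B where B: "0 \<le> B" "AE q in lborel. q \<in> Q \<longrightarrow> \<bar>U q\<bar> \<le> B" using U_bound .
  have "compact (\<eta>' ` {0..T})" by (intro compact_continuous_image continuous_on_subset[OF \<eta>(2)]) auto
  then obtain C where C: "\<And>y. y \<in> \<eta>' ` {0..T} \<Longrightarrow> \<bar>y\<bar> \<le> C"
    by (metis compact_imp_bounded bounded_iff real_norm_def)
  define w where "w = (\<lambda>q. indicator Q q * ((\<Sum>i\<le>n. \<bar>U q - v i\<bar>) * (\<bar>C\<bar> * indicator {-(R+1)..R+1} (fst q))))"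
  have w_int: "integrable lborel w"
    unfolding w_def
  proof (rule strip_integrable[where R="R+1" and D="\<bar>C\<bar>" and C="\<Sum>i\<le>n. B + \<bar>v i\<bar>"])
    show "AE q in lborel. q \<in> Q \<longrightarrow> \<bar>\<Sum>i\<le>n. \<bar>U q - v i\<bar>\<bar> \<le> (\<Sum>i\<le>n. B + \<bar>v i\<bar>)"
      using B(2)
    proof eventually_elim
      case (elim q)
      then show ?case by (auto intro!: sum_mono order_trans[OF sum_abs])
    qed
  qed (auto simp: indicator_def)
  have fw: "norm (f k q) \<le> w q" for k q
  proof (cases "q \<in> Q \<and> \<eta>' (snd q) \<noteq> 0")
    case True
    then have X: "snd q \<in> X" using \<eta>X by auto
    have "\<eta>' (snd q) \<in> \<eta>' ` {0..T}" using True by (intro imageI) auto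
    then have c: "\<bar>\<eta>' (snd q)\<bar> \<le> \<bar>C\<bar>" using C by fastforce
    have "\<bar>\<Sum>i\<le>n. \<bar>U q - v i\<bar> * (\<sigma> k i q - \<sigma> k (Suc i) q)\<bar> \<le> (\<Sum>i\<le>n. \<bar>U q - v i\<bar>) * indicator {-(R+1)..R+1} (fst q)"
      unfolding sum_distrib_right using \<sigma>diff[OF X] by (intro order_trans[OF sum_abs] sum_mono) (auto simp: abs_mult intro!: mult_left_mono)
    then have "\<bar>\<eta>' (snd q)\<bar> * \<bar>\<Sum>i\<le>n. \<bar>U q - v i\<bar> * (\<sigma> k i q - \<sigma> k (Suc i) q)\<bar> \<le> \<bar>C\<bar> * ((\<Sum>i\<le>n. \<bar>U q - v i\<bar>) * indicator {-(R+1)..R+1} (fst q))"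
      using c by (intro mult_mono) auto
    then show ?thesis using True by (simp add: f_def w_def abs_mult mult_ac)
  next
    case False
    then show ?thesis by (auto simp: f_def w_def intro!: mult_nonneg_nonneg sum_nonneg)
  qed
  have F1: "integrable lborel f0" and F2: "(\<lambda>k. \<integral>q. f k q \<partial>lborel) \<longlonglongrightarrow> (\<integral>q. f0 q \<partial>lborel)"
    using integrable_dominated_convergence[of f0 lborel f w] integral_dominated_convergence[of f0 lborel f w]
      w_int flim fw by auto
  define z where "z = (\<lambda>x. \<Sum>i\<le>n. \<bar>u0 x - v i\<bar> * (\<eta> 0 * indicator {-(R+1)..R+1} x))"
  have z_int: "integrable lborel z"
    unfolding z_def
  proof (rule Bochner_Integration.integrable_sum)
    fix i
    show "integrable lborel (\<lambda>x. \<bar>u0 x - v i\<bar> * (\<eta> 0 * indicator {-(R+1)..R+1} x))"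
      by (rule u0_bounded_box_integrable[where R="R+1" and D="\<eta> 0"]) (use \<eta>(3) in \<open>auto simp: indicator_def\<close>)
  qed
  have gz: "norm (g k x) \<le> z x" for k x
  proof (cases "\<eta> 0 = 0")
    case False
    then have X: "0 \<in> X" using \<eta>X by auto
    have "\<bar>\<Sum>i\<le>n. \<bar>u0 x - v i\<bar> * (\<sigma> k i (x, 0) - \<sigma> k (Suc i) (x, 0))\<bar> \<le> (\<Sum>i\<le>n. \<bar>u0 x - v i\<bar>) * indicator {-(R+1)..R+1} x"
      unfolding sum_distrib_right using \<sigma>diff[of "(x, 0)"] X by (intro order_trans[OF sum_abs] sum_mono) (auto simp: abs_mult intro!: mult_left_mono)
    then have "\<eta> 0 * \<bar>\<Sum>i\<le>n. \<bar>u0 x - v i\<bar> * (\<sigma> k i (x, 0) - \<sigma> k (Suc i) (x, 0))\<bar> \<le> \<eta> 0 * ((\<Sum>i\<le>n. \<bar>u0 x - v i\<bar>) * indicator {-(R+1)..R+1} x)"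
      using \<eta>(3) by (intro mult_left_mono) auto
    then show ?thesis using \<eta>(3)[of 0]
      unfolding g_def z_def sum_distrib_right[symmetric] by (simp add: abs_mult mult_ac)
  qed (simp add: g_def z_def)
  have G2: "(\<lambda>k. \<integral>x. g k x \<partial>lborel) \<longlonglongrightarrow> (\<integral>x. g0 x \<partial>lborel)"
    using integral_dominated_convergence[of g0 lborel g z] z_int glim gz by auto
  have lim: "0 \<le> (\<integral>q. f0 q \<partial>lborel) + (\<Sum>j=1..n. e j) * (\<integral>t. indicator {0<..<T} t * \<eta> t \<partial>lborel) + (\<integral>x. g0 x \<partial>lborel)"
    by (rule LIMSEQ_le_const[OF tendsto_add[OF tendsto_add[OF F2 tendsto_const] G2]]) (use ineq in auto)
  have g0: "(\<integral>x. g0 x \<partial>lborel) = \<eta> 0 * (\<integral>x. \<bar>u0 x - stp n p s v x 0\<bar> \<partial>lborel)"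
  proof (cases "\<eta> 0 = 0")
    case False
    then have X: "0 \<in> X" using \<eta>X by auto
    have "g0 x = \<eta> 0 * \<bar>u0 x - stp n p s v x 0\<bar>" for x
      unfolding g0_def H_def fst_conv snd_conv using region_sum[OF ends ord[OF X] u0_out] by simp
    then show ?thesis by simp
  qed (simp add: g0_def)
  define r where "r = (\<lambda>x t. indicator {0<..<T} t * (\<eta>' t * \<bar>u x t - stp n p s v x t\<bar>))"
  have AE: "AE q in lborel. f0 q = r (fst q) (snd q)"
    using U_outside
  proof eventually_elim
    case (elim q)
    show ?case
    proof (cases "q \<in> Q \<and> \<eta>' (snd q) \<noteq> 0")
      case True
      then have X: "snd q \<in> X" using \<eta>X by auto
      show ?thesis
        unfolding f0_def H_def r_def
        using region_sum[OF ends ord[OF X], of "fst q" "U q"] elim True by (auto simp: indicator_def)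
    qed (auto simp: f0_def r_def indicator_def mem_Times_iff)
  qed
  have mr [measurable]: "(\<lambda>q. r (fst q) (snd q)) \<in> borel_measurable borel"
    unfolding r_def by measurable
  have ri: "integrable lborel (\<lambda>q. r (fst q) (snd q))"
    using F1 AE by (subst integrable_cong_AE[of _ _ f0]) auto
  have re: "(\<integral>q. f0 q \<partial>lborel) = (\<integral>q. r (fst q) (snd q) \<partial>lborel)"
    using AE by (intro integral_cong_AE) auto
  have i: "integrable (lborel \<Otimes>\<^sub>M lborel) (case_prod r)"
    using ri unfolding lborel_prod by (simp add: case_prod_beta')
  have inner: "(\<integral>x. r x t \<partial>lborel) = indicator {0<..<T} t * (\<eta>' t * A t)" for t
    by (simp add: r_def A_def)
  show "integrable lborel (\<lambda>t. indicator {0<..<T} t * (\<eta>' t * A t))"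
    using lborel_pair.integrable_snd[OF i] unfolding inner .
  have "(\<integral>t. indicator {0<..<T} t * (\<eta>' t * A t) \<partial>lborel) = (\<integral>q. case_prod r q \<partial>(lborel \<Otimes>\<^sub>M lborel))"
    using lborel_pair.integral_snd[OF i] unfolding inner .
  also have "\<dots> = (\<integral>q. f0 q \<partial>lborel)"
    unfolding lborel_prod re by (simp add: case_prod_beta')
  finally show "0 \<le> (\<integral>t. indicator {0<..<T} t * (\<eta>' t * A t) \<partial>lborel)
     + (\<Sum>j=1..n. e j) * (\<integral>t. indicator {0<..<T} t * \<eta> t \<partial>lborel)
     + \<eta> 0 * (\<integral>x. \<bar>u0 x - stp n p s v x 0\<bar> \<partial>lborel)"
    using lim unfolding g0 by simp
qed

end

lemma sstep_scaled_deriv: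
  assumes "0 < h"
  shows "((\<lambda>t. sstep ((t - a) / h)) has_real_derivative dstep ((t - a) / h) / h) (at t)"
proof -
  have "((\<lambda>t. (t - a) / h) has_real_derivative 1 / h) (at t)"
    using assms by (auto intro!: derivative_eq_intros)
  from DERIV_chain2[OF sstep_deriv this] show ?thesis by simp
qed

lemma dstep_scaled_outside:
  assumes "0 < h" "t \<notin> {a..a+h}" shows "dstep ((t - a) / h) = 0"
  using assms by (intro dstep_outside) (auto simp: field_simps)

context entropy_setting
begin

definition err :: "nat \<Rightarrow> (nat \<Rightarrow> real) \<Rightarrow> (nat \<Rightarrow> real) \<Rightarrow> (nat \<Rightarrow> real) \<Rightarrow> real \<Rightarrow> real" where
  "err n p s v t = (\<integral>x. \<bar>u x t - stp n p s v x t\<bar> \<partial>lborel)"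

lemma err_cont:
  assumes t0: "t0 \<in> {0<..<T}" and v: "v 0 = 0" "v n = 0"
  shows "(err n p s v \<longlongrightarrow> err n p s v t0) (at t0 within {0<..<T})"
proof (rule Lim_transform2)
  define D where "D = (\<Sum>j=1..n. \<bar>v j - v (j - 1)\<bar> * \<bar>s j\<bar>)"
  define b where "b = (\<lambda>t. (\<integral>x. \<bar>u x t - u x t0\<bar> \<partial>lborel) + D * \<bar>t - t0\<bar>)"
  have b0: "(b \<longlongrightarrow> 0) (at t0 within {0<..<T})"
  proof -
    have "((\<lambda>t. \<integral>x. \<bar>u x t - u x t0\<bar> \<partial>lborel) \<longlongrightarrow> 0) (at t0 within {0<..<T})"
      using tcont t0 by (auto simp: L1_time_continuous_def)
    moreover have "((\<lambda>t. D * \<bar>t - t0\<bar>) \<longlongrightarrow> 0) (at t0 within {0<..<T})"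
      by (rule tendsto_eq_intros refl | simp)+
    ultimately show ?thesis unfolding b_def using tendsto_add by fastforce
  qed
  have le: "\<bar>err n p s v t0 - err n p s v t\<bar> \<le> b t" if t: "t \<in> {0<..<T}" for t
  proof -
    note i = u_integrable[OF t] u_integrable[OF t0] stp_integrable[OF v] stp_time_diff(1)
    let ?f = "\<lambda>x. u x t0 - stp n p s v x t0" and ?g = "\<lambda>x. u x t - stp n p s v x t"
    have fi: "integrable lborel ?f" "integrable lborel ?g" using i by auto
    have "\<bar>err n p s v t0 - err n p s v t\<bar> = \<bar>\<integral>x. \<bar>?f x\<bar> - \<bar>?g x\<bar> \<partial>lborel\<bar>"
      unfolding err_def using fi by simp
    also have "\<dots> \<le> (\<integral>x. \<bar>\<bar>?f x\<bar> - \<bar>?g x\<bar>\<bar> \<partial>lborel)" by (rule integral_abs_bound)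
    also have "\<dots> \<le> (\<integral>x. \<bar>u x t - u x t0\<bar> + \<bar>stp n p s v x t - stp n p s v x t0\<bar> \<partial>lborel)"
      using fi i by (intro integral_mono Bochner_Integration.integrable_add integrable_abs Bochner_Integration.integrable_diff) auto
    also have "\<dots> = (\<integral>x. \<bar>u x t - u x t0\<bar> \<partial>lborel) + (\<integral>x. \<bar>stp n p s v x t - stp n p s v x t0\<bar> \<partial>lborel)"
      using i by (intro Bochner_Integration.integral_add integrable_abs Bochner_Integration.integrable_diff) auto
    also have "\<dots> \<le> b t" using stp_time_diff(2)[of n p s v t t0] by (simp add: b_def D_def)
    finally show ?thesis .
  qed
  show "((\<lambda>t. err n p s v t0 - err n p s v t) \<longlongrightarrow> 0) (at t0 within {0<..<T})"
    by (rule Lim_null_comparison[OF _ b0]) (use le in \<open>auto simp: eventually_at_filter intro!: always_eventually\<close>)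
qed simp

lemma err_near:
  assumes "t0 \<in> {0<..<T}" "v 0 = 0" "v n = 0" "0 < \<gamma>"
  obtains r where "0 < r" "\<And>t. t \<in> {0<..<T} \<Longrightarrow> \<bar>t - t0\<bar> \<le> r \<Longrightarrow> \<bar>err n p s v t - err n p s v t0\<bar> < \<gamma>"
proof -
  obtain d where d: "0 < d" "\<And>t. t \<in> {0<..<T} \<Longrightarrow> 0 < dist t t0 \<Longrightarrow> dist t t0 < d \<Longrightarrow> dist (err n p s v t) (err n p s v t0) < \<gamma>"
    using err_cont[OF assms(1-3), of p s] assms(4) unfolding Lim_within by blast
  show ?thesis
  proof (rule that[of "d / 2"])
    fix t assume "t \<in> {0<..<T}" "\<bar>t - t0\<bar> \<le> d / 2"
    then show "\<bar>err n p s v t - err n p s v t0\<bar> < \<gamma>"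
      using d(2)[of t] d(1) assms(4) by (cases "t = t0") (auto simp: dist_real_def)
  qed (use d in auto)
qed

lemma dstep_average:
  assumes h: "0 < h" "0 \<le> a" "a + h \<le> T" and c: "\<And>t. t \<in> {0<..<T} \<Longrightarrow> t \<in> {a..a+h} \<Longrightarrow> f t \<le> c"
    and i: "integrable lborel (\<lambda>t. indicator {0<..<T} t * (dstep ((t - a) / h) / h * f t))"
  shows "(\<integral>t. indicator {0<..<T} t * (dstep ((t - a) / h) / h * f t) \<partial>lborel) \<le> c"
proof -
  note b = has_bochner_integral_dstep[OF h(1), of a]
  have "(\<integral>t. indicator {0<..<T} t * (dstep ((t - a) / h) / h * f t) \<partial>lborel) \<le> (\<integral>t. dstep ((t - a) / h) / h * c \<partial>lborel)"
  proof (rule integral_mono[OF i])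
    show "integrable lborel (\<lambda>t. dstep ((t - a) / h) / h * c)"
      using integrable.intros[OF b] by (rule integrable_mult_left)
    fix t
    show "indicator {0<..<T} t * (dstep ((t - a) / h) / h * f t) \<le> dstep ((t - a) / h) / h * c"
    proof (cases "dstep ((t - a) / h) = 0")
      case False
      then have t: "0 < (t - a) / h" "(t - a) / h < 1" using dstep_outside by (force simp: not_le)+
      then have "t \<in> {0<..<T}" "t \<in> {a..a+h}" using h by (auto simp: field_simps)
      then have "f t \<le> c" "indicator {0<..<T} t = (1::real)" using c by auto
      moreover have "0 \<le> dstep ((t - a) / h) / h" using h dstep_nonneg by simp
      ultimately show ?thesis using mult_left_mono[of "f t" c "dstep ((t - a) / h) / h"] by simp
    qed simp
  qed
  also have "\<dots> = c" using b by (simp add: has_bochner_integral_iff)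
  finally show ?thesis .
qed

lemma slab_estimate:
  assumes ends: "p 0 \<le> -1" "s 0 = 0" "1 \<le> p (Suc n)" "s (Suc n) = 0" "v 0 = 0" "v n = 0"
    and t: "0 < t1" "t1 \<le> t2" "t2 < T"
    and ord: "\<And>t i. t \<in> {t1..t2} \<Longrightarrow> i \<le> n \<Longrightarrow> p i + s i * t \<le> p (Suc i) + s (Suc i) * t"
    and jump: "AE q in lborel. q \<in> Q \<longrightarrow> (\<forall>j\<in>{1..n}. jmp F (s j) (v (j - 1)) (v j) (U q) \<le> e j)"
    and e: "\<And>j. 0 \<le> e j"
  shows "err n p s v t2 \<le> err n p s v t1 + (t2 - t1) * (\<Sum>j=1..n. e j)"
proof (cases "t1 = t2")
  case False
  then have t12: "t1 < t2" using t by simp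
  show ?thesis
  proof (rule field_le_epsilon)
    fix \<gamma>' :: real assume "0 < \<gamma>'"
    define \<gamma> where "\<gamma> = \<gamma>' / 2"
    have g: "0 < \<gamma>" "\<gamma>' = \<gamma> + \<gamma>" using \<open>0 < \<gamma>'\<close> by (auto simp: \<gamma>_def)
    have tt: "t1 \<in> {0<..<T}" "t2 \<in> {0<..<T}" using t t12 by auto
    obtain r1 where r1: "0 < r1" "\<And>t. t \<in> {0<..<T} \<Longrightarrow> \<bar>t - t1\<bar> \<le> r1 \<Longrightarrow> \<bar>err n p s v t - err n p s v t1\<bar> < \<gamma>"
      using err_near[OF tt(1) ends(5,6) g(1), of p s] by blast
    obtain r2 where r2: "0 < r2" "\<And>t. t \<in> {0<..<T} \<Longrightarrow> \<bar>t - t2\<bar> \<le> r2 \<Longrightarrow> \<bar>err n p s v t - err n p s v t2\<bar> < \<gamma>"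
      using err_near[OF tt(2) ends(5,6) g(1), of p s] by blast
    define h where "h = min (min r1 r2) (t2 - t1)"
    have h: "0 < h" "h \<le> r1" "h \<le> r2" "t1 + h \<le> t2" using r1 r2 t12 by (auto simp: h_def)
    define \<eta> where "\<eta> = (\<lambda>t. sstep ((t - t1) / h) - sstep ((t - (t2 - h)) / h))"
    define \<eta>' where "\<eta>' = (\<lambda>t. dstep ((t - t1) / h) / h - dstep ((t - (t2 - h)) / h) / h)"
    have d: "(\<eta> has_real_derivative \<eta>' t) (at t)" for t
      unfolding \<eta>_def \<eta>'_def by (intro DERIV_diff sstep_scaled_deriv h)
    have c: "continuous_on UNIV \<eta>'" unfolding \<eta>'_def using h by (auto intro!: continuous_intros)
    have pos: "0 \<le> \<eta> t" for t
      unfolding \<eta>_def using h by (auto intro!: sstep_mono divide_right_mono)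
    have sup: "\<eta> t = 0 \<and> \<eta>' t = 0" if "t \<notin> {t1..t2}" for t
    proof (cases "t < t1")
      case True
      then have "(t - t1) / h \<le> 0" "(t - (t2 - h)) / h \<le> 0" using h by (auto simp: field_simps)
      then show ?thesis by (simp add: \<eta>_def \<eta>'_def sstep_0 dstep_outside)
    next
      case False
      then have "1 \<le> (t - t1) / h" "1 \<le> (t - (t2 - h)) / h" using h that by (auto simp: field_simps)
      then show ?thesis by (simp add: \<eta>_def \<eta>'_def sstep_1 dstep_outside)
    qed
    have up: "\<eta> t \<le> indicator {t1..t2} t" for t
      using sup[of t] sstep_le_1[of "(t - t1) / h"] sstep_ge_0[of "(t - (t2 - h)) / h"]
      by (auto simp: indicator_def \<eta>_def)
    have \<delta>: "0 < (T - t2)" "\<And>t. T - (T - t2) \<le> t \<Longrightarrow> \<eta> t = 0"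
    proof -
      show "\<eta> t = 0" if "T - (T - t2) \<le> t" for t
      proof -
        have "1 \<le> (t - t1) / h" "1 \<le> (t - (t2 - h)) / h" using h that by (auto simp: field_simps)
        then show ?thesis by (simp add: \<eta>_def sstep_1)
      qed
    qed (use t in simp)
    note kw = kato_weak[where X="{t1..t2}", OF ends ord d c pos sup \<delta> jump, folded err_def]
    define A where "A = err n p s v"
    have inT: "t \<in> {0<..<T}" if "t \<in> {t1..t2}" for t using t that by auto
    have int1: "integrable lborel (\<lambda>t. indicator {0<..<T} t * (dstep ((t - t1) / h) / h * A t))"
      and int2: "integrable lborel (\<lambda>t. indicator {0<..<T} t * (dstep ((t - (t2 - h)) / h) / h * A t))"
    proof -
      have Acont: "continuous_on {t1..t2} A"
        unfolding continuous_on_def A_def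
      proof
        fix x assume "x \<in> {t1..t2}"
        moreover have "{t1..t2} \<subseteq> {0<..<T}" using inT by auto
        ultimately show "(err n p s v \<longlongrightarrow> err n p s v x) (at x within {t1..t2})"
          using tendsto_within_subset[OF err_cont[OF inT ends(5,6)]] by blast
      qed
      have si: "set_integrable lborel {t1..t2} (\<lambda>t. dstep ((t - b) / h) / h * A t)" for b
        using h by (intro borel_integrable_atLeastAtMost' continuous_intros Acont) auto
      have ie: "indicator {t1..t2} t *\<^sub>R (dstep ((t - b) / h) / h * A t) = indicator {0<..<T} t * (dstep ((t - b) / h) / h * A t)"
        if "b \<in> {t1..t2-h}" for b t
        using inT[of t] dstep_scaled_outside[of h t b] that h
        by (cases "t \<in> {b..b+h}") (auto simp: indicator_def)
      have "integrable lborel (\<lambda>t. indicator {0<..<T} t * (dstep ((t - b) / h) / h * A t))"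
        if "b \<in> {t1..t2-h}" for b
        using si[of b] unfolding set_integrable_def ie[OF that] .
      then show "integrable lborel (\<lambda>t. indicator {0<..<T} t * (dstep ((t - t1) / h) / h * A t))"
        "integrable lborel (\<lambda>t. indicator {0<..<T} t * (dstep ((t - (t2 - h)) / h) / h * A t))"
        using h by simp_all
    qed
    have I: "(\<integral>t. indicator {0<..<T} t * (\<eta>' t * A t) \<partial>lborel) =
       (\<integral>t. indicator {0<..<T} t * (dstep ((t - t1) / h) / h * A t) \<partial>lborel)
       - (\<integral>t. indicator {0<..<T} t * (dstep ((t - (t2 - h)) / h) / h * A t) \<partial>lborel)"
      using int1 int2 by (simp add: \<eta>'_def left_diff_distrib right_diff_distrib)
    have I1: "(\<integral>t. indicator {0<..<T} t * (dstep ((t - t1) / h) / h * A t) \<partial>lborel) \<le> A t1 + \<gamma>"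
    proof (rule dstep_average[OF h(1) _ _ _ int1])
      fix x assume "x \<in> {0<..<T}" "x \<in> {t1..t1+h}"
      then show "A x \<le> A t1 + \<gamma>" using r1(2)[of x] h by (auto simp: A_def)
    qed (use t h in auto)
    have I2: "(\<integral>t. indicator {0<..<T} t * (dstep ((t - (t2 - h)) / h) / h * (- A t)) \<partial>lborel) \<le> - (A t2 - \<gamma>)"
    proof (rule dstep_average[OF h(1)])
      fix x assume "x \<in> {0<..<T}" "x \<in> {t2 - h..t2 - h + h}"
      then show "- A x \<le> - (A t2 - \<gamma>)" using r2(2)[of x] h by (auto simp: A_def)
    qed (use t h int2 in auto)
    have I3: "(\<integral>t. indicator {0<..<T} t * \<eta> t \<partial>lborel) \<le> t2 - t1"
    proof -
      have "(\<integral>t. indicator {0<..<T} t * \<eta> t \<partial>lborel) \<le> (\<integral>t. indicator {t1..t2} t \<partial>lborel)"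
      proof (rule integral_mono')
        show "integrable lborel (\<lambda>t. indicator {t1..t2} t :: real)" by (auto simp: emeasure_lborel_Icc_eq)
        show "indicator {0<..<T} t * \<eta> t \<le> indicator {t1..t2} t" for t
          using up[of t] pos[of t] by (auto simp: indicator_def)
      qed auto
      then show ?thesis using t12 by simp
    qed
    have "(\<Sum>j=1..n. e j) * (\<integral>t. indicator {0<..<T} t * \<eta> t \<partial>lborel) \<le> (\<Sum>j=1..n. e j) * (t2 - t1)"
      using I3 e by (intro mult_left_mono sum_nonneg) auto
    moreover have "\<eta> 0 = 0" using sup[of 0] t by auto
    ultimately show "err n p s v t2 \<le> err n p s v t1 + (t2 - t1) * (\<Sum>j=1..n. e j) + \<gamma>'"
      using kw(2) I I1 I2 g(2) unfolding A_def by (simp add: mult.commute)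
  qed
qed simp

text \<open>Fronts at rest stay ordered at negative times too, so the test functions need not vanish at time 0. This is
  how the initial datum, which is present only in the weak formulation, becomes an \<open>L\<^sup>1\<close> initial value.\<close>

lemma initial_estimate:
  assumes v: "v 0 = 0" "v n = 0" and p: "\<And>j. j \<in> {1..<n} \<Longrightarrow> p j \<le> p (Suc j)"
  obtains C where "0 \<le> C" "\<And>t. 0 < t \<Longrightarrow> t < T \<Longrightarrow>
     (\<integral>x. \<bar>u x t - stp n p (\<lambda>_. 0) v x 0\<bar> \<partial>lborel) \<le> (\<integral>x. \<bar>u0 x - stp n p (\<lambda>_. 0) v x 0\<bar> \<partial>lborel) + C * t"
proof -
  obtain B where B: "0 \<le> B" "AE q in lborel. q \<in> Q \<longrightarrow> \<bar>U q\<bar> \<le> B" using U_bound .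
  obtain CF where CF: "\<And>w. \<bar>w\<bar> \<le> B \<Longrightarrow> \<bar>F w\<bar> \<le> CF" using F_bounded[of B] by blast
  define e where "e = (\<lambda>j::nat. 2 * \<bar>CF\<bar> + \<bar>F (v j)\<bar> + \<bar>F (v (j - 1))\<bar>)"
  have e0: "0 \<le> e j" for j by (simp add: e_def)
  have jump: "AE q in lborel. q \<in> Q \<longrightarrow> (\<forall>j\<in>{1..n}. jmp F 0 (v (j - 1)) (v j) (U q) \<le> e j)"
    using B(2)
  proof eventually_elim
    case (elim q)
    show ?case
    proof (intro impI ballI)
      fix j assume "q \<in> Q"
      then have "\<bar>F (U q)\<bar> \<le> CF" using elim CF by auto
      then show "jmp F 0 (v (j - 1)) (v j) (U q) \<le> e j"
        by (auto simp: jmp_def e_def sgn_if)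
    qed
  qed
  define P where "P = (\<lambda>j. if j = 0 then min (-1) (p 1) else if j \<le> n then p j else max 1 (p n))"
  define z where "z = (\<lambda>_::nat. 0::real)"
  have ends: "P 0 \<le> -1" "z 0 = 0" "1 \<le> P (Suc n)" "z (Suc n) = 0" by (auto simp: P_def z_def)
  have ord: "P i + z i * t \<le> P (Suc i) + z (Suc i) * t" if "i \<le> n" for i t
    using p[of i] that by (auto simp: P_def z_def not_less_eq_eq le_Suc_eq)
  have stpP: "stp n P z v x t = stp n p (\<lambda>_. 0) v x 0" for x t
    unfolding stp_def by (intro sum.cong) (auto simp: P_def z_def)
  show ?thesis
  proof (rule that[of "\<Sum>j=1..n. e j"])
    show "0 \<le> (\<Sum>j=1..n. e j)" using e0 by (intro sum_nonneg) auto
    fix t2 assume t: "0 < t2" "t2 < T"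
    define A where "A = err n P z v"
    have "A t2 \<le> (\<integral>x. \<bar>u0 x - stp n P z v x 0\<bar> \<partial>lborel) + (\<Sum>j=1..n. e j) * t2"
    proof (rule field_le_epsilon)
      fix \<gamma> :: real assume g: "0 < \<gamma>"
      have tt: "t2 \<in> {0<..<T}" using t by auto
      obtain r2 where r2: "0 < r2" "\<And>t. t \<in> {0<..<T} \<Longrightarrow> \<bar>t - t2\<bar> \<le> r2 \<Longrightarrow> \<bar>A t - A t2\<bar> < \<gamma>"
        unfolding A_def using err_near[OF tt v g, of P z] by blast
      define h where "h = min r2 (t2 / 2)"
      have h: "0 < h" "h \<le> r2" "h < t2" using r2 t by (auto simp: h_def)
      define \<eta> where "\<eta> = (\<lambda>t. 1 - sstep ((t - (t2 - h)) / h))"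
      define \<eta>' where "\<eta>' = (\<lambda>t. 0 - dstep ((t - (t2 - h)) / h) / h)"
      have d: "(\<eta> has_real_derivative \<eta>' t) (at t)" for t
        unfolding \<eta>_def \<eta>'_def by (intro DERIV_diff DERIV_const sstep_scaled_deriv h)
      have c: "continuous_on UNIV \<eta>'" unfolding \<eta>'_def using h by (auto intro!: continuous_intros)
      have pos: "0 \<le> \<eta> t" for t unfolding \<eta>_def using sstep_le_1 by simp
      have late: "\<eta> t = 0" if "t \<ge> t2" for t
        using that h by (auto simp: \<eta>_def field_simps intro!: sstep_1)
      have \<delta>: "0 < (T - t2)" "\<And>t. T - (T - t2) \<le> t \<Longrightarrow> \<eta> t = 0"
      proof -
        show "\<eta> t = 0" if "T - (T - t2) \<le> t" for t using that t by (intro late) simp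
      qed (use t in simp)
      have jump': "AE q in lborel. q \<in> Q \<longrightarrow> (\<forall>j\<in>{1..n}. jmp F (z j) (v (j - 1)) (v j) (U q) \<le> e j)"
        using jump by (simp add: z_def)
      have sup: "\<eta> t = 0 \<and> \<eta>' t = 0" if "t \<notin> UNIV" for t using that by simp
      note kw = kato_weak[where X=UNIV, OF ends v ord d c pos sup \<delta> jump', folded err_def, folded A_def]
      have int2: "integrable lborel (\<lambda>t. indicator {0<..<T} t * (dstep ((t - (t2 - h)) / h) / h * - A t))"
        using kw(1) by (simp add: \<eta>'_def)
      have I2: "(\<integral>t. indicator {0<..<T} t * (dstep ((t - (t2 - h)) / h) / h * (- A t)) \<partial>lborel) \<le> - (A t2 - \<gamma>)"
      proof (rule dstep_average[OF h(1) _ _ _ int2])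
        fix x assume "x \<in> {0<..<T}" "x \<in> {t2 - h..t2 - h + h}"
        then show "- A x \<le> - (A t2 - \<gamma>)" using r2(2)[of x] h by (auto simp: A_def)
      qed (use t h in auto)
      have I3: "(\<integral>t. indicator {0<..<T} t * \<eta> t \<partial>lborel) \<le> t2"
      proof -
        have "(\<integral>t. indicator {0<..<T} t * \<eta> t \<partial>lborel) \<le> (\<integral>t. indicator {0..t2} t \<partial>lborel)"
        proof (rule integral_mono')
          show "integrable lborel (\<lambda>t. indicator {0..t2} t :: real)" by (auto simp: emeasure_lborel_Icc_eq)
          show "indicator {0<..<T} t * \<eta> t \<le> indicator {0..t2} t" for t
            using late[of t] sstep_ge_0[of "(t - (t2 - h)) / h"] by (auto simp: indicator_def \<eta>_def)
        qed auto
        then show ?thesis using t by simp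
      qed
      have "(\<Sum>j=1..n. e j) * (\<integral>t. indicator {0<..<T} t * \<eta> t \<partial>lborel) \<le> (\<Sum>j=1..n. e j) * t2"
        using I3 e0 by (intro mult_left_mono sum_nonneg) auto
      moreover have "\<eta> 0 = 1" using h by (auto simp: \<eta>_def field_simps intro!: sstep_0)
      ultimately show "A t2 \<le> (\<integral>x. \<bar>u0 x - stp n P z v x 0\<bar> \<partial>lborel) + (\<Sum>j=1..n. e j) * t2 + \<gamma>"
        using kw(2) I2 by (simp add: \<eta>'_def)
    qed
    then show "(\<integral>x. \<bar>u x t2 - stp n p (\<lambda>_. 0) v x 0\<bar> \<partial>lborel) \<le> (\<integral>x. \<bar>u0 x - stp n p (\<lambda>_. 0) v x 0\<bar> \<partial>lborel) + (\<Sum>j=1..n. e j) * t2"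
      by (simp add: A_def err_def stpP)
  qed
qed

end

section \<open>Front tracking\<close>

definition chord :: "(real \<Rightarrow> real) \<Rightarrow> real \<Rightarrow> real \<Rightarrow> real" where
  "chord F a b = (F b - F a) / (b - a)"

text \<open>With \<open>k = heav\<close> this is the piecewise constant function after \<open>h\<close> units of free flight of the fronts at
  Rankine-Hugoniot speed; with \<open>k = relu\<close> it is its primitive.\<close>

definition fsum :: "(real \<Rightarrow> real) \<Rightarrow> (real \<Rightarrow> real) \<Rightarrow> nat \<Rightarrow> (nat \<Rightarrow> real) \<Rightarrow> (nat \<Rightarrow> real) \<Rightarrow> real \<Rightarrow> real \<Rightarrow> real" where
  "fsum k F n p v x h = (\<Sum>j=1..n. (v j - v (j - 1)) * k (x - p j - chord F (v (j - 1)) (v j) * h))"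

text \<open>The Hopf-Lax kernel \<open>h F\<^sup>*(z / h)\<close> of the flux that interpolates \<open>F\<close> linearly between the levels in \<open>P\<close>.\<close>

definition lam :: "(real \<Rightarrow> real) \<Rightarrow> real set \<Rightarrow> real \<Rightarrow> real \<Rightarrow> real" where
  "lam F P h z = Max ((\<lambda>w. w * z - h * F w) ` P)"

definition grid :: "real \<Rightarrow> nat \<Rightarrow> real set" where
  "grid d J = (\<lambda>j. d * real_of_int j) ` {- int J..int J}"

definition ordered :: "(real \<Rightarrow> real) \<Rightarrow> nat \<Rightarrow> (nat \<Rightarrow> real) \<Rightarrow> (nat \<Rightarrow> real) \<Rightarrow> real \<Rightarrow> bool" where
  "ordered F n p v h \<longleftrightarrow> (\<forall>j\<in>{1..<n}. p j + chord F (v (j - 1)) (v j) * h \<le> p (Suc j) + chord F (v j) (v (Suc j)) * h)"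

definition valid :: "real \<Rightarrow> nat \<Rightarrow> nat \<Rightarrow> (nat \<Rightarrow> real) \<Rightarrow> (nat \<Rightarrow> real) \<Rightarrow> bool" where
  "valid d J n p v \<longleftrightarrow> v 0 = 0 \<and> v n = 0 \<and> (\<forall>j\<le>n. v j \<in> grid d J) \<and>
     (\<forall>j\<in>{1..n}. v (j - 1) \<noteq> v j \<and> (v (j - 1) < v j \<longrightarrow> v j = v (j - 1) + d)) \<and>
     (\<forall>j\<in>{1..<n}. p j \<le> p (Suc j))"

lemma finite_grid [simp]: "finite (grid d J)" by (simp add: grid_def)

lemma zero_in_grid [simp]: "0 \<in> grid d J" by (force simp: grid_def)

lemma grid_gap:
  assumes "a \<in> grid d J" "b \<in> grid d J" "a < b" "0 < d"
  shows "a + d \<le> b"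
proof -
  obtain i j where ij: "a = d * real_of_int i" "b = d * real_of_int j" using assms by (auto simp: grid_def)
  then have "i + 1 \<le> j" using assms by auto
  then have "real_of_int (i + 1) \<le> real_of_int j" by (simp only: of_int_le_iff)
  then have "d * real_of_int (i + 1) \<le> d * real_of_int j" using assms(4) by (intro mult_left_mono) auto
  then show ?thesis using ij by (simp add: algebra_simps)
qed

lemma lam_ge: "finite P \<Longrightarrow> w \<in> P \<Longrightarrow> w * z - h * F w \<le> lam F P h z"
  unfolding lam_def by (intro Max_ge) auto

lemma lam_attained:
  assumes "finite P" "P \<noteq> {}"
  obtains w where "w \<in> P" "lam F P h z = w * z - h * F w"
proof -
  have "lam F P h z \<in> (\<lambda>w. w * z - h * F w) ` P"
    unfolding lam_def using assms by (intro Max_in) auto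
  then show ?thesis using that by auto
qed

lemma lam_le:
  assumes "finite P" "P \<noteq> {}" "\<And>w. w \<in> P \<Longrightarrow> w * z - h * F w \<le> c"
  shows "lam F P h z \<le> c"
  using assms unfolding lam_def by (subst Max_le_iff) auto

lemma lam_subadd:
  assumes "finite P" "P \<noteq> {}"
  shows "lam F P (h + h') (z + z') \<le> lam F P h z + lam F P h' z'"
proof (rule lam_le[OF assms])
  fix w assume "w \<in> P"
  from lam_ge[OF assms(1) this, of z h F] lam_ge[OF assms(1) this, of z' h' F]
  show "w * (z + z') - (h + h') * F w \<le> lam F P h z + lam F P h' z'"
    by (simp add: algebra_simps)
qed

lemma lam_scale:
  assumes "finite P" "P \<noteq> {}" "0 \<le> h"
  shows "lam F P h (h * z) = h * lam F P 1 z"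
proof (rule antisym)
  show "lam F P h (h * z) \<le> h * lam F P 1 z"
  proof (rule lam_le[OF assms(1,2)])
    fix w assume "w \<in> P"
    from mult_left_mono[OF lam_ge[OF assms(1) this, of z 1 F] assms(3)]
    show "w * (h * z) - h * F w \<le> h * lam F P 1 z" by (simp add: algebra_simps)
  qed
  obtain w where w: "w \<in> P" "lam F P 1 z = w * z - 1 * F w" using lam_attained[OF assms(1,2)] .
  show "h * lam F P 1 z \<le> lam F P h (h * z)"
    unfolding w(2) using lam_ge[OF assms(1) w(1), of "h * z" h F] by (simp add: algebra_simps)
qed

lemma chord_commute: "chord F a b = chord F b a"
  unfolding chord_def by (metis minus_diff_eq minus_divide_divide)

lemma chord_mult: "a \<noteq> b \<Longrightarrow> (b - a) * chord F a b = F b - F a"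
  by (simp add: chord_def)

lemma chord_strict:
  assumes F: "strictly_convex F" and abc: "a < b" "b < c"
  shows "chord F a b < chord F a c" "chord F a c < chord F b c"
proof -
  define s where "s = (b - a) / (c - a)"
  have s: "0 < s" "s < 1" using abc by (auto simp: s_def field_simps)
  have b: "b = a + s * (c - a)" using abc by (simp add: s_def)
  have "F ((1 - s) * a + s * c) < (1 - s) * F a + s * F c"
    using F s abc unfolding strictly_convex_def by (metis less_irrefl less_trans)
  moreover have "(1 - s) * a + s * c = b" unfolding b by (simp add: algebra_simps)
  ultimately have lt: "F b < (1 - s) * F a + s * F c" by simp
  have ca: "0 < c - a" using abc by simp
  have k: "F c - F a = (c - a) * chord F a c" using chord_mult[of a c F] abc by simp
  have bs: "b - a = s * (c - a)" "c - b = (1 - s) * (c - a)" using b by (auto simp: algebra_simps)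
  have "F b - F a < s * (F c - F a)" using lt by (simp add: algebra_simps)
  also have "\<dots> = (b - a) * chord F a c" unfolding k bs by simp
  finally show "chord F a b < chord F a c"
    unfolding chord_def[of F a b] using abc by (simp add: divide_less_eq mult.commute)
  have "(1 - s) * (F c - F a) < F c - F b" using lt by (simp add: algebra_simps)
  moreover have "(1 - s) * (F c - F a) = (c - b) * chord F a c" unfolding k bs by simp
  ultimately show "chord F a c < chord F b c"
    unfolding chord_def[of F b c] using abc by (simp add: less_divide_eq mult.commute)
qed

lemma merge_down:
  assumes F: "strictly_convex F" and ne: "a \<noteq> b" "b \<noteq> c" and s: "chord F b c < chord F a b"
  shows "c < a"
proof (rule ccontr)
  assume "\<not> c < a"
  then consider "a = c" | "b < a" "a < c" | "a < b" "b < c" | "a < c" "c < b" using ne by linarith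
  then show False
  proof cases
    case 1 then show ?thesis using s chord_commute by simp
  next
    case 2 then show ?thesis using s chord_strict(1)[OF F, of b a c] chord_commute[of F a b] by simp
  next
    case 3 then show ?thesis using s chord_strict[OF F, of a b c] by simp
  next
    case 4 then show ?thesis using s chord_strict(2)[OF F, of a c b] chord_commute[of F b c] by simp
  qed
qed

lemma chord_mono_right:
  assumes F: "strictly_convex F" and "a < b" "b \<le> c" shows "chord F a b \<le> chord F a c"
  using chord_strict(1)[OF F, of a b c] assms by (cases "b = c") auto

lemma chord_mono_left:
  assumes F: "strictly_convex F" and "a \<le> b" "b < c" shows "chord F a c \<le> chord F b c"
  using chord_strict(2)[OF F, of a b c] assms by (cases "a = b") auto

lemma lam_at_level:
  assumes F: "strictly_convex F" and d: "0 < d" and v: "v \<in> grid d J" and h: "0 \<le> h"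
    and z: "h * chord F (v - d) v \<le> z" "z \<le> h * chord F v (v + d)"
  shows "lam F (grid d J) h z = v * z - h * F v"
proof (rule antisym)
  show "v * z - h * F v \<le> lam F (grid d J) h z" using v by (intro lam_ge) auto
  show "lam F (grid d J) h z \<le> v * z - h * F v"
  proof (rule lam_le)
    fix w assume w: "w \<in> grid d J"
    consider "w = v" | "v < w" | "w < v" by linarith
    then show "w * z - h * F w \<le> v * z - h * F v"
    proof cases
      case 2
      then have "v + d \<le> w" using grid_gap v w d by auto
      then have "chord F v (v + d) \<le> chord F v w" using chord_mono_right[OF F] d by auto
      then have "z \<le> h * chord F v w" using z(2) h mult_left_mono by fastforce
      then have "(w - v) * z \<le> (w - v) * (h * chord F v w)" using 2 by (intro mult_left_mono) auto
      also have "\<dots> = h * (F w - F v)" using chord_mult[of v w F] 2 by simp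
      finally show ?thesis by (simp add: algebra_simps)
    next
      case 3
      then have "w \<le> v - d" using grid_gap[of w d J v] v w d by auto
      then have "chord F w v \<le> chord F (v - d) v" using chord_mono_left[OF F] d by auto
      then have "h * chord F w v \<le> z" using z(1) h mult_left_mono by fastforce
      then have "(v - w) * (h * chord F w v) \<le> (v - w) * z" using 3 by (intro mult_left_mono) auto
      moreover have "(v - w) * (h * chord F w v) = h * (F v - F w)" using chord_mult[of w v F] 3 by simp
      ultimately show ?thesis by (simp add: algebra_simps)
    qed simp
  qed (use v in auto)
qed

lemma mono_chain:
  fixes l :: "nat \<Rightarrow> real"
  assumes "\<And>j. j \<in> {1..<n} \<Longrightarrow> l j \<le> l (Suc j)" "1 \<le> i" "i \<le> j" "j \<le> n"
  shows "l i \<le> l j"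
  using assms(3,4)
proof (induction j)
  case (Suc j)
  then show ?case using assms(1)[of j] assms(2) by (cases "i = Suc j") auto
qed simp

lemma prefix_split:
  fixes l :: "nat \<Rightarrow> real"
  assumes "\<And>j. j \<in> {1..<n} \<Longrightarrow> l j \<le> l (Suc j)"
  obtains i where "i \<le> n" "\<And>j. j \<in> {1..i} \<Longrightarrow> l j < x" "\<And>j. j \<in> {Suc i..n} \<Longrightarrow> x \<le> l j"
proof -
  define S where "S = {j\<in>{1..n}. l j < x}"
  define i where "i = (if S = {} then 0 else Max S)"
  have fin: "finite S" by (simp add: S_def)
  show ?thesis
  proof (rule that[of i])
    show "i \<le> n" using Max_in[OF fin] by (auto simp: i_def S_def)
    show "l j < x" if "j \<in> {1..i}" for j
    proof -
      have "S \<noteq> {}" "i = Max S" using that by (auto simp: i_def split: if_splits)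
      then have "i \<in> {1..n}" "l i < x" using Max_in[OF fin] by (auto simp: S_def)
      then show ?thesis using mono_chain[of n l j i] assms that by fastforce
    qed
    show "x \<le> l j" if "j \<in> {Suc i..n}" for j
    proof (rule ccontr)
      assume "\<not> x \<le> l j"
      then have "j \<in> S" using that by (auto simp: S_def)
      then show False using Max_ge[OF fin, of j] that by (auto simp: i_def split: if_splits)
    qed
  qed
qed

lemma flux_telescope:
  fixes v :: "nat \<Rightarrow> real"
  assumes "\<And>j. j \<in> {1..i} \<Longrightarrow> v (j - 1) \<noteq> v j"
  shows "(\<Sum>j=1..i. (v j - v (j - 1)) * chord F (v (j - 1)) (v j)) = F (v i) - F (v 0)"
proof -
  have "(\<Sum>j=1..i. (v j - v (j - 1)) * chord F (v (j - 1)) (v j)) = (\<Sum>j=1..i. F (v j) - F (v (j - 1)))"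
    using assms by (intro sum.cong refl chord_mult) auto
  also have "\<dots> = F (v i) - F (v 0)" using telescope_Suc[of "\<lambda>j. F (v j)" i] by simp
  finally show ?thesis .
qed

lemma relu_deriv: "z \<noteq> 0 \<Longrightarrow> (relu has_real_derivative heav z) (at z)"
proof (cases "z > 0")
  case True
  have "((\<lambda>z. z) has_real_derivative heav z) (at z)"
    using True by (auto intro!: derivative_eq_intros simp: heav_def)
  moreover have "\<forall>\<^sub>F y in nhds z. y = relu y"
    using eventually_nhds_in_open[of "{0<..}" z] True
    by (auto elim!: eventually_mono simp: relu_def)
  ultimately show ?thesis using DERIV_cong_ev[OF refl _ refl] by fast
next
  case False
  assume "z \<noteq> 0"
  have "((\<lambda>z::real. 0) has_real_derivative heav z) (at z)"
    using False by (auto intro!: derivative_eq_intros simp: heav_def)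
  moreover have "\<forall>\<^sub>F y in nhds z. 0 = relu y"
    using eventually_nhds_in_open[of "{..<0}" z] False \<open>z \<noteq> 0\<close>
    by (auto elim!: eventually_mono simp: relu_def)
  ultimately show ?thesis using DERIV_cong_ev[OF refl _ refl] by fast
qed

lemma slab_upper:
  assumes v: "valid d J n p v" and F0: "F 0 = 0" and H: "0 \<le> H"
    and ord: "\<And>h. h \<in> {0..H} \<Longrightarrow> ordered F n p v h"
  shows "fsum relu F n p v (y + s * H) H \<le> fsum relu F n p v y 0 + H * lam F (grid d J) 1 s"
proof -
  define c where "c = (\<lambda>j. chord F (v (j - 1)) (v j))"
  define \<delta> where "\<delta> = (\<lambda>j. v j - v (j - 1))"
  define L where "L = lam F (grid d J) 1 s"
  define g where "g = (\<lambda>h. (\<Sum>j=1..n. \<delta> j * relu ((y - p j) + (s - c j) * h)) - h * L)"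
  define g' where "g' = (\<lambda>h. (\<Sum>j=1..n. \<delta> j * ((s - c j) * heav ((y - p j) + (s - c j) * h))) - L)"
  define S where "S = (\<lambda>j. (p j - y) / (s - c j)) ` {1..n}"
  have der: "(g has_real_derivative g' h) (at h)" if "h \<notin> S" for h
  proof -
    have "((\<lambda>h. relu ((y - p j) + (s - c j) * h)) has_real_derivative (s - c j) * heav ((y - p j) + (s - c j) * h)) (at h)"
      if j: "j \<in> {1..n}" for j
    proof (cases "s = c j")
      case False
      have a: "((\<lambda>h. (y - p j) + (s - c j) * h) has_real_derivative (s - c j)) (at h)"
        by (auto intro!: derivative_eq_intros)
      have "(y - p j) + (s - c j) * h \<noteq> 0"
      proof
        assume "(y - p j) + (s - c j) * h = 0"
        then have "h = (p j - y) / (s - c j)" using False by (simp add: eq_divide_eq mult.commute)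
        then show False using \<open>h \<notin> S\<close> j by (simp add: S_def)
      qed
      from DERIV_chain2[OF relu_deriv[OF this] a] show ?thesis by (simp add: mult.commute)
    qed simp
    note r = this
    have "((\<lambda>h. h * L) has_real_derivative L) (at h)" by (auto intro!: derivative_eq_intros)
    then show ?thesis unfolding g_def g'_def by (intro DERIV_diff DERIV_sum DERIV_cmult r)
  qed
  have "(g' has_integral (g H - g 0)) {0..H}"
  proof (rule fundamental_theorem_of_calculus_strong[where S=S])
    show "continuous_on {0..H} g" unfolding g_def by (intro continuous_intros)
    show "(g has_vector_derivative g' h) (at h)" if "h \<in> {0..H} - S" for h
      using der that by (simp flip: has_real_derivative_iff_has_vector_derivative)
  qed (use H in \<open>auto simp: S_def\<close>)
  moreover have "g' h \<le> 0" if h: "h \<in> {0..H}" for h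
  proof -
    have o: "p j + c j * h \<le> p (Suc j) + c (Suc j) * h" if "j \<in> {1..<n}" for j
      using ord[OF h] that by (auto simp: ordered_def c_def)
    obtain i where i: "i \<le> n" "\<And>j. j \<in> {1..i} \<Longrightarrow> p j + c j * h < y + s * h" "\<And>j. j \<in> {Suc i..n} \<Longrightarrow> y + s * h \<le> p j + c j * h"
      using prefix_split[of n "\<lambda>j. p j + c j * h" "y + s * h"] o by blast
    have "(\<Sum>j=1..n. \<delta> j * ((s - c j) * heav ((y - p j) + (s - c j) * h))) = (\<Sum>j=1..i. \<delta> j * (s - c j))"
    proof (rule sum.mono_neutral_cong_right)
      show "\<forall>j\<in>{1..n} - {1..i}. \<delta> j * ((s - c j) * heav ((y - p j) + (s - c j) * h)) = 0"
      proof
        fix j assume "j \<in> {1..n} - {1..i}"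
        then have "y + s * h \<le> p j + c j * h" using i(3) by auto
        then have "heav ((y - p j) + (s - c j) * h) = 0" by (simp add: heav_def algebra_simps)
        then show "\<delta> j * ((s - c j) * heav ((y - p j) + (s - c j) * h)) = 0" by simp
      qed
      fix j assume "j \<in> {1..i}"
      then have "heav ((y - p j) + (s - c j) * h) = 1" using i(2)[of j] by (simp add: heav_def algebra_simps)
      then show "\<delta> j * ((s - c j) * heav ((y - p j) + (s - c j) * h)) = \<delta> j * (s - c j)" by simp
    qed (use i in auto)
    also have "\<dots> = s * (\<Sum>j=1..i. v j - v (j - 1)) - (\<Sum>j=1..i. (v j - v (j - 1)) * c j)"
      unfolding sum_distrib_left sum_subtractf[symmetric] by (intro sum.cong) (auto simp: \<delta>_def algebra_simps)
    also have "\<dots> = v i * s - F (v i)"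
      unfolding telescope_Suc c_def using v i F0 by (subst flux_telescope) (auto simp: valid_def)
    also have "\<dots> \<le> L" using lam_ge[of "grid d J" "v i" s 1 F] v i by (auto simp: L_def valid_def)
    finally show ?thesis by (simp add: g'_def)
  qed
  ultimately have "0 \<le> - (g H - g 0)"
    using has_integral_nonneg[OF has_integral_neg, of g' "g H - g 0" "{0..H}"] by simp
  then show ?thesis
    by (simp add: g_def fsum_def c_def \<delta>_def L_def algebra_simps)
qed

text \<open>Upward jumps are between neighbouring levels, hence some backward characteristic never meets a front.\<close>

lemma slab_lower:
  assumes v: "valid d J n p v" and F0: "F 0 = 0" and h: "0 \<le> h" and d: "0 < d" and F: "strictly_convex F"
    and ord: "ordered F n p v h"
  shows "\<exists>y. fsum relu F n p v y 0 + lam F (grid d J) h (x - y) \<le> fsum relu F n p v x h"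
proof -
  define c where "c = (\<lambda>j. chord F (v (j - 1)) (v j))"
  have o: "p j + c j * h \<le> p (Suc j) + c (Suc j) * h" if "j \<in> {1..<n}" for j
    using ord that by (auto simp: ordered_def c_def)
  obtain i where i: "i \<le> n" "\<And>j. j \<in> {1..i} \<Longrightarrow> p j + c j * h < x" "\<And>j. j \<in> {Suc i..n} \<Longrightarrow> x \<le> p j + c j * h"
    using prefix_split[of n "\<lambda>j. p j + c j * h" x] o by blast
  define sp where "sp = chord F (v i) (v i + d)"
  define sm where "sm = chord F (v i - d) (v i)"
  have vi: "v i \<in> grid d J" using v i by (auto simp: valid_def)
  have smp: "sm \<le> sp" using chord_strict[OF F, of "v i - d" "v i" "v i + d"] d by (auto simp: sm_def sp_def)
  have jmp: "v (j - 1) \<noteq> v j \<and> (v (j - 1) < v j \<longrightarrow> v j = v (j - 1) + d)" if "j \<in> {1..n}" for j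
    using v that by (auto simp: valid_def)
  have left: "sm \<le> c i" if "1 \<le> i"
  proof (cases "v (i - 1) < v i")
    case True
    then have "v (i - 1) = v i - d" using jmp[of i] that i by auto
    then show ?thesis by (simp add: sm_def c_def)
  next
    case False
    then have lt: "v i < v (i - 1)" using jmp[of i] that i by force
    have "chord F (v i - d) (v i) < chord F (v i) (v (i - 1))"
      using chord_strict[OF F, of "v i - d" "v i" "v (i - 1)"] d lt by auto
    then show ?thesis by (simp add: sm_def c_def chord_commute)
  qed
  have right: "c (Suc i) \<le> sp" if "Suc i \<le> n"
  proof (cases "v i < v (Suc i)")
    case True
    then have "v (Suc i) = v i + d" using jmp[of "Suc i"] that by auto
    then show ?thesis by (simp add: sp_def c_def)
  next
    case False
    then have lt: "v (Suc i) < v i" using jmp[of "Suc i"] that by force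
    have "chord F (v (Suc i)) (v i) < chord F (v i) (v i + d)"
      using chord_strict[OF F, of "v (Suc i)" "v i" "v i + d"] d lt by auto
    then show ?thesis by (simp add: sp_def c_def chord_commute)
  qed
  define y where "y = (if i = 0 then x - h * sp else max (x - h * sp) (p i))"
  have y1: "x - h * sp \<le> y" by (auto simp: y_def)
  have hs: "h * sm \<le> h * sp" using smp h by (intro mult_left_mono)
  have y2: "y \<le> x - h * sm"
  proof -
    have "p i \<le> x - h * sm" if "i \<noteq> 0"
    proof -
      have "h * sm \<le> h * c i" using left that h by (intro mult_left_mono) auto
      then show ?thesis using i(2)[of i] that by (simp add: mult.commute)
    qed
    then show ?thesis using hs by (auto simp: y_def)
  qed
  have pm: "p j \<le> p (Suc j)" if "j \<in> {1..<n}" for j using v that by (auto simp: valid_def)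
  have py: "p j \<le> y" if "j \<in> {1..i}" for j
    using mono_chain[of n p j i] pm that i(1) by (auto simp: y_def)
  have yp: "y \<le> p j" if "j \<in> {Suc i..n}" for j
  proof -
    have "h * c (Suc i) \<le> h * sp" using right that h by (intro mult_left_mono) auto
    then have "x - h * sp \<le> p (Suc i)" using i(3)[of "Suc i"] that by (simp add: mult.commute)
    moreover have "p i \<le> p (Suc i)" if "i \<noteq> 0" using pm[of i] that \<open>j \<in> {Suc i..n}\<close> by auto
    ultimately have "y \<le> p (Suc i)" by (auto simp: y_def)
    also have "\<dots> \<le> p j" using mono_chain[of n p "Suc i" j] pm that by auto
    finally show ?thesis .
  qed
  have fs: "fsum relu F n p v x' h' = (\<Sum>j=1..i. (v j - v (j - 1)) * (x' - p j - c j * h'))"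
    if "\<And>j. j \<in> {1..i} \<Longrightarrow> p j + c j * h' \<le> x'" "\<And>j. j \<in> {Suc i..n} \<Longrightarrow> x' \<le> p j + c j * h'" for x' h'
    unfolding fsum_def
  proof (rule sum.mono_neutral_cong_right)
    show "\<forall>j\<in>{1..n} - {1..i}. (v j - v (j - 1)) * relu (x' - p j - chord F (v (j - 1)) (v j) * h') = 0"
    proof
      fix j assume "j \<in> {1..n} - {1..i}"
      then have "x' \<le> p j + c j * h'" using that(2) by auto
      then show "(v j - v (j - 1)) * relu (x' - p j - chord F (v (j - 1)) (v j) * h') = 0"
        by (simp add: relu_def c_def)
    qed
    fix j assume "j \<in> {1..i}"
    from that(1)[OF this] show "(v j - v (j - 1)) * relu (x' - p j - chord F (v (j - 1)) (v j) * h') = (v j - v (j - 1)) * (x' - p j - c j * h')"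
      by (simp add: relu_def c_def)
  qed (use i in auto)
  have "fsum relu F n p v x h - fsum relu F n p v y 0 =
     (\<Sum>j=1..i. (v j - v (j - 1)) * (x - p j - c j * h)) - (\<Sum>j=1..i. (v j - v (j - 1)) * (y - p j - c j * 0))"
    using fs[of h x] fs[of 0 y] i(2,3) py yp by (simp add: less_imp_le)
  also have "\<dots> = (\<Sum>j=1..i. (v j - v (j - 1)) * (x - y) - (v j - v (j - 1)) * c j * h)"
    unfolding sum_subtractf[symmetric] by (intro sum.cong) (auto simp: algebra_simps)
  also have "\<dots> = (\<Sum>j=1..i. v j - v (j - 1)) * (x - y) - (\<Sum>j=1..i. (v j - v (j - 1)) * c j) * h"
    unfolding sum_distrib_right by (rule sum_subtractf)
  also have "\<dots> = v i * (x - y) - h * F (v i)"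
    unfolding telescope_Suc c_def using v i F0 by (subst flux_telescope) (auto simp: valid_def)
  also have "\<dots> = lam F (grid d J) h (x - y)"
    using lam_at_level[OF F d vi h, of "x - y"] y1 y2 by (simp add: sm_def sp_def)
  finally show ?thesis by (intro exI[of _ y]) simp
qed

text \<open>A term \<open>(c, q, s, \<theta>)\<close> is a jump of height \<open>c\<close> that rests at \<open>q\<close> until time \<open>\<theta>\<close> and then moves with speed \<open>s\<close>.
  When two fronts merge at time \<open>\<theta>\<close>, three such terms switch from the old fronts to the new one; they cancel
  before \<open>\<theta>\<close>. A network thus needs only a bounded number of neurons per collision.\<close>

definition tsum :: "(real \<Rightarrow> real) \<Rightarrow> (real \<times> real \<times> real \<times> real) list \<Rightarrow> real \<Rightarrow> real \<Rightarrow> real" where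
  "tsum k ts x t = (\<Sum>(c, q, s, \<theta>)\<leftarrow>ts. c * k (x - q - s * relu (t - \<theta>)))"

definition mrg_p :: "(real \<Rightarrow> real) \<Rightarrow> nat \<Rightarrow> (nat \<Rightarrow> real) \<Rightarrow> (nat \<Rightarrow> real) \<Rightarrow> real \<Rightarrow> nat \<Rightarrow> real" where
  "mrg_p F j p v h i = (if i \<le> j then p i + chord F (v (i - 1)) (v i) * h
     else p (Suc i) + chord F (v i) (v (Suc i)) * h)"

definition mrg_v :: "nat \<Rightarrow> (nat \<Rightarrow> real) \<Rightarrow> nat \<Rightarrow> real" where
  "mrg_v j v i = (if i < j then v i else v (Suc i))"

definition mterms :: "(real \<Rightarrow> real) \<Rightarrow> nat \<Rightarrow> (nat \<Rightarrow> real) \<Rightarrow> (nat \<Rightarrow> real) \<Rightarrow> real \<Rightarrow> real \<Rightarrow> (real \<times> real \<times> real \<times> real) list" where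
  "mterms F j p v \<tau> \<theta> = (let q = p j + chord F (v (j - 1)) (v j) * (\<theta> - \<tau>) in
     [(- (v j - v (j - 1)), q, chord F (v (j - 1)) (v j), \<theta>),
      (- (v (Suc j) - v j), q, chord F (v j) (v (Suc j)), \<theta>),
      (v (Suc j) - v (j - 1), q, chord F (v (j - 1)) (v (Suc j)), \<theta>)])"

inductive ftrack :: "(real \<Rightarrow> real) \<Rightarrow> nat \<Rightarrow> (nat \<Rightarrow> real) \<Rightarrow> (nat \<Rightarrow> real) \<Rightarrow> real \<Rightarrow> (real \<times> real \<times> real \<times> real) list \<Rightarrow> bool"
  for F where
  stop: "\<forall>h\<ge>0. ordered F n p v h \<Longrightarrow> ftrack F n p v \<tau> []"
| merge: "1 \<le> j \<Longrightarrow> j < n \<Longrightarrow> \<tau> \<le> \<theta> \<Longrightarrow> \<forall>h\<in>{0..\<theta>-\<tau>}. ordered F n p v h \<Longrightarrow>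
    p j + chord F (v (j - 1)) (v j) * (\<theta> - \<tau>) = p (Suc j) + chord F (v j) (v (Suc j)) * (\<theta> - \<tau>) \<Longrightarrow>
    v (Suc j) < v (j - 1) \<Longrightarrow>
    ftrack F (n - 1) (mrg_p F j p v (\<theta> - \<tau>)) (mrg_v j v) \<theta> ex \<Longrightarrow>
    ftrack F n p v \<tau> (mterms F j p v \<tau> \<theta> @ ex)"

definition trk :: "(real \<Rightarrow> real) \<Rightarrow> (real \<Rightarrow> real) \<Rightarrow> nat \<Rightarrow> (nat \<Rightarrow> real) \<Rightarrow> (nat \<Rightarrow> real) \<Rightarrow> real \<Rightarrow> (real \<times> real \<times> real \<times> real) list \<Rightarrow> real \<Rightarrow> real \<Rightarrow> real" where
  "trk k F n p v \<tau> ex x t = fsum k F n p v x (t - \<tau>) + tsum k ex x t"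

lemma tsum_append: "tsum k (as @ bs) x t = tsum k as x t + tsum k bs x t"
  by (simp add: tsum_def)

text \<open>Front \<open>j\<close> of the merged state carries the jump from \<open>v (j - 1)\<close> to \<open>v (Suc j)\<close>.\<close>

lemma mrg_sum:
  fixes f :: "real \<Rightarrow> real \<Rightarrow> real \<Rightarrow> real"
  assumes "1 \<le> j" "j < n"
  shows "(\<Sum>i=1..n. f (P i) (v (i - 1)) (v i)) =
    (\<Sum>i=1..n - 1. f (if i \<le> j then P i else P (Suc i)) (mrg_v j v (i - 1)) (mrg_v j v i))
    + f (P j) (v (j - 1)) (v j) + f (P (Suc j)) (v j) (v (Suc j)) - f (P j) (v (j - 1)) (v (Suc j))"
proof -
  have "Suc j \<le> n" using assms(2) by simp
  then show ?thesis
  proof (induction n rule: dec_induct)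
    case base
    obtain m where j: "j = Suc m" using assms(1) by (cases j) auto
    have "(\<Sum>i=1..m. f (if i \<le> j then P i else P (Suc i)) (mrg_v j v (i - 1)) (mrg_v j v i)) = (\<Sum>i=1..m. f (P i) (v (i - 1)) (v i))"
      by (intro sum.cong) (auto simp: mrg_v_def j)
    then show ?case by (simp add: j mrg_v_def)
  next
    case (step n)
    then obtain m where n: "n = Suc m" "j \<le> m" by (cases n) auto
    show ?case using step.IH n by (simp add: mrg_v_def)
  qed
qed

lemma fsum_merge:
  assumes j: "1 \<le> j" "j < n"
    and meet: "p j + chord F (v (j - 1)) (v j) * (\<theta> - \<tau>) = p (Suc j) + chord F (v j) (v (Suc j)) * (\<theta> - \<tau>)"
    and t: "\<theta> \<le> t"
  shows "fsum k F n p v x (t - \<tau>) + tsum k (mterms F j p v \<tau> \<theta>) x t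
     = fsum k F (n - 1) (mrg_p F j p v (\<theta> - \<tau>)) (mrg_v j v) x (t - \<theta>)"
proof -
  define P where "P = (\<lambda>i. p i + chord F (v (i - 1)) (v i) * (\<theta> - \<tau>))"
  define f where "f = (\<lambda>q l r. (r - l) * k (x - q - chord F l r * (t - \<theta>)))"
  have 1: "fsum k F n p v x (t - \<tau>) = (\<Sum>i=1..n. f (P i) (v (i - 1)) (v i))"
    unfolding fsum_def f_def P_def by (intro sum.cong refl) (simp add: algebra_simps)
  have 2: "fsum k F (n - 1) (mrg_p F j p v (\<theta> - \<tau>)) (mrg_v j v) x (t - \<theta>)
     = (\<Sum>i=1..n - 1. f (if i \<le> j then P i else P (Suc i)) (mrg_v j v (i - 1)) (mrg_v j v i))"
    unfolding fsum_def f_def P_def mrg_p_def by (intro sum.cong refl) simp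
  have PP: "P j = P (Suc j)" using meet by (simp add: P_def)
  have 3: "tsum k (mterms F j p v \<tau> \<theta>) x t = - f (P j) (v (j - 1)) (v j) - f (P (Suc j)) (v j) (v (Suc j)) + f (P j) (v (j - 1)) (v (Suc j))"
    unfolding PP[symmetric] using t
    by (simp add: tsum_def mterms_def f_def P_def Let_def relu_def left_diff_distrib)
  show ?thesis unfolding 1 2 3 mrg_sum[OF j, of f P v] by simp
qed

lemma mterms_before: "t \<le> \<theta> \<Longrightarrow> tsum k (mterms F j p v \<tau> \<theta>) x t = 0"
  by (simp add: tsum_def mterms_def Let_def relu_def left_diff_distrib)

lemma ftrack_before:
  "ftrack F n p v \<tau> ex \<Longrightarrow> t \<le> \<tau> \<Longrightarrow> tsum k ex x t = 0"
proof (induction rule: ftrack.induct)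
  case (stop n p v \<tau>)
  then show ?case by (simp add: tsum_def)
next
  case (merge j n \<tau> \<theta> p v ex)
  then show ?case by (simp add: tsum_append mterms_before)
qed

lemma trk_merge_before:
  assumes "ftrack F n' p' v' \<theta> ex" "t \<le> \<theta>"
  shows "trk k F n p v \<tau> (mterms F j p v \<tau> \<theta> @ ex) x t = fsum k F n p v x (t - \<tau>)"
  using assms by (simp add: trk_def tsum_append mterms_before ftrack_before)

lemma trk_merge_after:
  assumes "1 \<le> j" "j < n" "p j + chord F (v (j - 1)) (v j) * (\<theta> - \<tau>) = p (Suc j) + chord F (v j) (v (Suc j)) * (\<theta> - \<tau>)" "\<theta> \<le> t"
  shows "trk k F n p v \<tau> (mterms F j p v \<tau> \<theta> @ ex) x t
    = trk k F (n - 1) (mrg_p F j p v (\<theta> - \<tau>)) (mrg_v j v) \<theta> ex x t"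
  using fsum_merge[OF assms, of k x] by (simp add: trk_def tsum_append)

lemma fsum_at_merge:
  assumes "1 \<le> j" "j < n" "p j + chord F (v (j - 1)) (v j) * (\<theta> - \<tau>) = p (Suc j) + chord F (v j) (v (Suc j)) * (\<theta> - \<tau>)"
  shows "fsum k F (n - 1) (mrg_p F j p v (\<theta> - \<tau>)) (mrg_v j v) x 0 = fsum k F n p v x (\<theta> - \<tau>)"
  using fsum_merge[OF assms order_refl, of k x] by (simp add: mterms_before)

lemma valid_merge:
  assumes v: "valid d J n p v" and j: "1 \<le> j" "j < n" and o: "ordered F n p v h"
    and meet: "p j + chord F (v (j - 1)) (v j) * h = p (Suc j) + chord F (v j) (v (Suc j)) * h"
    and down: "v (Suc j) < v (j - 1)"
  shows "valid d J (n - 1) (mrg_p F j p v h) (mrg_v j v)"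
  unfolding valid_def
proof (intro conjI ballI allI impI)
  show "mrg_v j v 0 = 0" "mrg_v j v (n - 1) = 0" using v j by (auto simp: valid_def mrg_v_def)
  show "mrg_v j v i \<in> grid d J" if "i \<le> n - 1" for i using v j that by (auto simp: valid_def mrg_v_def)
  fix i assume i: "i \<in> {1..n - 1}"
  have jm: "v (i - 1) \<noteq> v i \<and> (v (i - 1) < v i \<longrightarrow> v i = v (i - 1) + d)" if "i \<in> {1..n}" for i
    using v that by (auto simp: valid_def)
  consider "i < j" | "i = j" | "j < i" by linarith
  then have "mrg_v j v (i - 1) \<noteq> mrg_v j v i \<and> (mrg_v j v (i - 1) < mrg_v j v i \<longrightarrow> mrg_v j v i = mrg_v j v (i - 1) + d)"
  proof cases
    case 1 then show ?thesis using jm[of i] i j by (auto simp: mrg_v_def)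
  next
    case 2 then show ?thesis using down i by (auto simp: mrg_v_def)
  next
    case 3 then show ?thesis using jm[of "Suc i"] i by (auto simp: mrg_v_def)
  qed
  then show "mrg_v j v (i - 1) \<noteq> mrg_v j v i" "mrg_v j v (i - 1) < mrg_v j v i \<Longrightarrow> mrg_v j v i = mrg_v j v (i - 1) + d"
    by auto
next
  fix i assume i: "i \<in> {1..<n - 1}"
  have oo: "p i + chord F (v (i - 1)) (v i) * h \<le> p (Suc i) + chord F (v i) (v (Suc i)) * h" if "i \<in> {1..<n}" for i
    using o that by (auto simp: ordered_def)
  consider "i < j" | "i = j" | "j < i" by linarith
  then show "mrg_p F j p v h i \<le> mrg_p F j p v h (Suc i)"
  proof cases
    case 1 then show ?thesis using oo[of i] i by (auto simp: mrg_p_def)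
  next
    case 2 then show ?thesis using oo[of "Suc i"] i meet by (auto simp: mrg_p_def)
  next
    case 3 then show ?thesis using oo[of "Suc i"] i by (auto simp: mrg_p_def)
  qed
qed

lemma ftrack_exists:
  assumes F: "strictly_convex F" and v: "valid d J n p v"
  shows "\<exists>ex. ftrack F n p v \<tau> ex \<and> length ex \<le> 3 * n"
  using v
proof (induction n arbitrary: p v \<tau> rule: less_induct)
  case (less n)
  define c where "c = (\<lambda>j. chord F (v (j - 1)) (v j))"
  define C where "C = {j\<in>{1..<n}. c (Suc j) < c j}"
  define g where "g = (\<lambda>j. (p (Suc j) - p j) / (c j - c (Suc j)))"
  have pm: "p j \<le> p (Suc j)" if "j \<in> {1..<n}" for j using less.prems that by (auto simp: valid_def)
  have step: "p j + c j * h \<le> p (Suc j) + c (Suc j) * h" if "j \<in> {1..<n}" "j \<notin> C \<or> h \<le> g j" "0 \<le> h" for j h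
  proof (cases "j \<in> C")
    case True
    then have "h * (c j - c (Suc j)) \<le> p (Suc j) - p j"
      using that by (simp add: C_def g_def pos_le_divide_eq)
    then show ?thesis by (simp add: algebra_simps)
  next
    case False
    then have "c j * h \<le> c (Suc j) * h" using that by (intro mult_right_mono) (auto simp: C_def)
    then show ?thesis using pm that by fastforce
  qed
  show ?case
  proof (cases "C = {}")
    case True
    then have "\<forall>h\<ge>0. ordered F n p v h" using step by (auto simp: ordered_def c_def)
    then show ?thesis using ftrack.stop by (intro exI[of _ "[]"]) auto
  next
    case False
    have fin: "finite C" by (simp add: C_def)
    define H where "H = Min (g ` C)"
    have "H \<in> g ` C" unfolding H_def using fin False by (intro Min_in) auto
    then obtain j where j: "j \<in> C" "g j = H" by auto
    have jn: "1 \<le> j" "j < n" "c (Suc j) < c j" using j by (auto simp: C_def)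
    have Hle: "H \<le> g i" if "i \<in> C" for i using that fin by (auto simp: H_def)
    have H0: "0 \<le> H" using j jn pm[of j] by (auto simp: g_def)
    have ord: "ordered F n p v h" if "h \<in> {0..H}" for h
      using step[of _ h] Hle that by (force simp: ordered_def c_def)
    have "H * (c j - c (Suc j)) = p (Suc j) - p j" using j jn by (auto simp: g_def)
    then have meet: "p j + c j * H = p (Suc j) + c (Suc j) * H" by (simp add: algebra_simps)
    have ne: "v (i - 1) \<noteq> v i" if "i \<in> {1..n}" for i using less.prems that by (auto simp: valid_def)
    have down: "v (Suc j) < v (j - 1)"
      using merge_down[OF F, of "v (j - 1)" "v j" "v (Suc j)"] ne[of j] ne[of "Suc j"] jn by (auto simp: c_def)
    have "valid d J (n - 1) (mrg_p F j p v H) (mrg_v j v)"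
      using valid_merge[OF less.prems jn(1,2) ord[of H] _ down] meet H0 by (simp add: c_def)
    then obtain ex where ex: "ftrack F (n - 1) (mrg_p F j p v H) (mrg_v j v) (\<tau> + H) ex" "length ex \<le> 3 * (n - 1)"
      using less.IH[of "n - 1" "mrg_p F j p v H" "mrg_v j v" "\<tau> + H"] jn by auto
    have "ftrack F n p v \<tau> (mterms F j p v \<tau> (\<tau> + H) @ ex)"
      using ftrack.merge[of j n \<tau> "\<tau> + H" F p v ex] jn H0 ord meet down ex(1) by (simp add: c_def)
    moreover have "length (mterms F j p v \<tau> (\<tau> + H) @ ex) \<le> 3 * n"
      using ex(2) jn by (simp add: mterms_def Let_def)
    ultimately show ?thesis by blast
  qed
qed

lemma ftrack_upper:
  assumes "ftrack F n p v \<tau> ex" "valid d J n p v" "F 0 = 0" "\<tau> \<le> t"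
  shows "trk relu F n p v \<tau> ex (y + s * (t - \<tau>)) t \<le> fsum relu F n p v y 0 + (t - \<tau>) * lam F (grid d J) 1 s"
  using assms
proof (induction arbitrary: y t rule: ftrack.induct)
  case (stop n p v \<tau>)
  then show ?case
    using slab_upper[where F=F, OF stop.prems(1,2), of "t - \<tau>" y s] by (simp add: trk_def tsum_def)
next
  case (merge j n \<tau> \<theta> p v ex)
  note mb = trk_merge_before[OF merge.hyps(7)]
  note ma = trk_merge_after[OF merge.hyps(1,2,5)]
  have v': "valid d J (n - 1) (mrg_p F j p v (\<theta> - \<tau>)) (mrg_v j v)"
    using valid_merge[OF merge.prems(1) merge.hyps(1,2) _ merge.hyps(5,6)] merge.hyps(3,4) by auto
  have slab: "fsum relu F n p v (y + s * h) h \<le> fsum relu F n p v y 0 + h * lam F (grid d J) 1 s"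
    if "0 \<le> h" "h \<le> \<theta> - \<tau>" for h
    using that merge.hyps(4) by (intro slab_upper[where F=F, OF merge.prems(1,2)]) auto
  show ?case
  proof (cases "t \<le> \<theta>")
    case True
    then show ?thesis using mb slab[of "t - \<tau>"] merge.prems by simp
  next
    case False
    then have t: "\<theta> \<le> t" by simp
    let ?y = "y + s * (\<theta> - \<tau>)"
    have ys: "y + s * (t - \<tau>) = ?y + s * (t - \<theta>)" by (simp add: algebra_simps)
    have "trk relu F n p v \<tau> (mterms F j p v \<tau> \<theta> @ ex) (y + s * (t - \<tau>)) t
       \<le> fsum relu F n p v ?y (\<theta> - \<tau>) + (t - \<theta>) * lam F (grid d J) 1 s"
      using merge.IH[OF v' merge.prems(2) t, of ?y]
      unfolding ys ma[OF t] fsum_at_merge[where F=F, OF merge.hyps(1,2,5)] .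
    also have "\<dots> \<le> fsum relu F n p v y 0 + (\<theta> - \<tau>) * lam F (grid d J) 1 s + (t - \<theta>) * lam F (grid d J) 1 s"
      using slab[of "\<theta> - \<tau>"] merge.hyps(3) by simp
    finally show ?thesis by (simp add: algebra_simps)
  qed
qed

lemma ftrack_lower:
  assumes "ftrack F n p v \<tau> ex" "valid d J n p v" "F 0 = 0" "\<tau> \<le> t" "strictly_convex F" "0 < d"
  shows "\<exists>y. fsum relu F n p v y 0 + lam F (grid d J) (t - \<tau>) (x - y) \<le> trk relu F n p v \<tau> ex x t"
  using assms
proof (induction arbitrary: x t rule: ftrack.induct)
  case (stop n p v \<tau>)
  then show ?case
    using slab_lower[where F=F, OF stop.prems(1,2), of "t - \<tau>" x] by (simp add: trk_def tsum_def)
next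
  case (merge j n \<tau> \<theta> p v ex)
  note mb = trk_merge_before[OF merge.hyps(7)]
  note ma = trk_merge_after[OF merge.hyps(1,2,5)]
  have v': "valid d J (n - 1) (mrg_p F j p v (\<theta> - \<tau>)) (mrg_v j v)"
    using valid_merge[OF merge.prems(1) merge.hyps(1,2) _ merge.hyps(5,6)] merge.hyps(3,4) by auto
  have slab: "\<exists>y. fsum relu F n p v y 0 + lam F (grid d J) h (x - y) \<le> fsum relu F n p v x h"
    if "0 \<le> h" "h \<le> \<theta> - \<tau>" for h x
    using that merge.hyps(4) merge.prems by (intro slab_lower) auto
  show ?case
  proof (cases "t \<le> \<theta>")
    case True
    then show ?thesis using mb slab[of "t - \<tau>" x] merge.prems by simp
  next
    case False
    then have t: "\<theta> \<le> t" by simp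
    obtain y' where y': "fsum relu F n p v y' (\<theta> - \<tau>) + lam F (grid d J) (t - \<theta>) (x - y') \<le> trk relu F n p v \<tau> (mterms F j p v \<tau> \<theta> @ ex) x t"
      using merge.IH[OF v' merge.prems(2) t merge.prems(4,5), of x]
      unfolding ma[OF t] fsum_at_merge[where F=F, OF merge.hyps(1,2,5)] by blast
    obtain y where y: "fsum relu F n p v y 0 + lam F (grid d J) (\<theta> - \<tau>) (y' - y) \<le> fsum relu F n p v y' (\<theta> - \<tau>)"
      using slab[of "\<theta> - \<tau>" y'] merge.hyps(3) by auto
    have "grid d J \<noteq> {}" using zero_in_grid by blast
    from lam_subadd[OF finite_grid this, of F "t - \<theta>" "\<theta> - \<tau>" "x - y'" "y' - y"]
    have "lam F (grid d J) (t - \<tau>) (x - y) \<le> lam F (grid d J) (t - \<theta>) (x - y') + lam F (grid d J) (\<theta> - \<tau>) (y' - y)"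
      by simp
    then show ?thesis using y y' by (intro exI[of _ y]) linarith
  qed
qed

lemma jmp_shock:
  assumes F: "strictly_convex F" and ab: "b < a"
  shows "jmp F (chord F a b) a b w \<le> 0"
proof -
  define s where "s = chord F a b"
  have rh: "F a = F b + s * (a - b)" using chord_mult[of a b F] ab by (simp add: s_def algebra_simps)
  consider "w \<le> b" | "b < w" "w < a" | "a \<le> w" by linarith
  then show ?thesis
  proof cases
    case 2
    have "chord F b w < chord F b a" using chord_strict(1)[OF F 2] .
    then have "(w - b) * chord F b w \<le> (w - b) * s" using 2 by (intro mult_left_mono) (auto simp: s_def chord_commute)
    then have "F w - F b \<le> (w - b) * s" using chord_mult[of b w F] 2 by simp
    then show ?thesis using 2 rh by (simp add: jmp_def flip: s_def) (simp add: algebra_simps)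
  qed (use ab rh in \<open>auto simp: jmp_def sgn_if simp flip: s_def, auto simp: algebra_simps\<close>)
qed

lemma jmp_up:
  assumes ab: "a < b" and e: "0 \<le> e" "\<And>w. w \<in> {a..b} \<Longrightarrow> 2 * (F a + chord F a b * (w - a) - F w) \<le> e"
  shows "jmp F (chord F a b) a b w \<le> e"
proof -
  define s where "s = chord F a b"
  have rh: "F b = F a + s * (b - a)" using chord_mult[of a b F] ab by (simp add: s_def algebra_simps)
  consider "w \<le> a" | "a < w" "w < b" | "b \<le> w" by linarith
  then show ?thesis
  proof cases
    case 2
    then show ?thesis using e(2)[of w] rh by (simp add: jmp_def flip: s_def) (simp add: algebra_simps)
  qed (use ab rh e(1) in \<open>auto simp: jmp_def sgn_if simp flip: s_def, auto simp: algebra_simps\<close>)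
qed

lemma fsum_eq_stp:
  "fsum heav F n p v x (t - \<tau>) = stp n (\<lambda>j. p j - chord F (v (j - 1)) (v j) * \<tau>) (\<lambda>j. chord F (v (j - 1)) (v j)) v x t"
  unfolding fsum_def stp_def by (intro sum.cong refl) (simp add: algebra_simps)

lemma fsum_integrable:
  assumes "valid d J n p v" shows "integrable lborel (\<lambda>x. fsum heav F n p v x h)"
  using stp_integrable[of v n] assms fsum_eq_stp[of F n p v _ h 0] by (simp add: valid_def)

lemma trk_integrable:
  assumes "ftrack F n p v \<tau> ex" "valid d J n p v" "\<tau> \<le> t"
  shows "integrable lborel (\<lambda>x. trk heav F n p v \<tau> ex x t)"
  using assms
proof (induction arbitrary: t rule: ftrack.induct)
  case (stop n p v \<tau>)
  then show ?case using fsum_integrable by (simp add: trk_def tsum_def)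
next
  case (merge j n \<tau> \<theta> p v ex)
  have v': "valid d J (n - 1) (mrg_p F j p v (\<theta> - \<tau>)) (mrg_v j v)"
    using valid_merge[OF merge.prems(1) merge.hyps(1,2) _ merge.hyps(5,6)] merge.hyps(3,4) by auto
  show ?case
  proof (cases "t \<le> \<theta>")
    case True
    then show ?thesis unfolding trk_merge_before[OF merge.hyps(7) True] by (intro fsum_integrable[OF merge.prems(1)])
  next
    case False
    then have t: "\<theta> \<le> t" by simp
    show ?thesis unfolding trk_merge_after[where F=F, OF merge.hyps(1,2,5) t] by (rule merge.IH[OF v' t])
  qed
qed

context entropy_setting
begin

definition uh :: "real \<Rightarrow> real \<Rightarrow> real" where "uh x t = (if t = 0 then u0 x else u x t)"

lemma free_flight_error:
  assumes F: "strictly_convex F" and v: "valid d J n p v" and d: "0 < d"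
    and e0: "0 \<le> e0" "\<And>a w. a \<in> grid d J \<Longrightarrow> w \<in> {a..a+d} \<Longrightarrow> 2 * (F a + chord F a (a + d) * (w - a) - F w) \<le> e0"
    and t: "0 < t1" "t1 \<le> t2" "t2 < T"
    and ord: "\<And>h. h \<in> {t1 - \<tau>..t2 - \<tau>} \<Longrightarrow> ordered F n p v h"
  shows "(\<integral>x. \<bar>u x t2 - fsum heav F n p v x (t2 - \<tau>)\<bar> \<partial>lborel)
     \<le> (\<integral>x. \<bar>u x t1 - fsum heav F n p v x (t1 - \<tau>)\<bar> \<partial>lborel) + (t2 - t1) * (real n * e0)"
proof -
  define c where "c = (\<lambda>j. chord F (v (j - 1)) (v j))"
  define p' where "p' = (\<lambda>j. p j - c j * \<tau>)"
  define P where "P = (\<lambda>j. if j = 0 then - (1 + \<bar>p' 1\<bar> + \<bar>c 1\<bar> * T) else if j \<le> n then p' j else 1 + \<bar>p' n\<bar> + \<bar>c n\<bar> * T)"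
  define s where "s = (\<lambda>j. if 1 \<le> j \<and> j \<le> n then c j else 0)"
  have ct: "\<bar>c j * t\<bar> \<le> \<bar>c j\<bar> * T" if "t \<in> {t1..t2}" for j t
    using that t by (auto simp: abs_mult intro!: mult_left_mono)
  have T0: "0 \<le> \<bar>c j\<bar> * T" for j using T_pos by auto
  have ends: "P 0 \<le> -1" "s 0 = 0" "1 \<le> P (Suc n)" "s (Suc n) = 0" "v 0 = 0" "v n = 0"
    using v T0[of 1] T0[of n] by (auto simp: P_def s_def valid_def)
  have eq: "fsum heav F n p v x (t - \<tau>) = stp n P s v x t" for x t
    unfolding fsum_eq_stp stp_def by (intro sum.cong refl) (auto simp: P_def s_def p'_def c_def)
  have "err n P s v t2 \<le> err n P s v t1 + (t2 - t1) * (\<Sum>j=1..n. e0)"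
  proof (rule slab_estimate[OF ends t])
    fix t i assume ti: "t \<in> {t1..t2}" "i \<le> n"
    consider "i = 0" "n = 0" | "i = 0" "n \<noteq> 0" | "i \<noteq> 0" "i = n" | "i \<noteq> 0" "i < n" using ti by linarith
    then show "P i + s i * t \<le> P (Suc i) + s (Suc i) * t"
    proof cases
      case 1 then show ?thesis using T0[of 1] T0[of 0] by (simp add: P_def s_def)
    next
      case 2 then show ?thesis using ct[OF ti(1), of 1] by (simp add: P_def s_def)
    next
      case 3 then show ?thesis using ct[OF ti(1), of n] by (simp add: P_def s_def)
    next
      case 4
      then have "p i + c i * (t - \<tau>) \<le> p (Suc i) + c (Suc i) * (t - \<tau>)"
        using ord[of "t - \<tau>"] ti by (auto simp: ordered_def c_def)
      then show ?thesis using 4 by (simp add: P_def s_def p'_def algebra_simps)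
    qed
  next
    have "jmp F (s j) (v (j - 1)) (v j) w \<le> e0" if j: "j \<in> {1..n}" for j w
    proof -
      have jm: "v (j - 1) \<noteq> v j" "v (j - 1) < v j \<Longrightarrow> v j = v (j - 1) + d" "v (j - 1) \<in> grid d J"
        using v j by (auto simp: valid_def)
      have sj: "s j = chord F (v (j - 1)) (v j)" using j by (simp add: s_def c_def)
      show ?thesis
      proof (cases "v (j - 1) < v j")
        case True
        show ?thesis unfolding sj using jmp_up[OF True e0(1)] e0(2)[OF jm(3)] jm(2)[OF True] by simp
      next
        case False
        then have "v j < v (j - 1)" using jm(1) by simp
        then show ?thesis unfolding sj using jmp_shock[OF F] e0(1) order_trans by blast
      qed
    qed
    then show "AE q in lborel. q \<in> Q \<longrightarrow> (\<forall>j\<in>{1..n}. jmp F (s j) (v (j - 1)) (v j) (U q) \<le> e0)"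
      by (intro AE_I2) blast
  qed (use e0 in auto)
  then show ?thesis by (simp add: err_def eq)
qed

lemma free_flight_error_initial:
  assumes F: "strictly_convex F" and v: "valid d J n p v" and d: "0 < d"
    and e0: "0 \<le> e0" "\<And>a w. a \<in> grid d J \<Longrightarrow> w \<in> {a..a+d} \<Longrightarrow> 2 * (F a + chord F a (a + d) * (w - a) - F w) \<le> e0"
    and t: "0 \<le> \<tau>" "\<tau> \<le> t" "t < T"
    and ord: "\<And>h. h \<in> {0..t - \<tau>} \<Longrightarrow> ordered F n p v h"
  shows "(\<integral>x. \<bar>uh x t - fsum heav F n p v x (t - \<tau>)\<bar> \<partial>lborel)
     \<le> (\<integral>x. \<bar>uh x \<tau> - fsum heav F n p v x 0\<bar> \<partial>lborel) + (t - \<tau>) * (real n * e0)"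
proof -
  consider "t = \<tau>" | "0 < \<tau>" | "\<tau> = 0" "0 < t" using t by linarith
  then show ?thesis
  proof cases
    case 2
    then show ?thesis using free_flight_error[OF F v d e0, of \<tau> t \<tau>] t ord by (auto simp: uh_def)
  next
    case 3
    have v0: "v 0 = 0" "v n = 0" and pm: "\<And>j. j \<in> {1..<n} \<Longrightarrow> p j \<le> p (Suc j)" using v by (auto simp: valid_def)
    define c where "c = (\<lambda>j. chord F (v (j - 1)) (v j))"
    have fs: "fsum heav F n p v x h = stp n p c v x h" for x h
      using fsum_eq_stp[of F n p v x h 0] by (simp add: c_def)
    have fs0: "stp n p (\<lambda>_. 0) v x 0 = stp n p c v x 0" for x by (simp add: stp_def)
    obtain C where C: "0 \<le> C" "\<And>t. 0 < t \<Longrightarrow> t < T \<Longrightarrow>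
       (\<integral>x. \<bar>u x t - stp n p c v x 0\<bar> \<partial>lborel) \<le> (\<integral>x. \<bar>u0 x - stp n p c v x 0\<bar> \<partial>lborel) + C * t"
      using initial_estimate[where v=v and n=n and p=p, OF v0 pm] unfolding fs0 by blast
    define D where "D = (\<Sum>j=1..n. \<bar>v j - v (j - 1)\<bar> * \<bar>c j\<bar>)"
    have D0: "0 \<le> D" unfolding D_def by (intro sum_nonneg) auto
    let ?A0 = "\<integral>x. \<bar>u0 x - stp n p c v x 0\<bar> \<partial>lborel"
    have key: "(\<integral>x. \<bar>u x t - stp n p c v x t\<bar> \<partial>lborel) \<le> ?A0 + t * (real n * e0) + (C + D) * t1" if t1: "0 < t1" "t1 \<le> t" for t1
    proof -
      have ii: "integrable lborel (\<lambda>x. u x t1)" "integrable lborel (\<lambda>x. stp n p c v x h)" for h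
        using u_integrable[of t1] t1 t stp_integrable[OF v0] by auto
      have "(\<integral>x. \<bar>u x t - stp n p c v x t\<bar> \<partial>lborel) \<le> (\<integral>x. \<bar>u x t1 - stp n p c v x t1\<bar> \<partial>lborel) + (t - t1) * (real n * e0)"
        using free_flight_error[OF F v d e0, of t1 t 0] t1 t ord 3 by (simp add: fs)
      also have "\<dots> \<le> (\<integral>x. \<bar>u x t1 - stp n p c v x t1\<bar> \<partial>lborel) + t * (real n * e0)"
        using t1 e0(1) by (intro add_left_mono mult_right_mono) auto
      also have "(\<integral>x. \<bar>u x t1 - stp n p c v x t1\<bar> \<partial>lborel) \<le> (\<integral>x. \<bar>u x t1 - stp n p c v x 0\<bar> + \<bar>stp n p c v x t1 - stp n p c v x 0\<bar> \<partial>lborel)"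
        using ii by (intro integral_mono Bochner_Integration.integrable_add integrable_abs Bochner_Integration.integrable_diff) auto
      also have "\<dots> = (\<integral>x. \<bar>u x t1 - stp n p c v x 0\<bar> \<partial>lborel) + (\<integral>x. \<bar>stp n p c v x t1 - stp n p c v x 0\<bar> \<partial>lborel)"
        using ii by (intro Bochner_Integration.integral_add integrable_abs Bochner_Integration.integrable_diff) auto
      also have "\<dots> \<le> (?A0 + C * t1) + D * t1"
        using C(2)[of t1] stp_time_diff(2)[of n p c v t1 0] t1 t by (intro add_mono) (auto simp: D_def)
      finally show ?thesis by (simp add: algebra_simps)
    qed
    have "(\<integral>x. \<bar>u x t - stp n p c v x t\<bar> \<partial>lborel) \<le> ?A0 + t * (real n * e0)"
    proof (rule field_le_epsilon)
      fix \<gamma> :: real assume g: "0 < \<gamma>"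
      define t1 where "t1 = min t (\<gamma> / (C + D + 1))"
      have t1: "0 < t1" "t1 \<le> t" using g 3 C(1) D0 by (auto simp: t1_def)
      have "t1 \<le> \<gamma> / (C + D + 1)" by (simp add: t1_def)
      then have "(C + D + 1) * t1 \<le> \<gamma>" using C(1) D0 by (simp add: field_simps)
      then have "(C + D) * t1 \<le> \<gamma>" using t1 by (simp add: algebra_simps)
      then show "(\<integral>x. \<bar>u x t - stp n p c v x t\<bar> \<partial>lborel) \<le> ?A0 + t * (real n * e0) + \<gamma>"
        using key[OF t1] by linarith
    qed
    then show ?thesis using 3 by (simp add: uh_def fs)
  qed simp
qed

lemma ftrack_entropy_error:
  assumes "ftrack F n p v \<tau> ex" "valid d J n p v" "0 \<le> \<tau>" "\<tau> \<le> t" "t < T"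
    and F: "strictly_convex F" and d: "0 < d"
    and e0: "0 \<le> e0" "\<And>a w. a \<in> grid d J \<Longrightarrow> w \<in> {a..a+d} \<Longrightarrow> 2 * (F a + chord F a (a + d) * (w - a) - F w) \<le> e0"
  shows "(\<integral>x. \<bar>uh x t - trk heav F n p v \<tau> ex x t\<bar> \<partial>lborel)
     \<le> (\<integral>x. \<bar>uh x \<tau> - fsum heav F n p v x 0\<bar> \<partial>lborel) + (t - \<tau>) * (real n * e0)"
  using assms(1-5)
proof (induction arbitrary: t rule: ftrack.induct)
  case (stop n p v \<tau>)
  then show ?case
    using free_flight_error_initial[OF F stop.prems(1) d e0, of \<tau> t] by (simp add: trk_def tsum_def)
next
  case (merge j n \<tau> \<theta> p v ex)
  note mb = trk_merge_before[OF merge.hyps(7)]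
  note ma = trk_merge_after[where F=F, OF merge.hyps(1,2,5)]
  have v': "valid d J (n - 1) (mrg_p F j p v (\<theta> - \<tau>)) (mrg_v j v)"
    using valid_merge[OF merge.prems(1) merge.hyps(1,2) _ merge.hyps(5,6)] merge.hyps(3,4) by auto
  have slab: "(\<integral>x. \<bar>uh x s - fsum heav F n p v x (s - \<tau>)\<bar> \<partial>lborel)
     \<le> (\<integral>x. \<bar>uh x \<tau> - fsum heav F n p v x 0\<bar> \<partial>lborel) + (s - \<tau>) * (real n * e0)"
    if "\<tau> \<le> s" "s \<le> \<theta>" "s < T" for s
    using that merge.hyps(4) merge.prems by (intro free_flight_error_initial[OF F merge.prems(1) d e0]) auto
  show ?case
  proof (cases "t \<le> \<theta>")
    case True
    then show ?thesis using mb slab[of t] merge.prems by simp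
  next
    case False
    then have t: "\<theta> \<le> t" by simp
    have "(\<integral>x. \<bar>uh x t - trk heav F n p v \<tau> (mterms F j p v \<tau> \<theta> @ ex) x t\<bar> \<partial>lborel)
       \<le> (\<integral>x. \<bar>uh x \<theta> - fsum heav F n p v x (\<theta> - \<tau>)\<bar> \<partial>lborel) + (t - \<theta>) * (real (n - 1) * e0)"
      using merge.IH[OF v' _ t merge.prems(4)] merge.hyps(3) merge.prems(2)
      unfolding ma[OF t] fsum_at_merge[where F=F, OF merge.hyps(1,2,5)] by simp
    also have "\<dots> \<le> ((\<integral>x. \<bar>uh x \<tau> - fsum heav F n p v x 0\<bar> \<partial>lborel) + (\<theta> - \<tau>) * (real n * e0)) + (t - \<theta>) * (real n * e0)"
      using t merge.hyps(3) merge.prems e0(1)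
      by (intro add_mono slab mult_left_mono mult_right_mono) auto
    finally show ?thesis by (simp add: algebra_simps)
  qed
qed

end

section \<open>Comparison of Hopf-Lax solutions\<close>

lemma lam_increments:
  assumes "finite P" "P \<noteq> {}" "a \<le> b" "0 \<le> k"
  shows "lam F P h (a + k) - lam F P h a \<le> lam F P h (b + k) - lam F P h b"
proof -
  obtain w where w: "w \<in> P" "lam F P h (a + k) = w * (a + k) - h * F w" using lam_attained[OF assms(1,2)] .
  obtain w' where w': "w' \<in> P" "lam F P h b = w' * b - h * F w'" using lam_attained[OF assms(1,2)] .
  show ?thesis
  proof (cases "w' \<le> w")
    case True
    then have "0 \<le> (w - w') * (b - a)" using assms by (intro mult_nonneg_nonneg) auto
    then show ?thesis
      using lam_ge[OF assms(1) w(1), of "b + k" h F] lam_ge[OF assms(1) w'(1), of a h F] w(2) w'(2)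
      by (simp add: algebra_simps)
  next
    case False
    then have "0 \<le> (w' - w) * k" using assms by (intro mult_nonneg_nonneg) auto
    then show ?thesis
      using lam_ge[OF assms(1) w(1), of a h F] lam_ge[OF assms(1) w'(1), of "b + k" h F] w(2) w'(2)
      by (simp add: algebra_simps)
  qed
qed

lemma convex_majorize:
  assumes F: "strictly_convex F" and x: "a \<le> x" "x \<le> b"
  shows "F x + F (a + b - x) \<le> F a + F b"
proof (cases "x = a \<or> x = b")
  case False
  then have ab: "a < x" "x < b" using x by auto
  define s where "s = (x - a) / (b - a)"
  have s: "0 < s" "s < 1" using ab by (auto simp: s_def field_simps)
  have xs: "x = a + s * (b - a)" using ab by (simp add: s_def)
  have i1: "F ((1 - s) * a + s * b) < (1 - s) * F a + s * F b"
    using F s ab unfolding strictly_convex_def by (metis less_irrefl less_trans)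
  have i2: "F ((1 - s) * b + s * a) < (1 - s) * F b + s * F a"
    using F s ab unfolding strictly_convex_def by (metis less_irrefl less_trans)
  have e: "(1 - s) * a + s * b = x" "(1 - s) * b + s * a = a + b - x"
    unfolding xs by (simp_all add: algebra_simps)
  show ?thesis using i1 i2 unfolding e by (simp add: left_diff_distrib)
qed auto

text \<open>Two maximisers more than \<open>d\<close> apart can be replaced by a pair with the same sum lying between them, which
  does not increase the sum of the values of \<open>F\<close>.\<close>

lemma lam_grid_diff:
  fixes J m :: nat
  assumes F: "strictly_convex F" and d: "0 < d" and m: "1 \<le> m" and h: "0 \<le> h" and z: "z \<le> z'"
  defines "P \<equiv> grid d J" and "P' \<equiv> grid (d / real m) (J * m)"
  shows "lam F P' h z' + lam F P h z \<le> lam F P' h z + lam F P h z' + d * (z' - z)"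
    and "lam F P' h z + lam F P h z' \<le> lam F P' h z' + lam F P h z + d * (z' - z)"
proof -
  define e where "e = d / real m"
  have de: "d = e * real m" using m by (simp add: e_def)
  have e0: "0 < e" using d m by (simp add: e_def)
  have fin: "finite P" "P \<noteq> {}" "finite P'" "P' \<noteq> {}"
    unfolding P_def P'_def by (auto simp: grid_def)
  have zz: "0 \<le> z' - z" using z by simp
  have inP': "e * real_of_int i \<in> P'" if "\<bar>i\<bar> \<le> int (J * m)" for i
    unfolding P'_def grid_def e_def by (intro imageI) (use that in auto)
  have P'D: "\<exists>i. w = e * real_of_int i \<and> \<bar>i\<bar> \<le> int (J * m)" if w: "w \<in> P'" for w
  proof -
    obtain i where "w = e * real_of_int i" "i \<in> {- int (J * m)..int (J * m)}"
      using w unfolding P'_def grid_def e_def by (elim imageE)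
    then show ?thesis by (intro exI[of _ i]) auto
  qed
  have PD: "\<exists>i. w = d * real_of_int i \<and> \<bar>i\<bar> \<le> int J" if w: "w \<in> P" for w
  proof -
    obtain i where "w = d * real_of_int i" "i \<in> {- int J..int J}"
      using w unfolding P_def grid_def by (elim imageE)
    then show ?thesis by (intro exI[of _ i]) auto
  qed
  have m0: "0 < int m" using m by simp
  show "lam F P' h z' + lam F P h z \<le> lam F P' h z + lam F P h z' + d * (z' - z)"
  proof -
    obtain a where a: "a \<in> P'" "lam F P' h z' = a * z' - h * F a" using lam_attained[OF fin(3,4)] .
    obtain b where b: "b \<in> P" "lam F P h z = b * z - h * F b" using lam_attained[OF fin(1,2)] .
    obtain \<alpha> where \<alpha>: "a = e * real_of_int \<alpha>" "\<bar>\<alpha>\<bar> \<le> int (J * m)" using P'D[OF a(1)] by blast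
    obtain \<beta> where \<beta>: "b = d * real_of_int \<beta>" "\<bar>\<beta>\<bar> \<le> int J" using PD[OF b(1)] by blast
    have b': "b = e * real_of_int (int m * \<beta>)" using \<beta> de by simp
    have mb: "\<bar>int m * \<beta>\<bar> \<le> int (J * m)"
      using mult_left_mono[OF \<beta>(2), of "int m"] by (simp add: abs_mult mult.commute)
    have bP': "b \<in> P'" unfolding b' by (rule inP'[OF mb])
    show ?thesis
    proof (cases "a \<le> b + d")
      case True
      then have "0 \<le> (b + d - a) * (z' - z)" using zz by (intro mult_nonneg_nonneg) auto
      then show ?thesis
        using lam_ge[OF fin(3) a(1), of z h F] lam_ge[OF fin(1) b(1), of z' h F] a(2) b(2)
        by (simp add: algebra_simps)
    next
      case False
      define r where "r = \<alpha> mod int m"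
      define c where "c = d * real_of_int (\<alpha> div int m)"
      have r: "0 \<le> r" "r < int m" using m0 by (auto simp: r_def)
      have \<alpha>dec: "\<alpha> = int m * (\<alpha> div int m) + r" by (simp add: r_def)
      have ac: "a = c + e * real_of_int r"
        unfolding \<alpha>(1) by (subst \<alpha>dec) (simp add: c_def de algebra_simps)
      have er: "0 \<le> e * real_of_int r" "e * real_of_int r \<le> d"
        using r e0 by (auto simp: de intro!: mult_left_mono)
      have cP: "c \<in> P"
      proof -
        have "\<alpha> \<le> int J * int m" "- (int J * int m) \<le> \<alpha>" using \<alpha>(2) by auto
        then have "\<alpha> div int m \<le> int J" "- int J \<le> \<alpha> div int m"
          using m0 zdiv_mono1[of \<alpha> "int J * int m" "int m"] zdiv_mono1[of "- (int J * int m)" \<alpha> "int m"]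
            nonzero_mult_div_cancel_right[of "int m" "- int J"] by auto
        then show ?thesis by (auto simp: P_def grid_def c_def)
      qed
      have aP: "a + b - c \<in> P'"
      proof -
        have e1: "a + b - c = e * real_of_int (int m * \<beta> + r)" unfolding ac b' by (simp add: algebra_simps)
        have "c > b" using ac er False by linarith
        then have "e * real_of_int (int m * \<beta> + r) \<le> e * real_of_int \<alpha>" using e1 \<alpha> by simp
        then have "int m * \<beta> + r \<le> \<alpha>" using e0 by (simp del: of_int_add)
        then have "\<bar>int m * \<beta> + r\<bar> \<le> int (J * m)" using \<alpha>(2) mb r by auto
        then show ?thesis unfolding e1 by (rule inP')
      qed
      have "F c + F (b + a - c) \<le> F b + F a"
        using ac er False by (intro convex_majorize[OF F]) linarith+
      then have "h * F c + h * F (a + b - c) \<le> h * F a + h * F b"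
        using mult_left_mono[OF _ h] by (fastforce simp: algebra_simps)
      moreover have "0 \<le> (c + d - a) * (z' - z)" using zz ac er by (intro mult_nonneg_nonneg) auto
      ultimately show ?thesis
        using lam_ge[OF fin(3) aP, of z h F] lam_ge[OF fin(1) cP, of z' h F] a(2) b(2)
        by (simp add: algebra_simps)
    qed
  qed
  show "lam F P' h z + lam F P h z' \<le> lam F P' h z' + lam F P h z + d * (z' - z)"
  proof -
    obtain a where a: "a \<in> P'" "lam F P' h z = a * z - h * F a" using lam_attained[OF fin(3,4)] .
    obtain b where b: "b \<in> P" "lam F P h z' = b * z' - h * F b" using lam_attained[OF fin(1,2)] .
    obtain \<alpha> where \<alpha>: "a = e * real_of_int \<alpha>" "\<bar>\<alpha>\<bar> \<le> int (J * m)" using P'D[OF a(1)] by blast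
    obtain \<beta> where \<beta>: "b = d * real_of_int \<beta>" "\<bar>\<beta>\<bar> \<le> int J" using PD[OF b(1)] by blast
    have b': "b = e * real_of_int (int m * \<beta>)" using \<beta> de by simp
    have mb: "\<bar>int m * \<beta>\<bar> \<le> int (J * m)"
      using mult_left_mono[OF \<beta>(2), of "int m"] by (simp add: abs_mult mult.commute)
    show ?thesis
    proof (cases "b \<le> a + d")
      case True
      then have "0 \<le> (a + d - b) * (z' - z)" using zz by (intro mult_nonneg_nonneg) auto
      then show ?thesis
        using lam_ge[OF fin(3) a(1), of z' h F] lam_ge[OF fin(1) b(1), of z h F] a(2) b(2)
        by (simp add: algebra_simps)
    next
      case False
      define r where "r = (- \<alpha>) mod int m"
      define c where "c = d * real_of_int (- ((- \<alpha>) div int m))"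
      have r: "0 \<le> r" "r < int m" using m0 by (auto simp: r_def)
      have \<alpha>dec: "\<alpha> = int m * (- ((- \<alpha>) div int m)) - r"
        using mult_div_mod_eq[of "int m" "- \<alpha>"] unfolding r_def by linarith
      have ac: "a = c - e * real_of_int r"
        unfolding \<alpha>(1) by (subst \<alpha>dec) (simp add: c_def de algebra_simps)
      have er: "0 \<le> e * real_of_int r" "e * real_of_int r \<le> d"
        using r e0 by (auto simp: de intro!: mult_left_mono)
      have cP: "c \<in> P"
      proof -
        have "- \<alpha> \<le> int J * int m" "- (int J * int m) \<le> - \<alpha>" using \<alpha>(2) by auto
        then have "(- \<alpha>) div int m \<le> int J" "- int J \<le> (- \<alpha>) div int m"
          using m0 zdiv_mono1[of "- \<alpha>" "int J * int m" "int m"] zdiv_mono1[of "- (int J * int m)" "- \<alpha>" "int m"]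
            nonzero_mult_div_cancel_right[of "int m" "- int J"] by auto
        then show ?thesis unfolding P_def grid_def c_def by (intro imageI) auto
      qed
      have aP: "a + b - c \<in> P'"
      proof -
        have e1: "a + b - c = e * real_of_int (int m * \<beta> - r)" unfolding ac b' by (simp add: algebra_simps)
        have "c < b" using ac er False by linarith
        then have "e * real_of_int \<alpha> \<le> e * real_of_int (int m * \<beta> - r)" using e1 \<alpha> by simp
        then have "\<alpha> \<le> int m * \<beta> - r" using e0 by (simp del: of_int_diff)
        then have "\<bar>int m * \<beta> - r\<bar> \<le> int (J * m)" using \<alpha>(2) mb r by auto
        then show ?thesis unfolding e1 by (rule inP')
      qed
      have "F c + F (a + b - c) \<le> F a + F b"
        using ac er False by (intro convex_majorize[OF F]) linarith+
      then have "h * F c + h * F (a + b - c) \<le> h * F a + h * F b"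
        using mult_left_mono[OF _ h] by (fastforce simp: algebra_simps)
      moreover have "0 \<le> (a + d - c) * (z' - z)" using zz ac er by (intro mult_nonneg_nonneg) auto
      ultimately show ?thesis
        using lam_ge[OF fin(3) aP, of z' h F] lam_ge[OF fin(1) cP, of z h F] a(2) b(2)
        by (simp add: algebra_simps)
    qed
  qed
qed

text \<open>The comparison of the slopes of \<open>UP\<close> and \<open>U\<close> compensates the difference of the kernels: an order-preservation
  property for minimisers taken from different problems.\<close>

lemma hopf_lax_order:
  fixes U UP L LP W WP :: "real \<Rightarrow> real"
  assumes WP: "\<And>y. y \<in> {-1..2} \<Longrightarrow> WP x1 \<le> UP y + LP (x1 - y)"
    and W: "\<And>y. y \<in> {-1..2} \<Longrightarrow> W x2 \<le> U y + L (x2 - y)"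
    and y1: "y1 \<in> {-1..2}" "U y1 + L (x1 - y1) \<le> W x1"
    and y2: "y2 \<in> {-1..2}" "UP y2 + LP (x2 - y2) \<le> WP x2"
    and conv: "\<And>a b k. a \<le> b \<Longrightarrow> 0 \<le> k \<Longrightarrow> L (a + k) - L a \<le> L (b + k) - L b"
    and lip: "\<And>z z'. \<bar>(LP z' - L z') - (LP z - L z)\<bar> \<le> D * \<bar>z' - z\<bar>"
    and A: "\<And>y y'. -1 \<le> y \<Longrightarrow> y \<le> y' \<Longrightarrow> y' \<le> 2 \<Longrightarrow> D * (y' - y) \<le> (UP y' - U y') - (UP y - U y)"
    and x: "x1 \<le> x2" and D: "0 \<le> D"
  shows "WP x1 + W x2 \<le> WP x2 + W x1 + D * (x2 - x1)"
proof (cases "y1 \<le> y2")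
  case True
  have "D * \<bar>(x2 - y2) - (x1 - y1)\<bar> \<le> D * ((x2 - x1) + (y2 - y1))"
    using D x True by (intro mult_left_mono) auto
  then have "- (D * (x2 - x1)) - D * (y2 - y1) \<le> (LP (x2 - y2) - L (x2 - y2)) - (LP (x1 - y1) - L (x1 - y1))"
    using lip[of "x2 - y2" "x1 - y1"] by (simp add: algebra_simps)
  then show ?thesis using WP[OF y1(1)] W[OF y2(1)] y1 y2 A[of y1 y2] True by simp
next
  case False
  have "L (x1 - y1 + (x2 - x1)) - L (x1 - y1) \<le> L (x1 - y2 + (x2 - x1)) - L (x1 - y2)"
    using False x by (intro conv) auto
  then have "L (x2 - y1) - L (x1 - y1) \<le> L (x2 - y2) - L (x1 - y2)" by simp
  moreover have "- (D * (x2 - x1)) \<le> (LP (x2 - y2) - L (x2 - y2)) - (LP (x1 - y2) - L (x1 - y2))"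
    using lip[of "x2 - y2" "x1 - y2"] x by (simp add: abs_le_iff)
  ultimately show ?thesis using WP[OF y2(1)] W[OF y1(1)] y1 y2 by simp
qed

text \<open>The Crandall-Tartar argument: both potentials are compared with one whose slope exceeds theirs.\<close>

lemma hopf_lax_compare:
  fixes U1 U2 UP L1 L2 W1 W2 :: "real \<Rightarrow> real"
  assumes W1: "\<And>x y. W1 x \<le> U1 y + L1 (x - y)" "\<And>x. x \<in> {0..1} \<Longrightarrow> \<exists>y\<in>{-1..2}. U1 y + L1 (x - y) \<le> W1 x"
    and W2: "\<And>x y. W2 x \<le> U2 y + L2 (x - y)" "\<And>x. x \<in> {0..1} \<Longrightarrow> \<exists>y\<in>{-1..2}. U2 y + L2 (x - y) \<le> W2 x"
    and conv: "\<And>a b k. a \<le> b \<Longrightarrow> 0 \<le> k \<Longrightarrow> L1 (a + k) - L1 a \<le> L1 (b + k) - L1 b"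
       "\<And>a b k. a \<le> b \<Longrightarrow> 0 \<le> k \<Longrightarrow> L2 (a + k) - L2 a \<le> L2 (b + k) - L2 b"
    and lip: "\<And>z z'. \<bar>(L1 z' - L2 z') - (L1 z - L2 z)\<bar> \<le> D * \<bar>z' - z\<bar>" and D: "0 \<le> D"
    and A: "\<And>y y'. -1 \<le> y \<Longrightarrow> y \<le> y' \<Longrightarrow> y' \<le> 2 \<Longrightarrow> D * (y' - y) \<le> (UP y' - U1 y') - (UP y - U1 y)"
       "\<And>y y'. -1 \<le> y \<Longrightarrow> y \<le> y' \<Longrightarrow> y' \<le> 2 \<Longrightarrow> D * (y' - y) \<le> (UP y' - U2 y') - (UP y - U2 y)"
    and cont: "continuous_on {-1..2} UP" "continuous_on UNIV L1"
    and N: "(UP 2 - U1 2) - (UP (-1) - U1 (-1)) + ((UP 2 - U2 2) - (UP (-1) - U2 (-1))) \<le> N"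
  obtains S where "\<And>a b. 0 \<le> a \<Longrightarrow> a \<le> b \<Longrightarrow> b \<le> 1 \<Longrightarrow> \<bar>(W1 b - W2 b) - (W1 a - W2 a)\<bar> \<le> S b - S a"
    "S 1 - S 0 \<le> N + 10 * D"
proof -
  have "\<exists>y\<in>{-1..2}. \<forall>y'\<in>{-1..2}. UP y + L1 (x - y) \<le> UP y' + L1 (x - y')" for x
    by (rule continuous_attains_inf) (auto intro!: continuous_intros cont continuous_on_compose2[OF cont(2)])
  then obtain yP where yP: "\<And>x. yP x \<in> {-1..2}" "\<And>x y'. y' \<in> {-1..2} \<Longrightarrow> UP (yP x) + L1 (x - yP x) \<le> UP y' + L1 (x - y')"
    by metis
  define WP where "WP = (\<lambda>x. UP (yP x) + L1 (x - yP x))"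
  have WP_le: "WP x \<le> UP y + L1 (x - y)" if "y \<in> {-1..2}" for x y using yP(2)[OF that] by (simp add: WP_def)
  define S where "S = (\<lambda>x. (WP x - W1 x + D * x) + (WP x - W2 x + D * x))"
  have m1: "WP a + W1 b \<le> WP b + W1 a + D * (b - a)" if ab: "0 \<le> a" "a \<le> b" "b \<le> 1" for a b
  proof -
    obtain y where y: "y \<in> {-1..2}" "U1 y + L1 (a - y) \<le> W1 a" using W1(2)[of a] ab by auto
    show ?thesis
      by (rule hopf_lax_order[where U=U1 and UP=UP and L=L1 and LP=L1 and ?y1.0=y and ?y2.0="yP b"])
        (use WP_le W1(1) y yP(1) conv(1) A(1) that D in \<open>auto simp: WP_def\<close>)
  qed
  have m2: "WP a + W2 b \<le> WP b + W2 a + D * (b - a)" if ab: "0 \<le> a" "a \<le> b" "b \<le> 1" for a b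
  proof -
    obtain y where y: "y \<in> {-1..2}" "U2 y + L2 (a - y) \<le> W2 a" using W2(2)[of a] ab by auto
    show ?thesis
      by (rule hopf_lax_order[where U=U2 and UP=UP and L=L2 and LP=L1 and ?y1.0=y and ?y2.0="yP b"])
        (use WP_le W2(1) y yP(1) conv(2) A(2) that D lip in \<open>auto simp: WP_def\<close>)
  qed
  have mon: "UP y - U y - (UP y' - U y') \<le> (UP 2 - U 2) - (UP (-1) - U (-1))"
    if "\<And>y y'. -1 \<le> y \<Longrightarrow> y \<le> y' \<Longrightarrow> y' \<le> 2 \<Longrightarrow> D * (y' - y) \<le> (UP y' - U y') - (UP y - U y)"
      "y \<in> {-1..2}" "y' \<in> {-1..2}" for U y y'
  proof -
    have "0 \<le> D * (2 - y)" "0 \<le> D * (y' - (-1))" using D that by (auto intro!: mult_nonneg_nonneg)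
    moreover have "D * (2 - y) \<le> (UP 2 - U 2) - (UP y - U y)" "D * (y' - (-1)) \<le> (UP y' - U y') - (UP (-1) - U (-1))"
      by (rule that(1); use that(2,3) in simp)+
    ultimately show ?thesis by linarith
  qed
  have e1: "(WP 1 - W1 1) - (WP 0 - W1 0) \<le> (UP 2 - U1 2) - (UP (-1) - U1 (-1))"
  proof -
    obtain y where y: "y \<in> {-1..2}" "U1 y + L1 (1 - y) \<le> W1 1" using W1(2)[of 1] by auto
    have "WP 1 - W1 1 \<le> UP y - U1 y" using WP_le[OF y(1), of 1] y by simp
    moreover have "WP 0 - W1 0 \<ge> UP (yP 0) - U1 (yP 0)" using W1(1)[of 0 "yP 0"] by (simp add: WP_def)
    ultimately show ?thesis using mon[OF A(1) y(1) yP(1)[of 0]] by simp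
  qed
  have e2: "(WP 1 - W2 1) - (WP 0 - W2 0) \<le> (UP 2 - U2 2) - (UP (-1) - U2 (-1)) + 4 * D"
  proof -
    obtain y where y: "y \<in> {-1..2}" "U2 y + L2 (1 - y) \<le> W2 1" using W2(2)[of 1] by auto
    have "WP 1 - W2 1 \<le> UP y - U2 y + (L1 (1 - y) - L2 (1 - y))" using WP_le[OF y(1), of 1] y by simp
    moreover have "WP 0 - W2 0 \<ge> UP (yP 0) - U2 (yP 0) + (L1 (0 - yP 0) - L2 (0 - yP 0))"
      using W2(1)[of 0 "yP 0"] by (simp add: WP_def)
    moreover have "(L1 (1 - y) - L2 (1 - y)) - (L1 (0 - yP 0) - L2 (0 - yP 0)) \<le> 4 * D"
    proof -
      have "\<bar>(1 - y) - (0 - yP 0)\<bar> \<le> 4" using y(1) yP(1)[of 0] by auto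
      then have "D * \<bar>(1 - y) - (0 - yP 0)\<bar> \<le> D * 4" using D by (intro mult_left_mono)
      then show ?thesis using lip[of "1 - y" "0 - yP 0"] by linarith
    qed
    ultimately show ?thesis using mon[OF A(2) y(1) yP(1)[of 0]] by simp
  qed
  show ?thesis
  proof (rule that[of S])
    fix a b :: real assume ab: "0 \<le> a" "a \<le> b" "b \<le> 1"
    show "\<bar>(W1 b - W2 b) - (W1 a - W2 a)\<bar> \<le> S b - S a"
      using m1[OF ab] m2[OF ab] by (simp add: S_def algebra_simps abs_le_iff)
  next
    show "S 1 - S 0 \<le> N + 10 * D" using e1 e2 N D by (simp add: S_def)
  qed
qed

definition pl :: "(real \<Rightarrow> real) \<Rightarrow> (real \<times> real) list \<Rightarrow> real \<Rightarrow> real" where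
  "pl k xs x = (\<Sum>(c, a)\<leftarrow>xs. c * k (x - a))"

lemma pl_append: "pl k (xs @ ys) x = pl k xs x + pl k ys x" by (simp add: pl_def)

lemma pl_uminus: "pl k (map (\<lambda>(c, a). (- c, a)) xs) x = - pl k xs x"
  by (induction xs) (auto simp: pl_def)

lemma pl_Nil [simp]: "pl k [] x = 0" and pl_Cons [simp]: "pl k ((c, a) # xs) x = c * k (x - a) + pl k xs x"
  by (auto simp: pl_def)

lemma fsum_pl: "\<exists>xs. \<forall>k x. fsum k F n p v x h = pl k xs x"
proof (induction n)
  case (Suc n)
  then obtain xs where xs: "\<forall>k x. fsum k F n p v x h = pl k xs x" by blast
  show ?case
    by (rule exI[of _ "(v (Suc n) - v n, p (Suc n) + chord F (v n) (v (Suc n)) * h) # xs"])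
      (use xs in \<open>auto simp: fsum_def diff_diff_eq\<close>)
qed (auto simp: fsum_def intro: exI[of _ "[]"])

lemma tsum_pl: "\<exists>xs. \<forall>k x. tsum k ts x t = pl k xs x"
proof (induction ts)
  case (Cons a ts)
  obtain c q s \<theta> where a: "a = (c, q, s, \<theta>)" by (cases a) auto
  from Cons obtain xs where xs: "\<forall>k x. tsum k ts x t = pl k xs x" by blast
  show ?case
    by (rule exI[of _ "(c, q + s * relu (t - \<theta>)) # xs"]) (use xs in \<open>auto simp: tsum_def a diff_diff_eq\<close>)
qed (auto simp: tsum_def intro: exI[of _ "[]"])

lemma trk_pl: "\<exists>xs. \<forall>k x. trk k F n p v \<tau> ex x t = pl k xs x"
proof -
  obtain xs ys where "\<forall>k x. fsum k F n p v x (t - \<tau>) = pl k xs x" "\<forall>k x. tsum k ex x t = pl k ys x"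
    using fsum_pl tsum_pl by metis
  then show ?thesis by (intro exI[of _ "xs @ ys"]) (simp add: trk_def pl_append)
qed

lemma continuous_on_pl: "continuous_on S (pl relu xs)"
proof (induction xs)
  case (Cons a xs)
  have "pl relu (a # xs) = (\<lambda>x. fst a * relu (x - snd a) + pl relu xs x)"
    by (cases a) auto
  then show ?case using Cons by (auto intro!: continuous_intros)
qed (simp add: pl_def)

lemma heav_has_integral:
  assumes "a \<le> b"
  shows "((\<lambda>x. heav (x - c)) has_integral relu (b - c) - relu (a - c)) {a..b}"
proof (rule fundamental_theorem_of_calculus_strong[where S="{c}"])
  show "continuous_on {a..b} (\<lambda>x. relu (x - c))" by (intro continuous_intros)
  fix x assume "x \<in> {a..b} - {c}"
  then have "x - c \<noteq> 0" by auto
  have "((\<lambda>x. x - c) has_real_derivative 1) (at x)" by (auto intro!: derivative_eq_intros)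
  from DERIV_chain2[OF relu_deriv[OF \<open>x - c \<noteq> 0\<close>] this]
  show "((\<lambda>x. relu (x - c)) has_vector_derivative heav (x - c)) (at x)"
    by (simp flip: has_real_derivative_iff_has_vector_derivative)
qed (use assms in auto)

lemma pl_has_integral:
  assumes "a \<le> b"
  shows "(pl heav xs has_integral pl relu xs b - pl relu xs a) {a..b}"
proof (induction xs)
  case (Cons e xs)
  obtain c q where e: "e = (c, q)" by (cases e)
  have "((\<lambda>x. c * heav (x - q) + pl heav xs x) has_integral
      c * (relu (b - q) - relu (a - q)) + (pl relu xs b - pl relu xs a)) {a..b}"
    by (intro has_integral_add has_integral_mult_right heav_has_integral assms Cons)
  moreover have "(\<lambda>x. c * heav (x - q) + pl heav xs x) = pl heav (e # xs)" by (auto simp: e)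
  ultimately show ?case by (simp add: e algebra_simps)
qed (simp add: pl_def)

lemma pl_tv:
  assumes "a \<le> b" "\<And>x y. a \<le> x \<Longrightarrow> x \<le> y \<Longrightarrow> y \<le> b \<Longrightarrow> \<bar>pl relu xs y - pl relu xs x\<bar> \<le> S y - S x"
  shows "\<exists>I. ((\<lambda>x. \<bar>pl heav xs x\<bar>) has_integral I) {a..b} \<and> I \<le> S b - S a"
  using assms
proof (induction "card (snd ` set xs \<inter> {a<..<b})" arbitrary: a b rule: less_induct)
  case less
  show ?case
  proof (cases "snd ` set xs \<inter> {a<..<b} = {}")
    case True
    define \<kappa> where "\<kappa> = pl heav xs ((a + b) / 2)"
    have const: "pl heav xs x = \<kappa>" if "x \<in> {a..b} - {a, b}" for x
    proof -
      have x: "x \<in> {a<..<b}" "(a + b) / 2 \<in> {a<..<b}" using that by auto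
      have "heav (x - c) = heav ((a + b) / 2 - c)" if "c \<in> snd ` set xs" for c
      proof -
        have "c \<le> a \<or> b \<le> c" using True that by auto
        then show ?thesis using x by (auto simp: heav_def)
      qed
      then show ?thesis unfolding \<kappa>_def pl_def by (intro arg_cong[where f=sum_list] map_cong) force+
    qed
    have 1: "(pl heav xs has_integral (b - a) *\<^sub>R \<kappa>) {a..b}"
      using has_integral_spike_finite[where S="{a, b}" and f="\<lambda>x. \<kappa>", OF _ _ has_integral_const_real[of \<kappa> a b]] const less.prems by simp
    have "((\<lambda>x. \<bar>pl heav xs x\<bar>) has_integral (b - a) *\<^sub>R \<bar>\<kappa>\<bar>) {a..b}"
      using has_integral_spike_finite[where S="{a, b}" and f="\<lambda>x. \<bar>\<kappa>\<bar>", OF _ _ has_integral_const_real[of "\<bar>\<kappa>\<bar>" a b]] const less.prems by simp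
    moreover have "pl relu xs b - pl relu xs a = (b - a) *\<^sub>R \<kappa>"
      using has_integral_unique[OF pl_has_integral[OF less.prems(1)] 1] .
    then have "(b - a) *\<^sub>R \<bar>\<kappa>\<bar> = \<bar>pl relu xs b - pl relu xs a\<bar>" using less.prems by (simp add: abs_mult)
    ultimately show ?thesis using less.prems(2)[of a b] less.prems(1) by auto
  next
    case False
    then obtain c where "c \<in> snd ` set xs \<inter> {a<..<b}" by blast
    then have c: "c \<in> snd ` set xs" "a < c" "c < b" by simp_all
    have l: "card (snd ` set xs \<inter> {a<..<c}) < card (snd ` set xs \<inter> {a<..<b})"
    proof (rule psubset_card_mono)
      have "c \<in> snd ` set xs \<inter> {a<..<b}" "c \<notin> snd ` set xs \<inter> {a<..<c}" using c by auto
      moreover have "snd ` set xs \<inter> {a<..<c} \<subseteq> snd ` set xs \<inter> {a<..<b}" using c by auto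
      ultimately show "snd ` set xs \<inter> {a<..<c} \<subset> snd ` set xs \<inter> {a<..<b}" by blast
    qed simp
    have r: "card (snd ` set xs \<inter> {c<..<b}) < card (snd ` set xs \<inter> {a<..<b})"
    proof (rule psubset_card_mono)
      have "c \<in> snd ` set xs \<inter> {a<..<b}" "c \<notin> snd ` set xs \<inter> {c<..<b}" using c by auto
      moreover have "snd ` set xs \<inter> {c<..<b} \<subseteq> snd ` set xs \<inter> {a<..<b}" using c by auto
      ultimately show "snd ` set xs \<inter> {c<..<b} \<subset> snd ` set xs \<inter> {a<..<b}" by blast
    qed simp
    have p1: "\<bar>pl relu xs y - pl relu xs x\<bar> \<le> S y - S x" if "a \<le> x" "x \<le> y" "y \<le> c" for x y
      using less.prems(2)[of x y] that c by simp
    have p2: "\<bar>pl relu xs y - pl relu xs x\<bar> \<le> S y - S x" if "c \<le> x" "x \<le> y" "y \<le> b" for x y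
      using less.prems(2)[of x y] that c by simp
    obtain I1 where I1: "((\<lambda>x. \<bar>pl heav xs x\<bar>) has_integral I1) {a..c}" "I1 \<le> S c - S a"
      using less.hyps[OF l less_imp_le[OF c(2)] p1] by blast
    obtain I2 where I2: "((\<lambda>x. \<bar>pl heav xs x\<bar>) has_integral I2) {c..b}" "I2 \<le> S b - S c"
      using less.hyps[OF r less_imp_le[OF c(3)] p2] by blast
    show ?thesis
      using has_integral_combine[OF _ _ I1(1) I2(1)] I1(2) I2(2) c by (intro exI[of _ "I1 + I2"]) auto
  qed
qed

lemma lam_continuous:
  assumes "finite P" "P \<noteq> {}" shows "continuous_on S (lam F P h)"
  using assms
proof (induction P rule: finite_ne_induct)
  case (singleton x)
  then show ?case by (auto simp: lam_def intro!: continuous_intros)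
next
  case (insert x P)
  have "lam F (insert x P) h = (\<lambda>z. max (x * z - h * F x) (lam F P h z))"
    using insert by (intro ext) (simp add: lam_def)
  then show ?case using insert by (auto intro!: continuous_intros)
qed

lemma fsum_relu_left:
  assumes "\<And>j. j \<in> {1..n} \<Longrightarrow> 0 \<le> p j" "y \<le> 0"
  shows "fsum relu F n p v y 0 = 0"
  unfolding fsum_def using assms by (intro sum.neutral) (force simp: relu_def)

lemma fsum_relu_right:
  assumes "\<And>j. j \<in> {1..n} \<Longrightarrow> p j \<le> 1" "1 \<le> y" "v 0 = 0" "v n = 0"
  shows "fsum relu F n p v y 0 = fsum relu F n p v 1 0"
proof -
  have e: "fsum relu F n p v y 0 = y * (\<Sum>j=1..n. v j - v (j - 1)) - (\<Sum>j=1..n. (v j - v (j - 1)) * p j)" if "1 \<le> y" for y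
    unfolding fsum_def sum_distrib_left sum_subtractf[symmetric]
  proof (intro sum.cong refl)
    fix j assume "j \<in> {1..n}"
    then have "p j \<le> y" using assms(1) that by force
    then show "(v j - v (j - 1)) * relu (y - p j - chord F (v (j - 1)) (v j) * 0) = y * (v j - v (j - 1)) - (v j - v (j - 1)) * p j"
      by (simp add: relu_def algebra_simps)
  qed
  show ?thesis unfolding e[OF assms(2)] e[OF order_refl] telescope_Suc using assms by simp
qed

lemma ftrack_hopf_lax:
  assumes F: "strictly_convex F" "F 0 = 0" and slope: "\<And>w. m0 * w \<le> F w"
    and t: "0 < t" and d: "0 < d"
    and v: "valid d J n p v" and ft: "ftrack F n p v 0 ex" and p: "\<And>j. j \<in> {1..n} \<Longrightarrow> p j \<in> {0..1}"
  defines "U \<equiv> \<lambda>y. fsum relu F n p v y 0" and "L \<equiv> lam F (grid d J) t" and "W \<equiv> \<lambda>x. trk relu F n p v 0 ex x t"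
  shows "W x \<le> U y + L (x - y)" "\<exists>y. U y + L (x - y) \<le> W x" "0 \<le> L z" "L (t * m0) = 0"
    "\<bar>t * m0\<bar> \<le> 1 \<Longrightarrow> x \<in> {0..1} \<Longrightarrow> \<exists>y\<in>{-1..2}. U y + L (x - y) \<le> W x"
proof -
  have ne: "grid d J \<noteq> {}" using zero_in_grid by blast
  show up: "W x \<le> U y + L (x - y)" for x y
    using ftrack_upper[OF ft v F(2), of t y "(x - y) / t"] lam_scale[OF finite_grid ne, of t F "(x - y) / t"] t
    by (simp add: U_def L_def W_def)
  show low: "\<exists>y. U y + L (x - y) \<le> W x" for x
    using ftrack_lower[OF ft v F(2) _ F(1) d, of t x] t by (simp add: U_def L_def W_def)
  show L0: "0 \<le> L z" for z using lam_ge[OF finite_grid zero_in_grid, of z t F] F by (simp add: L_def)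
  show Lc: "L (t * m0) = 0"
  proof (rule antisym[OF _ L0])
    show "L (t * m0) \<le> 0" unfolding L_def
    proof (rule lam_le[OF finite_grid ne])
      fix w show "w * (t * m0) - t * F w \<le> 0" using mult_left_mono[OF slope[of w], of t] t by (simp add: algebra_simps)
    qed
  qed
  define c where "c = t * m0"
  have conv: "L (a + k) - L a \<le> L (b + k) - L b" if "a \<le> b" "0 \<le> k" for a b k
    unfolding L_def by (rule lam_increments[OF finite_grid ne that])
  have incr: "L z \<le> L z'" if "c \<le> z" "z \<le> z'" for z z'
    using conv[of c z "z' - z"] L0[of "c + (z' - z)"] Lc that by (simp add: c_def)
  have decr: "L z \<le> L z'" if "z \<le> c" "z' \<le> z" for z z'
    using conv[of z' "c - (z - z')" "z - z'"] L0[of "c - (z - z')"] Lc that by (simp add: c_def)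
  show "\<exists>y\<in>{-1..2}. U y + L (x - y) \<le> W x" if m: "\<bar>t * m0\<bar> \<le> 1" and x: "x \<in> {0..1}"
  proof -
    obtain y where y: "U y + L (x - y) \<le> W x" using low by blast
    have c1: "-1 \<le> c" "c \<le> 1" using m by (auto simp: c_def)
    consider "y \<in> {0..1}" | "y < 0" | "1 < y" by fastforce
    then show ?thesis
    proof cases
      case 1 then show ?thesis using y by (intro bexI[of _ y]) auto
    next
      case 2
      define y' where "y' = min 0 (x - c)"
      have r: "U z = 0" if "z \<le> 0" for z
        unfolding U_def using p that by (intro fsum_relu_left) auto
      have "U y' = U y" using r[of y] r[of y'] 2 by (simp add: y'_def)
      moreover have "L (x - y') \<le> L (x - y)"
      proof (cases "x - c \<le> 0")
        case True then show ?thesis using Lc L0 by (simp add: y'_def flip: c_def)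
      next
        case False then show ?thesis using 2 by (intro incr) (auto simp: y'_def)
      qed
      ultimately show ?thesis using y x c1 by (intro bexI[of _ y']) (auto simp: y'_def)
    next
      case 3
      define y' where "y' = max 1 (x - c)"
      have r: "U z = fsum relu F n p v 1 0" if "1 \<le> z" for z
        unfolding U_def using p v that by (intro fsum_relu_right) (auto simp: valid_def)
      have "U y' = U y" using r[of y] r[of y'] 3 by (simp add: y'_def)
      moreover have "L (x - y') \<le> L (x - y)"
      proof (cases "1 \<le> x - c")
        case True then show ?thesis using Lc L0 by (simp add: y'_def flip: c_def)
      next
        case False then show ?thesis using 3 by (intro decr) (auto simp: y'_def)
      qed
      ultimately show ?thesis using y x c1 by (intro bexI[of _ y']) (auto simp: y'_def)
    qed
  qed
qed

lemma fronts_compare: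
  fixes F :: "real \<Rightarrow> real" and n n' m J :: nat
  assumes F: "strictly_convex F" "F 0 = 0" and slope: "\<And>w. m0 * w \<le> F w"
    and t: "0 < t" "\<bar>t * m0\<bar> \<le> 1" and d: "0 < d" and m: "1 \<le> m"
    and v: "valid d J n p v" and ft: "ftrack F n p v 0 ex" and p: "\<And>j. j \<in> {1..n} \<Longrightarrow> p j \<in> {0..1}"
    and v': "valid (d / real m) (J * m) n' p' v'" and ft': "ftrack F n' p' v' 0 ex'"
    and p': "\<And>j. j \<in> {1..n'} \<Longrightarrow> p' j \<in> {0..1}"
  shows "(LINT x:{0<..<1}|lborel. \<bar>trk heav F n' p' v' 0 ex' x t - trk heav F n p v 0 ex x t\<bar>)
    \<le> (\<integral>x. \<bar>fsum heav F n' p' v' x 0 - fsum heav F n p v x 0\<bar> \<partial>lborel) + 16 * d"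
proof -
  have d': "0 < d / real m" using d m by simp
  note s1 = ftrack_hopf_lax[OF F slope t(1) d' v' ft' p']
  note s2 = ftrack_hopf_lax[OF F slope t(1) d v ft p]
  define U1 where "U1 = (\<lambda>y. fsum relu F n' p' v' y 0)"
  define U2 where "U2 = (\<lambda>y. fsum relu F n p v y 0)"
  define L1 where "L1 = lam F (grid (d / real m) (J * m)) t"
  define L2 where "L2 = lam F (grid d J) t"
  define W1 where "W1 = (\<lambda>x. trk relu F n' p' v' 0 ex' x t)"
  define W2 where "W2 = (\<lambda>x. trk relu F n p v 0 ex x t)"
  define f1 where "f1 = (\<lambda>x. fsum heav F n' p' v' x 0)"
  define f2 where "f2 = (\<lambda>x. fsum heav F n p v x 0)"
  have fi: "integrable lborel f1" "integrable lborel f2"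
    unfolding f1_def f2_def by (rule fsum_integrable[OF v'] fsum_integrable[OF v])+
  define g1 where "g1 = (\<lambda>x. max 0 (f2 x - f1 x))"
  define g2 where "g2 = (\<lambda>x. max 0 (f1 x - f2 x))"
  have gi: "integrable lborel g1" "integrable lborel g2"
    unfolding g1_def g2_def using fi by (auto intro!: integrable_max)
  have on: "g integrable_on {a..b}" if "integrable lborel g" for g :: "real \<Rightarrow> real" and a b
    using integrable_on_lborel[OF that] by (rule integrable_on_subinterval) simp
  define G1 where "G1 = (\<lambda>y. integral {-1..y} g1)"
  define UP where "UP = (\<lambda>y. U1 y + G1 y + d * y)"
  obtain xs1 where xs1: "\<And>k x. fsum k F n' p' v' x 0 = pl k xs1 x" using fsum_pl by blast
  obtain xs2 where xs2: "\<And>k x. fsum k F n p v x 0 = pl k xs2 x" using fsum_pl by blast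
  have U1d: "U1 b - U1 a = integral {a..b} f1" if "a \<le> b" for a b
    using integral_unique[OF pl_has_integral[OF that, of xs1]] by (simp add: U1_def f1_def xs1)
  have U2d: "U2 b - U2 a = integral {a..b} f2" if "a \<le> b" for a b
    using integral_unique[OF pl_has_integral[OF that, of xs2]] by (simp add: U2_def f2_def xs2)
  have G1d: "G1 b - G1 a = integral {a..b} g1" if "-1 \<le> a" "a \<le> b" for a b
    using Henstock_Kurzweil_Integration.integral_combine[of "-1" a b g1] that on[OF gi(1)] by (simp add: G1_def)
  have UP1: "(UP b - U1 b) - (UP a - U1 a) = integral {a..b} g1 + d * (b - a)" if "-1 \<le> a" "a \<le> b" for a b
    using G1d[OF that] by (simp add: UP_def algebra_simps)
  have UP2: "(UP b - U2 b) - (UP a - U2 a) = integral {a..b} g2 + d * (b - a)" if "-1 \<le> a" "a \<le> b" for a b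
  proof -
    have "(UP b - U2 b) - (UP a - U2 a) = integral {a..b} f1 - integral {a..b} f2 + integral {a..b} g1 + d * (b - a)"
      using G1d[OF that] U1d[OF that(2)] U2d[OF that(2)] by (simp add: UP_def algebra_simps)
    also have "integral {a..b} f1 - integral {a..b} f2 + integral {a..b} g1 = integral {a..b} (\<lambda>x. f1 x - f2 x + g1 x)"
      using on[OF fi(1)] on[OF fi(2)] on[OF gi(1)]
      by (simp add: Henstock_Kurzweil_Integration.integral_add Henstock_Kurzweil_Integration.integral_diff integrable_diff)
    also have "(\<lambda>x. f1 x - f2 x + g1 x) = g2" by (auto simp: g1_def g2_def max_def)
    finally show ?thesis .
  qed
  have gpos: "0 \<le> integral {a..b} g1" "0 \<le> integral {a..b} g2" for a b
    using on[OF gi(1)] on[OF gi(2)] by (auto intro!: integral_nonneg simp: g1_def g2_def)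
  have Nb: "integral {-1..2} g1 + integral {-1..2} g2 \<le> (\<integral>x. \<bar>f1 x - f2 x\<bar> \<partial>lborel)"
  proof -
    have i: "integrable lborel (\<lambda>x. \<bar>f1 x - f2 x\<bar>)" using fi by auto
    have "integral {-1..2} g1 + integral {-1..2} g2 = integral {-1..2} (\<lambda>x. g1 x + g2 x)"
      using on[OF gi(1)] on[OF gi(2)] by (simp add: Henstock_Kurzweil_Integration.integral_add)
    also have "(\<lambda>x. g1 x + g2 x) = (\<lambda>x. \<bar>f1 x - f2 x\<bar>)" by (auto simp: g1_def g2_def max_def)
    also have "integral {-1..2} (\<lambda>x. \<bar>f1 x - f2 x\<bar>) \<le> integral UNIV (\<lambda>x. \<bar>f1 x - f2 x\<bar>)"
      using on[OF i] integrable_on_lborel[OF i] by (intro integral_subset_le) auto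
    also have "\<dots> = (\<integral>x. \<bar>f1 x - f2 x\<bar> \<partial>lborel)" using integral_lborel[OF i] .
    finally show ?thesis .
  qed
  have gne: "grid e K \<noteq> {}" for e K using zero_in_grid by blast
  obtain S where S: "\<And>a b. 0 \<le> a \<Longrightarrow> a \<le> b \<Longrightarrow> b \<le> 1 \<Longrightarrow> \<bar>(W1 b - W2 b) - (W1 a - W2 a)\<bar> \<le> S b - S a"
    "S 1 - S 0 \<le> ((\<integral>x. \<bar>f1 x - f2 x\<bar> \<partial>lborel) + 6 * d) + 10 * d"
  proof (rule hopf_lax_compare[of W1 U1 L1 W2 U2 L2 d UP "(\<integral>x. \<bar>f1 x - f2 x\<bar> \<partial>lborel) + 6 * d"])
    show "W1 x \<le> U1 y + L1 (x - y)" for x y unfolding W1_def U1_def L1_def by (rule s1(1))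
    show "W2 x \<le> U2 y + L2 (x - y)" for x y unfolding W2_def U2_def L2_def by (rule s2(1))
    show "\<exists>y\<in>{-1..2}. U1 y + L1 (x - y) \<le> W1 x" if "x \<in> {0..1}" for x
      unfolding W1_def U1_def L1_def by (rule s1(5)[OF _ t(2) that])
    show "\<exists>y\<in>{-1..2}. U2 y + L2 (x - y) \<le> W2 x" if "x \<in> {0..1}" for x
      unfolding W2_def U2_def L2_def by (rule s2(5)[OF _ t(2) that])
    show "L1 (a + k) - L1 a \<le> L1 (b + k) - L1 b" if "a \<le> b" "0 \<le> k" for a b k
      unfolding L1_def by (rule lam_increments[OF finite_grid gne that])
    show "L2 (a + k) - L2 a \<le> L2 (b + k) - L2 b" if "a \<le> b" "0 \<le> k" for a b k
      unfolding L2_def by (rule lam_increments[OF finite_grid gne that])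
    show "\<bar>(L1 z' - L2 z') - (L1 z - L2 z)\<bar> \<le> d * \<bar>z' - z\<bar>" for z z'
      using lam_grid_diff[OF F(1) d m less_imp_le[OF t(1)], of z z' J] lam_grid_diff[OF F(1) d m less_imp_le[OF t(1)], of z' z J]
      unfolding L1_def L2_def by (cases "z \<le> z'") (auto simp: abs_if algebra_simps)
    show "d * (b - a) \<le> UP b - U1 b - (UP a - U1 a)" if "-1 \<le> a" "a \<le> b" for a b
      unfolding UP1[OF that] using gpos by simp
    show "d * (b - a) \<le> UP b - U2 b - (UP a - U2 a)" if "-1 \<le> a" "a \<le> b" for a b
      unfolding UP2[OF that] using gpos by simp
    show "continuous_on {-1..2} UP"
      unfolding UP_def G1_def U1_def xs1
      by (intro continuous_intros continuous_on_pl indefinite_integral_continuous_1 on gi)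
    show "continuous_on UNIV L1" unfolding L1_def by (rule lam_continuous[OF finite_grid gne])
    show "UP 2 - U1 2 - (UP (- 1) - U1 (- 1)) + (UP 2 - U2 2 - (UP (- 1) - U2 (- 1))) \<le> (\<integral>x. \<bar>f1 x - f2 x\<bar> \<partial>lborel) + 6 * d"
      using UP1[of "-1" 2] UP2[of "-1" 2] Nb by simp
  qed (use d in auto)
  obtain ys1 where ys1: "\<And>k x. trk k F n' p' v' 0 ex' x t = pl k ys1 x" using trk_pl by blast
  obtain ys2 where ys2: "\<And>k x. trk k F n p v 0 ex x t = pl k ys2 x" using trk_pl by blast
  define ys where "ys = ys1 @ map (\<lambda>(c, a). (- c, a)) ys2"
  have ys: "pl k ys x = trk k F n' p' v' 0 ex' x t - trk k F n p v 0 ex x t" for k x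
    by (simp add: ys_def pl_append pl_uminus ys1 ys2)
  obtain I where I: "((\<lambda>x. \<bar>pl heav ys x\<bar>) has_integral I) {0..1}" "I \<le> S 1 - S 0"
    using pl_tv[of 0 1 ys S] S(1) by (auto simp: ys W1_def W2_def)
  have int: "integrable lborel (\<lambda>x. \<bar>pl heav ys x\<bar>)"
    unfolding ys using trk_integrable[OF ft v, of t] trk_integrable[OF ft' v', of t] t by auto
  have si: "set_integrable lborel {0..1} (\<lambda>x. \<bar>pl heav ys x\<bar>)" "set_integrable lborel {0<..<1} (\<lambda>x. \<bar>pl heav ys x\<bar>)"
    using int unfolding set_integrable_def by (intro integrable_mult_indicator; simp)+
  have "(LINT x:{0<..<1}|lborel. \<bar>pl heav ys x\<bar>) \<le> (LINT x:{0..1}|lborel. \<bar>pl heav ys x\<bar>)"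
    using si unfolding set_lebesgue_integral_def set_integrable_def
    by (intro integral_mono) (auto simp: indicator_def)
  also have "\<dots> = I"
    using set_borel_integral_eq_integral(2)[OF si(1)] integral_unique[OF I(1)] by simp
  finally show ?thesis using I(2) S(2) unfolding ys by (simp add: f1_def f2_def)
qed

section \<open>Discretization of the initial datum\<close>

lemma variation_sumsI:
  assumes "\<And>i. i \<le> n \<Longrightarrow> xs i \<in> A" "\<And>i. i < n \<Longrightarrow> xs i < xs (Suc i)"
  shows "(\<Sum>i<n. \<bar>f (xs (Suc i)) - f (xs i)\<bar>) \<in> variation_sums f A"
  unfolding variation_sums_def using assms by blast

lemma variation_sums_mono:
  assumes "A \<subseteq> B" shows "variation_sums f A \<subseteq> variation_sums f B"
proof
  fix s assume "s \<in> variation_sums f A"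
  then obtain n xs where s: "s = (\<Sum>i<n. \<bar>f (xs (Suc i)) - f (xs i)\<bar>)" and xs: "\<forall>i\<le>n. xs i \<in> A" "\<forall>i<n. xs i < xs (Suc i)"
    unfolding variation_sums_def by blast
  show "s \<in> variation_sums f B"
    unfolding s by (rule variation_sumsI) (use xs assms in auto)
qed

lemma variation_sums_zero: "x \<in> A \<Longrightarrow> 0 \<in> variation_sums f A"
  unfolding variation_sums_def by (rule CollectI, rule exI[of _ 0], rule exI[of _ "\<lambda>_. x"]) auto

lemma variation_sums_extend:
  assumes s: "s \<in> variation_sums f (A \<inter> {..x})" and xy: "x < y" "x \<in> A" "y \<in> A"
  shows "\<exists>s'\<in>variation_sums f (A \<inter> {..y}). s + \<bar>f y - f x\<bar> \<le> s'"
proof -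
  obtain n xs where n: "s = (\<Sum>i<n. \<bar>f (xs (Suc i)) - f (xs i)\<bar>)" "\<forall>i\<le>n. xs i \<in> A \<inter> {..x}" "\<forall>i<n. xs i < xs (Suc i)"
    using s unfolding variation_sums_def by blast
  show ?thesis
  proof (cases "xs n = x")
    case True
    define ys where "ys = xs(Suc n := y)"
    have "(\<Sum>i<Suc n. \<bar>f (ys (Suc i)) - f (ys i)\<bar>) \<in> variation_sums f (A \<inter> {..y})"
    proof (rule variation_sumsI)
      show "ys i \<in> A \<inter> {..y}" if "i \<le> Suc n" for i
        using that n(2)[rule_format, of i] xy by (cases "i = Suc n") (auto simp: ys_def)
      show "ys i < ys (Suc i)" if "i < Suc n" for i
        using that n(3)[rule_format, of i] xy True by (cases "i = n") (auto simp: ys_def)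
    qed
    moreover have "(\<Sum>i<Suc n. \<bar>f (ys (Suc i)) - f (ys i)\<bar>) = s + \<bar>f y - f x\<bar>"
      using n(1) True by (simp add: ys_def)
    ultimately show ?thesis by force
  next
    case False
    then have lt: "xs n < x" using n(2) by force
    define ys where "ys = xs(Suc n := x, Suc (Suc n) := y)"
    have "(\<Sum>i<Suc (Suc n). \<bar>f (ys (Suc i)) - f (ys i)\<bar>) \<in> variation_sums f (A \<inter> {..y})"
    proof (rule variation_sumsI)
      show "ys i \<in> A \<inter> {..y}" if i: "i \<le> Suc (Suc n)" for i
      proof -
        consider "i \<le> n" | "i = Suc n" | "i = Suc (Suc n)" using i by linarith
        then show ?thesis using n(2)[rule_format, of i] xy by cases (auto simp: ys_def)
      qed
      show "ys i < ys (Suc i)" if i: "i < Suc (Suc n)" for i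
      proof -
        consider "i < n" | "i = n" | "i = Suc n" using i by linarith
        then show ?thesis using n(3)[rule_format, of i] xy lt by cases (auto simp: ys_def)
      qed
    qed
    moreover have "s + \<bar>f y - f x\<bar> \<le> (\<Sum>i<Suc (Suc n). \<bar>f (ys (Suc i)) - f (ys i)\<bar>)"
      using n(1) by (simp add: ys_def)
    ultimately show ?thesis by blast
  qed
qed

lemma variation_function:
  assumes "in_U u0"
  shows "\<exists>vf. (\<forall>x y. x \<le> y \<longrightarrow> \<bar>u0 y - u0 x\<bar> \<le> vf y - vf x) \<and>
    (\<forall>x. 0 \<le> vf x \<and> vf x \<le> total_variation u0 {0<..<1})"
proof -
  let ?A = "{0<..<1::real}"
  have bv: "bdd_above (variation_sums u0 ?A)" using assms by (simp add: in_U_def has_bv_on_def)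
  obtain a b where ab: "0 < a" "a \<le> b" "b < 1" "\<And>x. x \<notin> {a..b} \<Longrightarrow> u0 x = 0"
    using assms unfolding in_U_def by blast
  define \<pi> where "\<pi> = (\<lambda>x. max (a / 2) (min ((b + 1) / 2) x))"
  have \<pi>A: "\<pi> x \<in> ?A" for x using ab(1-3) by (auto simp: \<pi>_def max_def min_def)
  have \<pi>u: "u0 (\<pi> x) = u0 x" for x
  proof (cases "x \<in> {a..b}")
    case True
    then have "\<pi> x = x" using ab(1-3) by (auto simp: \<pi>_def max_def min_def)
    then show ?thesis by simp
  next
    case False
    then have "\<pi> x \<notin> {a..b}" using ab(1-3) by (auto simp: \<pi>_def max_def min_def)
    then show ?thesis using ab(4) False by simp
  qed
  have \<pi>m: "\<pi> x \<le> \<pi> y" if "x \<le> y" for x y using that by (auto simp: \<pi>_def)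
  define S where "S = (\<lambda>z. variation_sums u0 (?A \<inter> {..z}))"
  have Sub: "S z \<subseteq> variation_sums u0 ?A" for z unfolding S_def by (rule variation_sums_mono) auto
  have bdd: "bdd_above (S z)" for z using bdd_above_mono[OF bv Sub] .
  have ne: "0 \<in> S (\<pi> x)" for x unfolding S_def using \<pi>A by (intro variation_sums_zero[of "\<pi> x"]) auto
  define vf where "vf = (\<lambda>x. Sup (S (\<pi> x)))"
  show ?thesis
  proof (intro exI[of _ vf] conjI allI impI)
    show "0 \<le> vf x" for x unfolding vf_def by (rule cSup_upper[OF ne bdd])
    show "vf x \<le> total_variation u0 ?A" for x
      unfolding vf_def total_variation_def using ne[of x] by (intro cSup_subset_mono bv Sub) auto
    fix x y :: real assume "x \<le> y"
    then consider "\<pi> x = \<pi> y" | "\<pi> x < \<pi> y" using \<pi>m[of x y] by linarith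
    then show "\<bar>u0 y - u0 x\<bar> \<le> vf y - vf x"
    proof cases
      case 1
      then have "u0 y = u0 x" using \<pi>u[of x] \<pi>u[of y] by simp
      then show ?thesis using 1 by (simp add: vf_def)
    next
      case 2
      have "vf x \<le> vf y - \<bar>u0 y - u0 x\<bar>"
        unfolding vf_def
      proof (rule cSup_least)
        fix s assume "s \<in> S (\<pi> x)"
        then obtain s' where s': "s' \<in> S (\<pi> y)" "s + \<bar>u0 (\<pi> y) - u0 (\<pi> x)\<bar> \<le> s'"
          using variation_sums_extend[OF _ 2 \<pi>A \<pi>A] unfolding S_def by blast
        have "s' \<le> Sup (S (\<pi> y))" by (rule cSup_upper[OF s'(1) bdd])
        then show "s \<le> Sup (S (\<pi> y)) - \<bar>u0 y - u0 x\<bar>"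
          using s'(2) unfolding \<pi>u by linarith
      qed (use ne in auto)
      then show ?thesis by simp
    qed
  qed
qed

lemma in_U_props:
  assumes "in_U u0"
  shows "0 \<le> total_variation u0 {0<..<1}" "\<bar>u0 x\<bar> \<le> total_variation u0 {0<..<1}"
    "x \<notin> {0<..<1} \<Longrightarrow> u0 x = 0" "integrable lborel u0"
proof -
  obtain vf where vf: "\<And>x y. x \<le> y \<Longrightarrow> \<bar>u0 y - u0 x\<bar> \<le> vf y - vf x"
    "\<And>x. 0 \<le> vf x" "\<And>x. vf x \<le> total_variation u0 {0<..<1}"
    using variation_function[OF assms] by auto
  show "0 \<le> total_variation u0 {0<..<1}" using vf(2)[of 0] vf(3)[of 0] by simp
  have out: "u0 x = 0" if "x \<notin> {0<..<1}" for x
  proof -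
    obtain a b where "0 < a" "b < 1" "\<And>x. x \<notin> {a..b} \<Longrightarrow> u0 x = 0"
      using assms unfolding in_U_def by blast
    then show ?thesis using that by auto
  qed
  then show "x \<notin> {0<..<1} \<Longrightarrow> u0 x = 0" .
  show bd: "\<bar>u0 x\<bar> \<le> total_variation u0 {0<..<1}" for x
  proof -
    have "u0 (min x 0) = 0" by (rule out) auto
    then show ?thesis using vf(1)[of "min x 0" x] vf(2)[of "min x 0"] vf(3)[of x] by simp
  qed
  have "mono vf"
  proof (rule monoI)
    fix x y :: real assume "x \<le> y"
    from vf(1)[OF this] show "vf x \<le> vf y" by linarith
  qed
  moreover have "mono (\<lambda>x. vf x - u0 x)" 
  proof (rule monoI)
    fix x y :: real assume "x \<le> y"
    from vf(1)[OF this] show "vf x - u0 x \<le> vf y - u0 y" by linarith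
  qed
  ultimately have "vf \<in> borel_measurable borel" "(\<lambda>x. vf x - u0 x) \<in> borel_measurable borel"
    by (auto intro: borel_measurable_mono)
  then have "(\<lambda>x. vf x - (vf x - u0 x)) \<in> borel_measurable borel" by (rule borel_measurable_diff)
  then have [measurable]: "u0 \<in> borel_measurable borel" by simp
  show "integrable lborel u0"
    by (rule integrableI_bounded_set[where A="{0..1}" and B="total_variation u0 {0<..<1}"])
      (auto simp: bd out emeasure_lborel_Icc_eq intro!: AE_I2)
qed

definition pre_valid :: "real \<Rightarrow> nat \<Rightarrow> nat \<Rightarrow> (nat \<Rightarrow> real) \<Rightarrow> (nat \<Rightarrow> real) \<Rightarrow> real \<Rightarrow> bool" where
  "pre_valid d J n p v Q \<longleftrightarrow> v 0 = 0 \<and> (\<forall>j\<le>n. v j \<in> grid d J) \<and>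
     (\<forall>j\<in>{1..n}. v (j - 1) \<noteq> v j \<and> (v (j - 1) < v j \<longrightarrow> v j = v (j - 1) + d)) \<and>
     (\<forall>j\<in>{1..<n}. p j \<le> p (Suc j)) \<and> (\<forall>j\<in>{1..n}. 0 \<le> p j \<and> p j \<le> Q)"

lemma grid_memI: "\<bar>i\<bar> \<le> int J \<Longrightarrow> d * real_of_int i \<in> grid d J"
  unfolding grid_def by (intro imageI) auto

lemma extend_unit_jumps:
  fixes c \<sigma> :: int and m :: nat
  assumes d: "0 < d" and Q: "0 \<le> Q" and st: "pre_valid d J n p v Q" and vn: "v n = d * real_of_int c" and c: "\<bar>c\<bar> \<le> int J"
    and \<sigma>: "\<sigma> = 1 \<or> \<sigma> = -1" and cm: "\<bar>c + \<sigma> * int m\<bar> \<le> int J"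
  shows "\<exists>p' v'. pre_valid d J (n + m) p' v' Q \<and> v' (n + m) = d * real_of_int (c + \<sigma> * int m) \<and>
     (\<forall>f. (\<Sum>j=1..n+m. (v' j - v' (j - 1)) * f (p' j)) = (\<Sum>j=1..n. (v j - v (j - 1)) * f (p j)) + d * real_of_int (\<sigma> * int m) * f Q)"
  using cm
proof (induction m)
  case 0
  then show ?case using st vn by (intro exI[of _ p] exI[of _ v]) auto
next
  case (Suc m)
  have "\<bar>c + \<sigma> * int m\<bar> \<le> int J" using Suc.prems c \<sigma> by auto
  then obtain p' v' where IH: "pre_valid d J (n + m) p' v' Q" "v' (n + m) = d * real_of_int (c + \<sigma> * int m)"
     "\<And>f. (\<Sum>j=1..n+m. (v' j - v' (j - 1)) * f (p' j)) = (\<Sum>j=1..n. (v j - v (j - 1)) * f (p j)) + d * real_of_int (\<sigma> * int m) * f Q"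
    using Suc.IH by blast
  let ?N = "Suc (n + m)"
  define p2 where "p2 = p'(?N := Q)"
  define v2 where "v2 = v'(?N := d * real_of_int (c + \<sigma> * int (Suc m)))"
  have jump: "v2 ?N - v2 (n + m) = d * real_of_int \<sigma>"
    using IH(2) by (simp add: v2_def algebra_simps)
  have sum_eq: "(\<Sum>j=1..n+m. (v2 j - v2 (j - 1)) * f (p2 j)) = (\<Sum>j=1..n+m. (v' j - v' (j - 1)) * f (p' j))" for f
    by (intro sum.cong) (auto simp: v2_def p2_def)
  have "pre_valid d J ?N p2 v2 Q"
    unfolding pre_valid_def
  proof (intro conjI ballI allI impI)
    show "v2 0 = 0" using IH(1) by (simp add: v2_def pre_valid_def)
    show "v2 j \<in> grid d J" if "j \<le> ?N" for j
      using IH(1) that grid_memI[OF Suc.prems, of d] by (cases "j = ?N") (auto simp: v2_def pre_valid_def)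
    fix j assume j: "j \<in> {1..?N}"
    have "v2 (j - 1) \<noteq> v2 j \<and> (v2 (j - 1) < v2 j \<longrightarrow> v2 j = v2 (j - 1) + d)"
    proof (cases "j = ?N")
      case True
      then show ?thesis using jump d \<sigma> by (auto simp: algebra_simps)
    next
      case False
      then have "j \<in> {1..n+m}" using j by auto
      then show ?thesis using IH(1) by (auto simp: v2_def pre_valid_def)
    qed
    then show "v2 (j - 1) \<noteq> v2 j" "v2 (j - 1) < v2 j \<Longrightarrow> v2 j = v2 (j - 1) + d" by auto
    show "0 \<le> p2 j" "p2 j \<le> Q" using IH(1) j Q by (auto simp: p2_def pre_valid_def le_Suc_eq)
  next
    fix j assume j: "j \<in> {1..<?N}"
    show "p2 j \<le> p2 (Suc j)"
    proof (cases "j = n + m")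
      case True
      then show ?thesis using IH(1) j by (auto simp: p2_def pre_valid_def)
    next
      case False
      then have "j \<in> {1..<n+m}" using j by auto
      then show ?thesis using IH(1) by (auto simp: p2_def pre_valid_def)
    qed
  qed
  moreover have "v2 ?N = d * real_of_int (c + \<sigma> * int (Suc m))" by (simp add: v2_def)
  moreover have "(\<Sum>j=1..?N. (v2 j - v2 (j - 1)) * f (p2 j)) = (\<Sum>j=1..n. (v j - v (j - 1)) * f (p j)) + d * real_of_int (\<sigma> * int (Suc m)) * f Q" for f
  proof -
    have "(\<Sum>j=1..?N. (v2 j - v2 (j - 1)) * f (p2 j)) = (\<Sum>j=1..n+m. (v2 j - v2 (j - 1)) * f (p2 j)) + d * real_of_int \<sigma> * f Q"
      using jump by (simp add: p2_def)
    then show ?thesis unfolding sum_eq IH(3) by (simp add: algebra_simps)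
  qed
  ultimately show ?case by (intro exI[of _ p2] exI[of _ v2]) simp
qed

lemma step_state:
  fixes r :: "nat \<Rightarrow> int" and q :: "nat \<Rightarrow> real"
  assumes d: "0 < d" and r0: "r 0 = 0" and r: "\<And>k. \<bar>r k\<bar> \<le> int J" and q: "\<And>k. q k \<le> q (Suc k)" "0 \<le> q 0"
  shows "\<exists>n p v. pre_valid d J n p v (q K) \<and> v n = d * real_of_int (r K) \<and> int n = (\<Sum>k<K. \<bar>r (Suc k) - r k\<bar>) \<and>
     (\<forall>f. (\<Sum>j=1..n. (v j - v (j - 1)) * f (p j)) = (\<Sum>k<K. d * real_of_int (r (Suc k) - r k) * f (q (Suc k))))"
proof (induction K)
  case 0
  show ?case by (rule exI[of _ 0], rule exI[of _ "\<lambda>_. 0"], rule exI[of _ "\<lambda>_. 0"]) (simp add: pre_valid_def r0)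
next
  case (Suc K)
  then obtain n p v where st: "pre_valid d J n p v (q K)" "v n = d * real_of_int (r K)" "int n = (\<Sum>k<K. \<bar>r (Suc k) - r k\<bar>)"
     "\<And>f. (\<Sum>j=1..n. (v j - v (j - 1)) * f (p j)) = (\<Sum>k<K. d * real_of_int (r (Suc k) - r k) * f (q (Suc k)))" by blast
  have q0: "0 \<le> q k" for k
  proof (induction k)
    case (Suc k)
    then show ?case using q(1)[of k] by linarith
  qed (rule q(2))
  have st': "pre_valid d J n p v (q (Suc K))"
    using st(1) q(1)[of K] by (force simp: pre_valid_def)
  define m where "m = nat \<bar>r (Suc K) - r K\<bar>"
  define \<sigma> :: int where "\<sigma> = (if r K \<le> r (Suc K) then 1 else -1)"
  have \<sigma>m: "\<sigma> * int m = r (Suc K) - r K" by (auto simp: \<sigma>_def m_def)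
  have cm: "\<bar>r K + \<sigma> * int m\<bar> \<le> int J" unfolding \<sigma>m using r[of "Suc K"] by simp
  have \<sigma>1: "\<sigma> = 1 \<or> \<sigma> = -1" by (simp add: \<sigma>_def)
  from extend_unit_jumps[OF d q0 st' st(2) r \<sigma>1 cm]
  obtain p' v' where "pre_valid d J (n + m) p' v' (q (Suc K))" "v' (n + m) = d * real_of_int (r K + \<sigma> * int m)"
     "\<And>f. (\<Sum>j=1..n+m. (v' j - v' (j - 1)) * f (p' j)) = (\<Sum>j=1..n. (v j - v (j - 1)) * f (p j)) + d * real_of_int (\<sigma> * int m) * f (q (Suc K))"
    by blast
  moreover have "int (n + m) = (\<Sum>k<Suc K. \<bar>r (Suc k) - r k\<bar>)" using st(3) by (simp add: m_def)
  ultimately show ?case unfolding \<sigma>m st(4)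
    by (intro exI[of _ "n + m"] exI[of _ p'] exI[of _ v']) simp
qed

lemma floor_diff_abs: "\<bar>real_of_int (\<lfloor>a\<rfloor> - \<lfloor>b\<rfloor>)\<bar> \<le> \<bar>a - b\<bar> + 1" for a b :: real
proof -
  have "real_of_int \<lfloor>a\<rfloor> \<le> a" "a < real_of_int \<lfloor>a\<rfloor> + 1" "real_of_int \<lfloor>b\<rfloor> \<le> b" "b < real_of_int \<lfloor>b\<rfloor> + 1"
    by linarith+
  then show ?thesis unfolding of_int_diff abs_le_iff by linarith
qed

lemma telescope_lessThan: "(\<Sum>k<m. f (Suc k) - f k) = f m - (f 0 :: real)"
  by (induction m) auto

lemma discretize:
  assumes U: "in_U u0" and V: "V = total_variation u0 {0<..<1}" "0 < V" and K: "1 \<le> K"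
  shows "\<exists>n p v. valid (V / real K) K n p v \<and> n \<le> 2 * K \<and> (\<forall>j\<in>{1..n}. p j \<in> {0..1}) \<and>
     (\<forall>F. (\<integral>x. \<bar>u0 x - fsum heav F n p v x 0\<bar> \<partial>lborel) \<le> 2 * V / real K)"
proof -
  obtain vf where vf: "\<And>x y. x \<le> y \<Longrightarrow> \<bar>u0 y - u0 x\<bar> \<le> vf y - vf x" "\<And>x. 0 \<le> vf x" "\<And>x. vf x \<le> V"
    using variation_function[OF U] V by auto
  note u0 = in_U_props[OF U, folded V(1)]
  define d where "d = V / real K"
  have K0: "0 < real K" using K by simp
  have d: "0 < d" using V(2) K0 by (simp add: d_def)
  define q where "q = (\<lambda>k. real k / real K)"
  define r where "r = (\<lambda>k. \<lfloor>u0 (q k) / d\<rfloor>)"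
  have q0: "q 0 = 0" "q K = 1" using K0 by (auto simp: q_def)
  have qm: "q k \<le> q (Suc k)" for k using K0 by (simp add: q_def divide_right_mono)
  have qS: "q (Suc k) - q k = 1 / real K" for k using K0 by (simp add: q_def field_simps)
  have r0: "r 0 = 0" "r K = 0" using u0(3)[of 0] u0(3)[of 1] by (auto simp: r_def q0)
  have rb: "\<bar>r k\<bar> \<le> int K" for k
  proof -
    have "\<bar>u0 (q k)\<bar> \<le> real K * d" using u0(2)[of "q k"] K0 by (simp add: d_def)
    then have "u0 (q k) / d \<le> real K" "- real K \<le> u0 (q k) / d"
      using d by (auto simp: field_simps)
    then have "\<lfloor>u0 (q k) / d\<rfloor> \<le> int K" "- int K \<le> \<lfloor>u0 (q k) / d\<rfloor>"
      by (simp_all add: floor_le_iff le_floor_iff)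
    then show ?thesis by (simp add: r_def abs_le_iff)
  qed
  have q00: "0 \<le> q 0" by (simp add: q0)
  obtain n p v where st: "pre_valid d K n p v (q K)" "v n = d * real_of_int (r K)" "int n = (\<Sum>k<K. \<bar>r (Suc k) - r k\<bar>)"
     "\<And>f. (\<Sum>j=1..n. (v j - v (j - 1)) * f (p j)) = (\<Sum>k<K. d * real_of_int (r (Suc k) - r k) * f (q (Suc k)))"
    using step_state[where r=r and q=q and J=K and K=K, OF d r0(1) rb qm q00] by blast
  have "valid d K n p v" using st(1,2) r0 by (simp add: valid_def pre_valid_def)
  moreover have "n \<le> 2 * K"
  proof -
    have "real n = real_of_int (int n)" by simp
    also have "\<dots> = (\<Sum>k<K. \<bar>real_of_int (r (Suc k) - r k)\<bar>)" unfolding st(3) by simp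
    also have "\<dots> \<le> (\<Sum>k<K. (vf (q (Suc k)) - vf (q k)) / d + 1)"
    proof (rule sum_mono)
      fix k
      have "\<bar>real_of_int (r (Suc k) - r k)\<bar> \<le> \<bar>u0 (q (Suc k)) / d - u0 (q k) / d\<bar> + 1"
        unfolding r_def by (rule floor_diff_abs)
      also have "\<bar>u0 (q (Suc k)) / d - u0 (q k) / d\<bar> = \<bar>u0 (q (Suc k)) - u0 (q k)\<bar> / d"
        using d by (simp add: diff_divide_distrib[symmetric] abs_divide)
      also have "\<dots> \<le> (vf (q (Suc k)) - vf (q k)) / d"
        using vf(1)[OF qm] d by (intro divide_right_mono) auto
      finally show "\<bar>real_of_int (r (Suc k) - r k)\<bar> \<le> (vf (q (Suc k)) - vf (q k)) / d + 1" by simp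
    qed
    also have "\<dots> = (vf (q K) - vf (q 0)) / d + real K"
      using telescope_lessThan[of "\<lambda>k. vf (q k)" K] by (simp add: sum.distrib flip: sum_divide_distrib)
    also have "(vf (q K) - vf (q 0)) / d \<le> V / d"
      using vf(2)[of "q 0"] vf(3)[of "q K"] d by (intro divide_right_mono) auto
    also have "V / d = real K" using V(2) K0 by (simp add: d_def)
    finally show ?thesis by simp
  qed
  moreover have "\<forall>j\<in>{1..n}. p j \<in> {0..1}" using st(1) by (auto simp: pre_valid_def q0)
  moreover have "(\<integral>x. \<bar>u0 x - fsum heav F n p v x 0\<bar> \<partial>lborel) \<le> 2 * V / real K" for F
  proof -
    define f where "f = (\<lambda>x. fsum heav F n p v x 0)"
    have f: "f x = (\<Sum>k<K. d * real_of_int (r (Suc k) - r k) * heav (x - q (Suc k)))" for x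
      using st(4)[of "\<lambda>a. heav (x - a)"] by (simp add: f_def fsum_def)
    have qmono: "q i \<le> q j" if "i \<le> j" for i j using that K0 by (simp add: q_def divide_right_mono)
    have fcell: "f x = d * real_of_int (r m)" if x: "q m < x" "m < K \<Longrightarrow> x \<le> q (Suc m)" "m \<le> K" for x m
    proof -
      have "f x = (\<Sum>k<m. d * real_of_int (r (Suc k) - r k))"
        unfolding f
      proof (rule sum.mono_neutral_cong_right)
        show "\<forall>k\<in>{..<K} - {..<m}. d * real_of_int (r (Suc k) - r k) * heav (x - q (Suc k)) = 0"
        proof
          fix k assume "k \<in> {..<K} - {..<m}"
          then have "x \<le> q (Suc k)" using x qmono[of "Suc m" "Suc k"] by auto
          then show "d * real_of_int (r (Suc k) - r k) * heav (x - q (Suc k)) = 0" by (simp add: heav_def)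
        qed
        fix k assume "k \<in> {..<m}"
        then have "q (Suc k) < x" using x qmono[of "Suc k" m] by auto
        then show "d * real_of_int (r (Suc k) - r k) * heav (x - q (Suc k)) = d * real_of_int (r (Suc k) - r k)"
          by (simp add: heav_def)
      qed (use x in auto)
      also have "\<dots> = d * (\<Sum>k<m. real_of_int (r (Suc k)) - real_of_int (r k))" by (simp add: sum_distrib_left)
      also have "\<dots> = d * real_of_int (r m)"
        using telescope_lessThan[of "\<lambda>k. real_of_int (r k)" m] r0 by simp
      finally show ?thesis .
    qed
    define w where "w = (\<lambda>m. vf (q (Suc m)) - vf (q m) + d)"
    have w0: "0 \<le> w m" for m using vf(1)[OF qm[of m]] d by (simp add: w_def)
    define g where "g = (\<lambda>x. \<Sum>m<K. w m * indicator {q m<..q (Suc m)} x)"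
    have le: "\<bar>u0 x - f x\<bar> \<le> g x" for x
    proof -
      have g0: "0 \<le> g x" unfolding g_def using w0 by (intro sum_nonneg) (auto simp: indicator_def)
      consider "x \<le> 0" | "1 < x" | "0 < x" "x \<le> 1" by linarith
      then show ?thesis
      proof cases
        case 1
        then have "heav (x - q (Suc k)) = 0" for k using qmono[of 0 "Suc k"] by (auto simp: heav_def q0)
        then have "f x = 0" by (simp add: f)
        then show ?thesis using 1 u0(3)[of x] g0 by simp
      next
        case 2
        then have "f x = 0" using fcell[of K x] by (simp add: q0 r0)
        then show ?thesis using 2 u0(3)[of x] g0 by simp
      next
        case 3
        define m where "m = nat (\<lceil>x * real K\<rceil> - 1)"
        have c: "0 < x * real K" "x * real K \<le> real K" using 3 K0 by auto
        have cl: "0 \<le> \<lceil>x * real K\<rceil> - 1" "\<lceil>x * real K\<rceil> \<le> int K"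
          using c by (auto simp: le_ceiling_iff ceiling_le_iff)
        have mm1: "int m = \<lceil>x * real K\<rceil> - 1" unfolding m_def by (rule int_nat_eq[THEN trans]) (use cl in simp)
        then have "m < K" using cl(2) by linarith
        note mm = mm1 this
        have "real m = real_of_int \<lceil>x * real K\<rceil> - 1" using mm(1) by (metis of_int_1 of_int_diff of_int_of_nat_eq)
        then have "real m < x * real K" "x * real K \<le> real m + 1" by linarith+
        then have x: "q m < x" "x \<le> q (Suc m)" using K0 by (auto simp: q_def field_simps)
        have fx: "f x = d * real_of_int (r m)" using fcell[of m x] x mm by simp
        have "r m \<le> u0 (q m) / d" "u0 (q m) / d < real_of_int (r m) + 1" by (auto simp: r_def)
        then have "d * real_of_int (r m) \<le> u0 (q m)" "u0 (q m) < d * real_of_int (r m) + d"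
          using d by (auto simp: field_simps)
        moreover have "\<bar>u0 x - u0 (q m)\<bar> \<le> vf x - vf (q m)" using x by (intro vf(1)) simp
        moreover have "vf x \<le> vf (q (Suc m))" using vf(1)[OF x(2)] by simp
        ultimately have "\<bar>u0 x - f x\<bar> \<le> w m" unfolding fx w_def by linarith
        also have "w m = w m * indicator {q m<..q (Suc m)} x" using x by simp
        also have "\<dots> \<le> g x" unfolding g_def
          using w0 mm by (intro member_le_sum) (auto simp: indicator_def)
        finally show ?thesis .
      qed
    qed
    have gi: "integrable lborel (\<lambda>x. w m * indicator {q m<..q (Suc m)} x)" for m
      by (intro integrable_mult_right) (auto simp: emeasure_lborel_Ioc qm)
    have gint: "(\<integral>x. g x \<partial>lborel) = (\<Sum>m<K. w m * (q (Suc m) - q m))"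
      unfolding g_def using gi qm by (subst Bochner_Integration.integral_sum) (auto simp: measure_def emeasure_lborel_Ioc)
    have "(\<integral>x. \<bar>u0 x - f x\<bar> \<partial>lborel) \<le> (\<integral>x. g x \<partial>lborel)"
    proof (rule integral_mono')
      show "integrable lborel g" unfolding g_def using gi by (intro Bochner_Integration.integrable_sum)
      show "0 \<le> g x" for x using order_trans[OF abs_ge_zero le] .
    qed (rule le)
    also have "\<dots> = (\<Sum>m<K. w m) / real K" unfolding gint qS by (simp add: sum_divide_distrib)
    also have "(\<Sum>m<K. w m) = vf (q K) - vf (q 0) + real K * d"
      using telescope_lessThan[of "\<lambda>k. vf (q k)" K] by (simp add: w_def sum.distrib)
    also have "real K * d = V" using K0 by (simp add: d_def)
    also have "(vf (q K) - vf (q 0) + V) / real K \<le> 2 * V / real K"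
      using vf(2)[of "q 0"] vf(3)[of "q K"] K0 by (intro divide_right_mono) auto
    finally show ?thesis by (simp add: f_def)
  qed
  ultimately show ?thesis unfolding d_def by blast
qed

section \<open>The network\<close>

definition colv :: "nat \<Rightarrow> (nat \<Rightarrow> real) \<Rightarrow> mat" where "colv n f = (n, 1, \<lambda>i j. f i)"
definition rowv :: "nat \<Rightarrow> (nat \<Rightarrow> real) \<Rightarrow> mat" where "rowv n f = (1, n, \<lambda>i j. f j)"
definition vecf :: "nat \<Rightarrow> (nat \<Rightarrow> real) \<Rightarrow> factor" where "vecf n f = (Kron, colv 1 (\<lambda>_. 1), colv n f)"

lemma mat_simps [simp]:
  "mrows (colv n f) = n" "mcols (colv n f) = 1" "ment (colv n f) i j = f i"
  "mrows (rowv n f) = 1" "mcols (rowv n f) = n" "ment (rowv n f) i j = f j"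
  "vlen (colv n f) = n" "vlen (rowv n f) = n" "vent (colv n f) i = f i"
  "is_vec (colv n f)" "is_vec (rowv n f)"
  "mrows (kron A B) = mrows A * mrows B" "mcols (kron A B) = mcols A * mcols B"
  "mrows (diagv A) = vlen A" "mcols (diagv A) = vlen A"
  "ment (kron A B) i j = ment A (i div mrows B) (j div mcols B) * ment B (i mod mrows B) (j mod mcols B)"
  "ment (diagv A) i j = (if i = j then vent A i else 0)"
  by (simp_all add: colv_def rowv_def mrows_def mcols_def ment_def vlen_def vent_def is_vec_def kron_def diagv_def)

lemma factor_simps [simp]:
  "factor_mat (Kron, A, B) = kron A B" "factor_mat (KronD, A, B) = kron A (diagv B)"
  "valid_factor (k, A, B) = (is_vec A \<and> is_vec B)" "factor_dof (k, A, B) = vlen A + vlen B"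
  by (simp_all add: factor_mat_def valid_factor_def factor_dof_def)

lemma vecf_simps [simp]:
  "mrows (factor_mat (vecf n f)) = n" "mcols (factor_mat (vecf n f)) = 1" "valid_factor (vecf n f)"
  "factor_dof (vecf n f) = Suc n" "i < n \<Longrightarrow> ment (factor_mat (vecf n f)) i j = f i"
  by (simp_all add: vecf_def)

lemma sum_split_double:
  fixes f :: "nat \<Rightarrow> real"
  shows "(\<Sum>j<2 * N. f j) = (\<Sum>j<N. f j) + (\<Sum>j<N. f (N + j))"
proof -
  have "(\<Sum>j<N + m. f j) = (\<Sum>j<N. f j) + (\<Sum>j<m. f (N + j))" for m by (induction m) auto
  from this[of N] show ?thesis by (simp add: mult_2)
qed

definition ramp :: "real \<Rightarrow> real \<Rightarrow> real" where "ramp e z = (relu z - relu (z - e)) / e"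

lemma tsum_indexed:
  assumes "length ts \<le> N"
  shows "\<exists>c q s \<theta>. \<forall>k x t. tsum k ts x t = (\<Sum>i<N. c i * k (x - q i - s i * relu (t - \<theta> i)))"
proof -
  define us where "us = ts @ replicate (N - length ts) (0, 0, 0, 0)"
  have l: "length us = N" using assms by (simp add: us_def)
  have "tsum k ts x t = (\<Sum>i<N. (\<lambda>(c, q, s, \<theta>). c * k (x - q - s * relu (t - \<theta>))) (us ! i))" for k x t
  proof -
    have "tsum k ts x t = tsum k us x t"
      by (simp add: us_def tsum_def sum_list_replicate)
    also have "\<dots> = (\<Sum>i<N. (\<lambda>(c, q, s, \<theta>). c * k (x - q - s * relu (t - \<theta>))) (us ! i))"
      unfolding tsum_def using l by (simp add: sum_list_sum_nth atLeast0LessThan)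
    finally show ?thesis .
  qed
  then show ?thesis
    by (intro exI[of _ "\<lambda>i. fst (us ! i)"] exI[of _ "\<lambda>i. fst (snd (us ! i))"]
        exI[of _ "\<lambda>i. fst (snd (snd (us ! i)))"] exI[of _ "\<lambda>i. snd (snd (snd (us ! i)))"])
      (simp add: case_prod_beta)
qed

lemma fsum_terms:
  "\<exists>ts. length ts = n \<and> (\<forall>k x t. 0 \<le> t \<longrightarrow> fsum k F n p v x t = tsum k ts x t)"
proof (induction n)
  case 0
  show ?case by (simp add: fsum_def tsum_def)
next
  case (Suc n)
  then obtain ts where "length ts = n" "\<And>k x t. 0 \<le> t \<Longrightarrow> fsum k F n p v x t = tsum k ts x t" by blast
  then show ?case
    by (intro exI[of _ "(v (Suc n) - v n, p (Suc n), chord F (v n) (v (Suc n)), 0) # ts"])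
      (auto simp: fsum_def tsum_def relu_def)
qed

context
  fixes N m :: nat and c q s \<theta> :: "nat \<Rightarrow> real" and e C :: real
begin

definition nwidth :: "nat \<Rightarrow> nat" where
  "nwidth l = (if l = 1 then 2 * N else if l = 2 then N else if l = 3 then 2 * N else if l = 4 then m * (2 * N) else 1)"

text \<open>Layer 1 outputs copies of \<open>x\<close> and \<open>relu (t - \<theta>)\<close>, layer 2 the shifted distances to the fronts, layer 3 the two
  kinks of each ramp; layer 4 only repeats these \<open>m\<close> times, to reach the prescribed width.\<close>

definition nU :: "nat \<Rightarrow> nat \<Rightarrow> factor" where
  "nU l r = (if l = 1 then vecf (2 * N) (\<lambda>i. if i < N then 1 else 0)
    else if l = 2 then (if r = 0 then (KronD, rowv 2 (\<lambda>j. if j = 0 then 1 else 0), colv N (\<lambda>_. 1))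
       else (KronD, rowv 2 (\<lambda>j. if j = 0 then 0 else 1), colv N (\<lambda>i. - s i)))
    else if l = 3 then (KronD, colv 2 (\<lambda>_. 1), colv N (\<lambda>_. 1))
    else if l = 4 then (KronD, colv m (\<lambda>_. 1), colv (2 * N) (\<lambda>_. 1))
    else (Kron, rowv m (\<lambda>j. if j = 0 then 1 else 0), rowv (2 * N) (\<lambda>j. if j < N then c j / e else - c (j - N) / e)))"

definition nV :: "nat \<Rightarrow> nat \<Rightarrow> factor" where
  "nV l r = (if l = 1 then (if r = 0 then vecf (2 * N) (\<lambda>i. if i < N then 0 else - \<theta> (i - N))
       else vecf (2 * N) (\<lambda>i. if i < N then 0 else 1))
    else if l = 2 then vecf N (\<lambda>i. C - q i)
    else if l = 3 then vecf (2 * N) (\<lambda>i. if i < N then - C else - C - e)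
    else if l = 4 then (Kron, colv m (\<lambda>_. 0), colv (2 * N) (\<lambda>_. 0))
    else vecf 1 (\<lambda>_. 0))"

definition ng0 :: "nat \<Rightarrow> nat \<Rightarrow> real" where "ng0 l r = (if r = 0 \<or> l = 2 then 1 else 0)"
definition nh0 :: "nat \<Rightarrow> nat \<Rightarrow> real" where "nh0 l r = (if r = 0 then 1 else 0)"
definition nh1 :: "nat \<Rightarrow> nat \<Rightarrow> real" where "nh1 l r = (if l = 1 \<and> r = 1 then 1 else 0)"

lemma upto5: "{1..5::nat} = {1, 2, 3, 4, 5}" "{..5::nat} = {0, 1, 2, 3, 4, 5}" by auto

lemma lessThan2: "{..<2::nat} = {0, 1}" by auto

lemma network_basis:
  assumes "1 \<le> N" "1 \<le> m"
  shows "lrnr_basis 5 nwidth 2 nU nV"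
  unfolding lrnr_basis_def upto5 using assms
  by (auto simp: nwidth_def nU_def nV_def le_Suc_eq less_Suc_eq numeral_2_eq_2)

lemma network_dof: "lrnr_dof 5 2 nU nV = 30 * N + 6 * m + 20"
  unfolding lrnr_dof_def upto5 lessThan2 by (simp add: nU_def nV_def)

lemma network_width:
  assumes "1 \<le> N" "1 \<le> m"
  shows "net_width 5 nwidth = m * (2 * N)"
proof -
  have "nwidth ` {..5} = {1, 2 * N, N, m * (2 * N)}" unfolding upto5 by (auto simp: nwidth_def)
  moreover have "Max {1, 2 * N, N, m * (2 * N)} = m * (2 * N)"
    using assms by (intro Max_eqI) (auto intro: order_trans[of _ "2 * N"])
  ultimately show ?thesis by (simp add: net_width_def)
qed

lemma network_eval:
  assumes N: "1 \<le> N" "1 \<le> m" and e: "0 < e" and x: "0 \<le> x"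
    and C: "\<And>i. i < N \<Longrightarrow> 0 \<le> x - s i * relu (t - \<theta> i) - q i + C"
  shows "lrnr_eval 5 nwidth 2 nU nV (\<lambda>l i. ng0 l i + 0 * t) (\<lambda>l i. nh0 l i + nh1 l i * t) x
     = (\<Sum>i<N. c i * ramp e (x - q i - s i * relu (t - \<theta> i)))"
proof -
  define W where "W = (\<lambda>l i j. \<Sum>r<2. (ng0 l r + 0 * t) * ment (factor_mat (nU l r)) i j)"
  define B where "B = (\<lambda>l i. \<Sum>r<2. (nh0 l r + nh1 l r * t) * ment (factor_mat (nV l r)) i 0)"
  define H where "H = hidden nwidth W B x"
  have H0: "H 0 j = x" for j by (simp add: H_def)
  have HS: "H l i = relu ((\<Sum>j<nwidth (l - 1). W l i j * H (l - 1) j) + B l i)" if "1 \<le> l" for l i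
    using that by (cases l) (simp_all add: H_def)
  have h1: "H 1 i = (if i < N then x else relu (t - \<theta> (i - N)))" if "i < 2 * N" for i
  proof -
    have "H 1 i = relu (W 1 i 0 * x + B 1 i)" using HS[of 1 i] by (simp add: nwidth_def H0)
    also have "W 1 i 0 = (if i < N then 1 else 0)" using that by (simp add: W_def lessThan2 ng0_def nU_def)
    also have "B 1 i = (if i < N then 0 else t - \<theta> (i - N))" using that by (simp add: B_def lessThan2 nh0_def nh1_def nV_def)
    finally show ?thesis using x by (simp add: relu_def)
  qed
  define z where "z = (\<lambda>i. x - q i - s i * relu (t - \<theta> i))"
  have h2: "H 2 i = z i + C" if i: "i < N" for i
  proof -
    have W2: "W 2 i j = (if j < N then (if i = j then 1 else 0) else (if i = j - N then - s i else 0))" if "j < 2 * N" for j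
    proof (cases "j < N")
      case False
      then have "j div N = 1" "j mod N = j - N" using that by (auto simp: div_nat_eqI le_mod_geq)
      then show ?thesis using False i N by (simp add: W_def lessThan2 ng0_def nU_def)
    qed (use i N in \<open>simp add: W_def lessThan2 ng0_def nU_def\<close>)
    have "H 2 i = relu ((\<Sum>j<2 * N. W 2 i j * H 1 j) + B 2 i)" using HS[of 2 i] by (simp add: nwidth_def)
    also have "(\<Sum>j<2 * N. W 2 i j * H 1 j) = (\<Sum>j<N. (if i = j then 1 else 0) * x) + (\<Sum>j<N. (if i = j then - s i else 0) * relu (t - \<theta> j))"
      unfolding sum_split_double by (intro arg_cong2[where f="(+)"] sum.cong refl) (simp_all add: W2 h1[unfolded One_nat_def])
    also have "\<dots> = x - s i * relu (t - \<theta> i)" using i by (simp add: if_distrib[where f="\<lambda>a. a * _"] cong: if_cong)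
    also have "B 2 i = C - q i" using i by (simp add: B_def lessThan2 nh0_def nh1_def nV_def)
    finally show ?thesis using C[OF i] by (simp add: relu_def z_def)
  qed
  have h3: "H 3 i = (if i < N then relu (z i) else relu (z (i - N) - e))" if i: "i < 2 * N" for i
  proof -
    define i' where "i' = i mod N"
    have i': "i' < N" "i' = (if i < N then i else i - N)" using N i by (auto simp: i'_def le_mod_geq)
    have "H 3 i = relu ((\<Sum>j<N. W 3 i j * H 2 j) + B 3 i)" using HS[of 3 i] by (simp add: nwidth_def)
    also have "(\<Sum>j<N. W 3 i j * H 2 j) = (\<Sum>j<N. (if i' = j then 1 else 0) * (z j + C))"
      using N by (intro sum.cong refl) (simp add: W_def lessThan2 ng0_def nU_def h2 i'_def)
    also have "\<dots> = z i' + C" using i' by (simp add: if_distrib[where f="\<lambda>a. a * _"] cong: if_cong)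
    also have "B 3 i = (if i < N then - C else - C - e)" using i by (simp add: B_def lessThan2 nh0_def nh1_def nV_def)
    finally show ?thesis using i' by (simp add: add.commute)
  qed
  have h4: "H 4 i = H 3 (i mod (2 * N))" if i: "i < m * (2 * N)" for i
  proof -
    define i' where "i' = i mod (2 * N)"
    have i': "i' < 2 * N" using N by (simp add: i'_def)
    have "H 4 i = relu ((\<Sum>j<2 * N. W 4 i j * H 3 j) + B 4 i)"
      using HS[of 4 i] by (simp add: nwidth_def)
    also have "(\<Sum>j<2 * N. W 4 i j * H 3 j) = (\<Sum>j<2 * N. (if i' = j then 1 else 0) * H 3 j)"
      using N by (intro sum.cong refl) (simp add: W_def lessThan2 ng0_def nU_def i'_def)
    also have "\<dots> = H 3 i'" using i' by (simp add: if_distrib[where f="\<lambda>a. a * _"] cong: if_cong)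
    also have "B 4 i = 0" by (simp add: B_def lessThan2 nh0_def nh1_def nV_def)
    finally show ?thesis using h3[OF i'] by (simp add: relu_def i'_def)
  qed
  have "lrnr_eval 5 nwidth 2 nU nV (\<lambda>l i. ng0 l i + 0 * t) (\<lambda>l i. nh0 l i + nh1 l i * t) x
     = (\<Sum>j<m * (2 * N). W 5 0 j * H 4 j) + B 5 0"
    unfolding lrnr_eval_def net_def W_def[symmetric] B_def[symmetric] H_def[symmetric] by (simp add: nwidth_def)
  also have "B 5 0 = 0" by (simp add: B_def lessThan2 nh0_def nh1_def nV_def)
  also have "(\<Sum>j<m * (2 * N). W 5 0 j * H 4 j) = (\<Sum>j<2 * N. W 5 0 j * H 4 j)"
  proof (rule sum.mono_neutral_right)
    show "\<forall>j\<in>{..<m * (2 * N)} - {..<2 * N}. W 5 0 j * H 4 j = 0"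
    proof
      fix j assume "j \<in> {..<m * (2 * N)} - {..<2 * N}"
      then have "j div (2 * N) \<noteq> 0" using N by (auto simp: div_eq_0_iff)
      then show "W 5 0 j * H 4 j = 0" by (simp add: W_def lessThan2 ng0_def nU_def)
    qed
  qed (use N in auto)
  also have "\<dots> = (\<Sum>j<2 * N. (if j < N then c j / e else - c (j - N) / e) * H 3 j)"
  proof (intro sum.cong refl)
    fix j assume "j \<in> {..<2 * N}"
    then have j: "j < 2 * N" "j < m * (2 * N)" using N by (auto intro: less_le_trans[of _ "2 * N"])
    then show "W 5 0 j * H 4 j = (if j < N then c j / e else - c (j - N) / e) * H 3 j"
      by (simp add: W_def lessThan2 ng0_def nU_def h4)
  qed
  also have "\<dots> = (\<Sum>j<N. c j / e * relu (z j)) + (\<Sum>j<N. - c j / e * relu (z j - e))"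
    unfolding sum_split_double by (intro arg_cong2[where f="(+)"] sum.cong refl) (simp_all add: h3)
  also have "\<dots> = (\<Sum>i<N. c i * ramp e (z i))"
    unfolding sum.distrib[symmetric] by (intro sum.cong refl) (simp add: ramp_def diff_divide_distrib right_diff_distrib)
  finally show ?thesis by (simp add: z_def)
qed

end

lemma network_realizes:
  assumes N: "1 \<le> N" "1 \<le> m" "length ts \<le> N" and e: "0 < e" and T: "0 < T"
  shows "\<exists>M U V g0 g1 h0 h1. lrnr_basis 5 M 2 U V \<and> lrnr_dof 5 2 U V = 30 * N + 6 * m + 20 \<and> net_width 5 M = m * (2 * N) \<and>
     (\<forall>t\<in>{0<..<T}. \<forall>x\<in>{0<..<1}. lrnr_eval 5 M 2 U V (\<lambda>l i. g0 l i + g1 l i * t) (\<lambda>l i. h0 l i + h1 l i * t) x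
        = tsum (ramp e) ts x t)"
proof -
  obtain c q s \<theta> where ts: "\<And>k x t. tsum k ts x t = (\<Sum>i<N. c i * k (x - q i - s i * relu (t - \<theta> i)))"
    using tsum_indexed[OF N(3)] by blast
  define C where "C = (\<Sum>i<N. \<bar>s i\<bar> * (T + \<bar>\<theta> i\<bar>) + \<bar>q i\<bar>)"
  have C: "0 \<le> x - s i * relu (t - \<theta> i) - q i + C" if "i < N" "t \<in> {0<..<T}" "x \<in> {0<..<1}" for i t x
  proof -
    have "\<bar>s i\<bar> * (T + \<bar>\<theta> i\<bar>) + \<bar>q i\<bar> \<le> C"
      unfolding C_def using that T by (intro member_le_sum) auto
    moreover have "\<bar>s i * relu (t - \<theta> i)\<bar> \<le> \<bar>s i\<bar> * (T + \<bar>\<theta> i\<bar>)"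
      unfolding abs_mult using that by (intro mult_left_mono) (auto simp: relu_def)
    ultimately show ?thesis using that by auto
  qed
  show ?thesis
  proof (intro exI conjI ballI)
    show "lrnr_basis 5 (nwidth N m) 2 (nU N m c s e) (nV N m q \<theta> e C)" by (rule network_basis[OF N(1,2)])
    show "lrnr_dof 5 2 (nU N m c s e) (nV N m q \<theta> e C) = 30 * N + 6 * m + 20" by (rule network_dof)
    show "net_width 5 (nwidth N m) = m * (2 * N)" by (rule network_width[OF N(1,2)])
    fix t x assume tx: "t \<in> {0<..<T}" "x \<in> {0<..<1::real}"
    show "lrnr_eval 5 (nwidth N m) 2 (nU N m c s e) (nV N m q \<theta> e C)
        (\<lambda>l i. ng0 l i + (\<lambda>_ _. 0) l i * t) (\<lambda>l i. nh0 l i + nh1 l i * t) x = tsum (ramp e) ts x t"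
      unfolding ts by (rule network_eval[OF N(1,2) e _ C]) (use tx in auto)
  qed
qed

section \<open>The entropy solution and its approximation\<close>

lemma AE_zero_of_lower_integrals:
  fixes f :: "real \<Rightarrow> real"
  assumes f: "integrable lborel f" and z: "\<And>x. (\<integral>y. indicator {..x} y * f y \<partial>lborel) = 0" and t: "(\<integral>y. f y \<partial>lborel) = 0"
  shows "AE x in lborel. f x = 0"
proof -
  define g where "g = (\<lambda>x. max 0 (f x))"
  define h where "h = (\<lambda>x. max 0 (- f x))"
  have gi: "integrable lborel g" and hi: "integrable lborel h" unfolding g_def h_def using f by auto
  have ind: "integrable lborel (\<lambda>y. indicator A y * k y)" if "integrable lborel k" "A \<in> sets borel" for k :: "real \<Rightarrow> real" and A
    using integrable_mult_indicator[of A lborel k] that by simp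
  have eq: "(\<integral>y. indicator {x<..} y * g y \<partial>lborel) = (\<integral>y. indicator {x<..} y * h y \<partial>lborel)" for x
  proof -
    have "(\<integral>y. indicator {x<..} y * f y \<partial>lborel) = (\<integral>y. f y - indicator {..x} y * f y \<partial>lborel)"
      by (intro Bochner_Integration.integral_cong) (auto simp: indicator_def)
    also have "\<dots> = 0" using f ind[OF f] z t by (subst Bochner_Integration.integral_diff) auto
    finally have "(\<integral>y. indicator {x<..} y * f y \<partial>lborel) = 0" .
    moreover have "(\<lambda>y. indicator {x<..} y * f y) = (\<lambda>y. indicator {x<..} y * g y - indicator {x<..} y * h y)"
      by (auto simp: g_def h_def max_def indicator_def)
    ultimately show ?thesis using ind[OF gi] ind[OF hi] by (simp add: Bochner_Integration.integral_diff)
  qed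
  have em: "emeasure (density lborel (\<lambda>x. ennreal (k x))) {x<..} = ennreal (\<integral>y. indicator {x<..} y * k y \<partial>lborel)"
    if "integrable lborel k" "\<And>y. 0 \<le> k y" for k :: "real \<Rightarrow> real" and x
  proof -
    have "emeasure (density lborel (\<lambda>x. ennreal (k x))) {x<..} = (\<integral>\<^sup>+y. ennreal (indicator {x<..} y * k y) \<partial>lborel)"
      using that(1) by (subst emeasure_density) (auto simp: indicator_def intro!: nn_integral_cong)
    also have "\<dots> = ennreal (\<integral>y. indicator {x<..} y * k y \<partial>lborel)"
      using that ind[OF that(1)] by (intro nn_integral_eq_integral) auto
    finally show ?thesis .
  qed
  have pos: "0 \<le> g y" "0 \<le> h y" for y by (auto simp: g_def h_def)
  have "density lborel (\<lambda>x. ennreal (g x)) = density lborel (\<lambda>x. ennreal (h x))"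
    by (rule measure_eqI_lessThan) (auto simp: em[OF gi pos(1)] em[OF hi pos(2)] eq)
  moreover have "(\<integral>\<^sup>+x. ennreal (g x) \<partial>lborel) \<noteq> \<infinity>"
    using nn_integral_eq_integral[OF gi] pos by simp
  ultimately have "AE x in lborel. ennreal (g x) = ennreal (h x)"
    using gi hi by (subst (asm) finite_density_unique) auto
  then show ?thesis
  proof eventually_elim
    case (elim x)
    then have "g x = h x" using pos by (simp add: ennreal_inj)
    then show ?case by (auto simp: g_def h_def max_def split: if_splits)
  qed
qed

lemma strictly_convex_imp_convex_on:
  assumes "strictly_convex F" shows "convex_on UNIV F"
  unfolding convex_on_def
proof (intro conjI ballI allI impI)
  fix x y u v :: real assume uv: "0 \<le> u" "0 \<le> v" "u + v = 1"
  show "F (u *\<^sub>R x + v *\<^sub>R y) \<le> u * F x + v * F y"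
  proof (cases "x = y \<or> v = 0 \<or> u = 0")
    case True
    then show ?thesis using uv by (auto simp flip: distrib_right scaleR_left.add)
  next
    case False
    have u: "u = 1 - v" using uv by simp
    have "0 < v" "v < 1" using False uv by auto
    then have "F ((1 - v) * x + v * y) < (1 - v) * F x + v * F y"
      using assms False unfolding strictly_convex_def by metis
    then show ?thesis unfolding u by simp
  qed
qed simp

lemma smooth_fun_derivs:
  assumes "smooth_fun F"
  shows "(F has_real_derivative deriv F x) (at x)" "(deriv F has_real_derivative deriv (deriv F) x) (at x)"
    "continuous_on S (deriv (deriv F))" "continuous_on S F"
proof -
  have d: "((deriv ^^ n) F) differentiable (at x)" for n x using assms by (simp add: smooth_fun_def)
  show "(F has_real_derivative deriv F x) (at x)"
    using d[of 0 x] by (simp add: DERIV_deriv_iff_real_differentiable)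
  show "(deriv F has_real_derivative deriv (deriv F) x) (at x)"
    using d[of 1 x] by (simp add: DERIV_deriv_iff_real_differentiable)
  show "continuous_on S (deriv (deriv F))"
    using d[of 2] by (intro continuous_at_imp_continuous_on ballI differentiable_imp_continuous_within) (simp add: numeral_2_eq_2)
  show "continuous_on S F"
    using d[of 0] by (intro continuous_at_imp_continuous_on ballI differentiable_imp_continuous_within) simp
qed

lemma tangent_below:
  assumes "strictly_convex F" "smooth_fun F" "F 0 = 0"
  shows "deriv F 0 * w \<le> F w"
  using convex_on_imp_above_tangent[OF strictly_convex_imp_convex_on[OF assms(1)], of 0 w "deriv F 0"]
    smooth_fun_derivs(1)[OF assms(2), of 0] assms(3) by simp

lemma chord_gap:
  assumes sm: "smooth_fun F" and M: "\<And>x. x \<in> {-R..R} \<Longrightarrow> \<bar>deriv (deriv F) x\<bar> \<le> M"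
    and a: "-R \<le> a" "a + d \<le> R" "0 < d" and w: "w \<in> {a..a+d}"
  shows "2 * (F a + chord F a (a + d) * (w - a) - F w) \<le> 2 * M * d\<^sup>2"
proof (cases "w = a")
  case True
  have "0 \<le> M" using M[of a] a by auto
  then show ?thesis using True by simp
next
  case False
  then have wa: "a < w" using w by auto
  obtain \<xi> where \<xi>: "a < \<xi>" "\<xi> < w" "F w - F a = (w - a) * deriv F \<xi>"
    using MVT2[OF wa, of F "deriv F"] smooth_fun_derivs(1)[OF sm] by blast
  have ad: "a < a + d" using a by simp
  obtain \<zeta> where \<zeta>: "a < \<zeta>" "\<zeta> < a + d" "F (a + d) - F a = (a + d - a) * deriv F \<zeta>"
    using MVT2[OF ad, of F "deriv F"] smooth_fun_derivs(1)[OF sm] by blast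
  have ch: "chord F a (a + d) = deriv F \<zeta>" using \<zeta>(3) a by (simp add: chord_def)
  have lip: "\<bar>deriv F y - deriv F x\<bar> \<le> M * (y - x)" if xy: "x < y" "-R \<le> x" "y \<le> R" for x y
  proof -
    obtain z where z: "x < z" "z < y" "deriv F y - deriv F x = (y - x) * deriv (deriv F) z"
      using MVT2[OF xy(1), of "deriv F" "deriv (deriv F)"] smooth_fun_derivs(2)[OF sm] by blast
    have "\<bar>deriv (deriv F) z\<bar> \<le> M" using M[of z] z xy by auto
    then show ?thesis unfolding z(3) abs_mult using xy by (simp add: mult.commute mult_left_mono)
  qed
  have M0: "0 \<le> M" using M[of a] a by auto
  have "\<bar>deriv F \<zeta> - deriv F \<xi>\<bar> \<le> M * d"
  proof (cases "\<xi> = \<zeta>")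
    case True then show ?thesis using M0 a by simp
  next
    case False
    have "\<bar>deriv F \<zeta> - deriv F \<xi>\<bar> \<le> M * \<bar>\<zeta> - \<xi>\<bar>"
      using lip[of \<xi> \<zeta>] lip[of \<zeta> \<xi>] \<xi> \<zeta> w a False by (cases "\<xi> < \<zeta>") (auto simp: abs_minus_commute)
    also have "\<dots> \<le> M * d" using \<xi> \<zeta> w M0 by (intro mult_left_mono) auto
    finally show ?thesis .
  qed
  then have "deriv F \<zeta> - deriv F \<xi> \<le> M * d" by simp
  then have "(deriv F \<zeta> - deriv F \<xi>) * (w - a) \<le> (M * d) * d"
    using w wa M0 a by (intro mult_mono) auto
  then show ?thesis using \<xi>(3) unfolding ch by (simp add: algebra_simps power2_eq_square)
qed

lemma grid_bound: "w \<in> grid d J \<Longrightarrow> 0 < d \<Longrightarrow> \<bar>w\<bar> \<le> d * real J"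
proof -
  assume w: "w \<in> grid d J" "0 < d"
  then obtain j where "w = d * real_of_int j" "j \<in> {- int J..int J}" unfolding grid_def by (elim imageE)
  moreover from this have "\<bar>real_of_int j\<bar> \<le> real J" by (simp add: abs_le_iff)
  ultimately show ?thesis using w by (simp add: abs_mult)
qed

context entropy_setting
begin

lemma fine_approx:
  assumes sc: "strictly_convex F" and sm: "smooth_fun F" and U: "in_U u0"
    and V: "V = total_variation u0 {0<..<1}" "0 < V" and K: "1 \<le> K" and \<epsilon>: "0 < \<epsilon>"
  shows "\<exists>m\<ge>1. \<exists>n p v ex. valid (V / real K / real m) (K * m) n p v \<and> (\<forall>j\<in>{1..n}. p j \<in> {0..1}) \<and> ftrack F n p v 0 ex \<and>
     (\<integral>x. \<bar>u0 x - fsum heav F n p v x 0\<bar> \<partial>lborel) \<le> \<epsilon> \<and>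
     (\<forall>t\<in>{0<..<T}. (\<integral>x. \<bar>u x t - trk heav F n p v 0 ex x t\<bar> \<partial>lborel) \<le> \<epsilon>)"
proof -
  have "compact ((deriv (deriv F)) ` {-2 * V..2 * V})"
    by (intro compact_continuous_image smooth_fun_derivs(3)[OF sm]) auto
  then obtain M where M: "\<And>y. y \<in> (deriv (deriv F)) ` {-2 * V..2 * V} \<Longrightarrow> \<bar>y\<bar> \<le> M"
    by (metis compact_imp_bounded bounded_iff real_norm_def)
  have MF: "\<bar>deriv (deriv F) x\<bar> \<le> M" if "x \<in> {-(2 * V)..2 * V}" for x
    using that by (intro M imageI) auto
  have M0: "0 \<le> M" using MF[of 0] V by auto
  define D where "D = 2 * V + 8 * T * M * V\<^sup>2"
  have D0: "0 < D" using V(2) T_pos M0 by (auto simp: D_def intro!: add_pos_nonneg)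
  obtain m where m: "D / \<epsilon> < real m" using reals_Archimedean2 by blast
  have "0 < D / \<epsilon>" using D0 \<epsilon> by simp
  then have m0: "0 < real m" using m by linarith
  define N where "N = K * m"
  have N: "1 \<le> N" using K m0 by (simp add: N_def)
  have Nm: "real m \<le> real N" using mult_le_mono1[OF K, of m] unfolding N_def of_nat_le_iff by simp
  have N0: "0 < real N" using N by simp
  define d where "d = V / real N"
  have d: "0 < d" using V N0 by (simp add: d_def)
  obtain n p v where st: "valid d N n p v" "n \<le> 2 * N" "\<forall>j\<in>{1..n}. p j \<in> {0..1}"
    "\<And>F. (\<integral>x. \<bar>u0 x - fsum heav F n p v x 0\<bar> \<partial>lborel) \<le> 2 * V / real N"
    using discretize[OF U V N] unfolding d_def by blast
  obtain ex where ex: "ftrack F n p v 0 ex" using ftrack_exists[OF sc st(1)] by blast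
  define e0 where "e0 = 2 * M * d\<^sup>2"
  have e0: "0 \<le> e0" using M0 by (simp add: e0_def)
  have dN: "d * real N = V" using N0 by (simp add: d_def)
  have dV: "d \<le> V" using N V by (simp add: d_def divide_le_eq)
  have gap: "2 * (F a + chord F a (a + d) * (w - a) - F w) \<le> e0" if "a \<in> grid d N" "w \<in> {a..a+d}" for a w
  proof -
    have "\<bar>a\<bar> \<le> V" using grid_bound[OF that(1) d] dN by simp
    then show ?thesis unfolding e0_def using dV d by (intro chord_gap[OF sm MF _ _ d that(2)]) auto
  qed
  have small: "2 * V / real N + T * (real n * e0) \<le> \<epsilon>"
  proof -
    have "real n * e0 \<le> (2 * real N) * e0" using st(2) e0 by (intro mult_right_mono) auto
    also have "\<dots> = 4 * M * V * d" unfolding dN[symmetric] e0_def by (simp add: power2_eq_square)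
    also have "\<dots> = 4 * M * V\<^sup>2 / real N" by (simp add: d_def power2_eq_square)
    finally have "T * (real n * e0) \<le> T * (4 * M * V\<^sup>2 / real N)" using T_pos by (intro mult_left_mono) auto
    then have "2 * V / real N + T * (real n * e0) \<le> (2 * V + 4 * T * M * V\<^sup>2) / real N"
      by (simp add: add_divide_distrib mult_ac)
    also have "\<dots> \<le> D / real N" using T_pos M0 N0 by (intro divide_right_mono) (auto simp: D_def)
    also have "\<dots> \<le> D / real m" using Nm m0 D0 by (intro divide_left_mono) auto
    also have "\<dots> \<le> \<epsilon>" using m m0 \<epsilon> by (simp add: field_simps)
    finally show ?thesis .
  qed
  have Tn: "0 \<le> T * (real n * e0)" using T_pos e0 by simp
  show ?thesis
  proof (rule exI[of _ m], rule conjI, goal_cases)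
    case 2
    show ?case
    proof (rule exI[of _ n], rule exI[of _ p], rule exI[of _ v], rule exI[of _ ex], intro conjI ballI)
      show "valid (V / real K / real m) (K * m) n p v" using st(1) by (simp add: d_def N_def)
      show "ftrack F n p v 0 ex" by (rule ex)
      show "(\<integral>x. \<bar>u0 x - fsum heav F n p v x 0\<bar> \<partial>lborel) \<le> \<epsilon>" using st(4)[of F] small Tn by linarith
      fix t assume t: "t \<in> {0<..<T}"
      have "(\<integral>x. \<bar>u x t - trk heav F n p v 0 ex x t\<bar> \<partial>lborel) \<le> (\<integral>x. \<bar>u0 x - fsum heav F n p v x 0\<bar> \<partial>lborel) + t * (real n * e0)"
        using ftrack_entropy_error[OF ex st(1) order_refl _ _ sc d e0 gap, of t] t by (simp add: uh_def)
      also have "\<dots> \<le> 2 * V / real N + T * (real n * e0)"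
        using st(4)[of F] t e0 by (intro add_mono mult_right_mono) auto
      finally show "(\<integral>x. \<bar>u x t - trk heav F n p v 0 ex x t\<bar> \<partial>lborel) \<le> \<epsilon>" using small by linarith
    qed (use st(3) in auto)
  qed (use m0 in simp)
qed

lemma solution_vanishes:
  assumes sc: "strictly_convex F" and sm: "smooth_fun F" and z: "AE x in lborel. u0 x = 0" and t: "t \<in> {0<..<T}"
  shows "(\<integral>x. \<bar>u x t\<bar> \<partial>lborel) = 0"
proof -
  have "compact ((deriv (deriv F)) ` {-2..2})"
    by (intro compact_continuous_image smooth_fun_derivs(3)[OF sm]) auto
  then obtain M where M: "\<And>y. y \<in> (deriv (deriv F)) ` {-2..2} \<Longrightarrow> \<bar>y\<bar> \<le> M"
    by (metis compact_imp_bounded bounded_iff real_norm_def)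
  have MF: "\<bar>deriv (deriv F) x\<bar> \<le> M" if "x \<in> {-2..2}" for x
    using that by (intro M imageI) auto
  have M0: "0 \<le> 2 * M * 1\<^sup>2" using MF[of 0] by auto
  have v: "valid 1 0 0 (\<lambda>_. 0) (\<lambda>_. 0)" by (simp add: valid_def)
  have gap: "2 * (F a + chord F a (a + 1) * (w - a) - F w) \<le> 2 * M * 1\<^sup>2" if "a \<in> grid 1 0" "w \<in> {a..a+1}" for a w
    using that by (intro chord_gap[OF sm MF]) (auto simp: grid_def)
  have ft: "ftrack F 0 (\<lambda>_. 0) (\<lambda>_. 0) 0 []" by (rule ftrack.stop) (simp add: ordered_def)
  have u0z: "(\<integral>x. \<bar>u0 x\<bar> \<partial>lborel) = 0"
    using z u0_int by (subst integral_cong_AE[where g="\<lambda>_. 0"]) auto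
  have "(\<integral>x. \<bar>u x t\<bar> \<partial>lborel) \<le> (\<integral>x. \<bar>u0 x\<bar> \<partial>lborel)"
    using ftrack_entropy_error[OF ft v order_refl _ _ sc _ M0 gap, of t] t
    by (simp add: uh_def trk_def fsum_def tsum_def)
  moreover have "0 \<le> (\<integral>x. \<bar>u x t\<bar> \<partial>lborel)" by simp
  ultimately show ?thesis using u0z by linarith
qed

end

lemma heav_lower_integral:
  "has_bochner_integral lborel (\<lambda>y. indicator {..x} y * heav (y - a)) (relu (x - a))"
proof -
  have e: "(\<lambda>y. indicator {..x} y * heav (y - a)) = (\<lambda>y. indicator {a<..x} y)"
    by (auto simp: heav_def indicator_def)
  have "has_bochner_integral lborel (\<lambda>y. indicator {a<..x} y :: real) (measure lborel {a<..x})"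
    by (rule has_bochner_integral_real_indicator) (simp, cases "a \<le> x", simp_all add: emeasure_lborel_Ioc)
  moreover have "measure lborel {a<..x} = relu (x - a)"
    by (cases "a \<le> x") (auto simp: relu_def measure_def emeasure_lborel_Ioc)
  ultimately show ?thesis unfolding e by simp
qed

lemma pl_lower_integral:
  "has_bochner_integral lborel (\<lambda>y. indicator {..x} y * pl heav xs y) (pl relu xs x)"
proof (induction xs)
  case (Cons e xs)
  obtain c a where e: "e = (c, a)" by (cases e)
  have "has_bochner_integral lborel (\<lambda>y. c * (indicator {..x} y * heav (y - a)) + indicator {..x} y * pl heav xs y)
     (c * relu (x - a) + pl relu xs x)"
    by (intro has_bochner_integral_add has_bochner_integral_mult_right heav_lower_integral Cons)
  then show ?case by (simp add: e algebra_simps)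
qed (simp add: has_bochner_integral_zero)

lemma lower_integral_close:
  fixes f g :: "real \<Rightarrow> real"
  assumes "integrable lborel f" "integrable lborel g"
  shows "\<bar>(\<integral>y. indicator {..x} y * f y \<partial>lborel) - (\<integral>y. indicator {..x} y * g y \<partial>lborel)\<bar> \<le> (\<integral>y. \<bar>f y - g y\<bar> \<partial>lborel)"
proof -
  have i: "integrable lborel (\<lambda>y. indicator {..x} y * f y)" "integrable lborel (\<lambda>y. indicator {..x} y * g y)"
    using integrable_mult_indicator[of "{..x}" lborel f] integrable_mult_indicator[of "{..x}" lborel g] assms by auto
  have "\<bar>(\<integral>y. indicator {..x} y * f y \<partial>lborel) - (\<integral>y. indicator {..x} y * g y \<partial>lborel)\<bar>
     = \<bar>\<integral>y. indicator {..x} y * f y - indicator {..x} y * g y \<partial>lborel\<bar>"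
    using i by simp
  also have "\<dots> \<le> (\<integral>y. \<bar>indicator {..x} y * f y - indicator {..x} y * g y\<bar> \<partial>lborel)"
    by (rule integral_abs_bound)
  also have "\<dots> \<le> (\<integral>y. \<bar>f y - g y\<bar> \<partial>lborel)"
    using i assms by (intro integral_mono integrable_abs Bochner_Integration.integrable_diff) (auto simp: indicator_def)
  finally show ?thesis .
qed

context entropy_setting
begin

text \<open>The Hopf-Lax formula makes the characteristic of speed \<open>deriv F 0\<close> a straight line that is never absorbed,
  so it cannot leave the interval unless the datum vanishes.\<close>

lemma drift_bound:
  assumes sc: "strictly_convex F" and sm: "smooth_fun F" and F0: "F 0 = 0" and U: "in_U u0"
    and V: "V = total_variation u0 {0<..<1}" "0 < V" and t: "t \<in> {0<..<T}" and big: "1 < \<bar>t * deriv F 0\<bar>"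
  shows "AE x in lborel. u0 x = 0"
proof -
  define m0 where "m0 = deriv F 0"
  define c where "c = t * m0"
  note u0 = in_U_props[OF U, folded V(1)]
  have t0: "0 < t" using t by simp
  have slope: "m0 * w \<le> F w" for w using tangent_below[OF sc sm F0] by (simp add: m0_def)
  define P where "P = (\<lambda>y. \<integral>z. indicator {..y} z * u0 z \<partial>lborel)"
  define w where "w = (\<lambda>x. \<integral>z. indicator {..x} z * u z t \<partial>lborel)"
  have approx: "\<exists>W Um L. (\<forall>y. \<bar>Um y - P y\<bar> \<le> \<epsilon>) \<and> (\<forall>x. \<bar>W x - w x\<bar> \<le> \<epsilon>) \<and> (\<forall>x y. W x \<le> Um y + L (x - y)) \<and>
     (\<forall>x. \<exists>y. Um y + L (x - y) \<le> W x) \<and> (\<forall>z. 0 \<le> L z) \<and> L c = 0 \<and>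
     (\<forall>z. (V / real K) * z - t * F (V / real K) \<le> L z \<and> (- V / real K) * z - t * F (- V / real K) \<le> L z)"
    if K: "1 \<le> K" and \<epsilon>: "0 < \<epsilon>" for K \<epsilon>
  proof -
    obtain m n p v ex where A: "1 \<le> m" "valid (V / real K / real m) (K * m) n p v" "\<forall>j\<in>{1..n}. p j \<in> {0..1}" "ftrack F n p v 0 ex"
      "(\<integral>x. \<bar>u0 x - fsum heav F n p v x 0\<bar> \<partial>lborel) \<le> \<epsilon>"
      "\<forall>t\<in>{0<..<T}. (\<integral>x. \<bar>u x t - trk heav F n p v 0 ex x t\<bar> \<partial>lborel) \<le> \<epsilon>"
      using fine_approx[OF sc sm U V K \<epsilon>] by blast
    have d: "0 < V / real K / real m" using V K A(1) by simp
    have pj: "p j \<in> {0..1}" if "j \<in> {1..n}" for j using A(3) that by blast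
    note hl = ftrack_hopf_lax[OF sc F0 slope t0 d A(2,4) pj]
    obtain xs where xs: "\<And>k x. fsum k F n p v x 0 = pl k xs x" using fsum_pl by blast
    obtain ys where ys: "\<And>k x. trk k F n p v 0 ex x t = pl k ys x" using trk_pl by blast
    define Um where "Um = (\<lambda>y. fsum relu F n p v y 0)"
    define W where "W = (\<lambda>x. trk relu F n p v 0 ex x t)"
    define L where "L = lam F (grid (V / real K / real m) (K * m)) t"
    have "\<bar>P y - Um y\<bar> \<le> \<epsilon>" for y
    proof -
      have "\<bar>P y - Um y\<bar> \<le> (\<integral>x. \<bar>u0 x - fsum heav F n p v x 0\<bar> \<partial>lborel)"
        using lower_integral_close[OF u0_int fsum_integrable[OF A(2)], of y F 0]
          has_bochner_integral_integral_eq[OF pl_lower_integral[of y xs]]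
        by (simp add: P_def Um_def xs)
      then show ?thesis using A(5) by simp
    qed
    moreover have "\<bar>w x - W x\<bar> \<le> \<epsilon>" for x
    proof -
      have "\<bar>w x - W x\<bar> \<le> (\<integral>x. \<bar>u x t - trk heav F n p v 0 ex x t\<bar> \<partial>lborel)"
        using lower_integral_close[OF u_integrable[OF t] trk_integrable[OF A(4,2), of t], of x] t0
          has_bochner_integral_integral_eq[OF pl_lower_integral[of x ys]]
        by (simp add: w_def W_def ys)
      then show ?thesis using A(6) t by fastforce
    qed
    moreover have "V / real K \<in> grid (V / real K / real m) (K * m)" "- V / real K \<in> grid (V / real K / real m) (K * m)"
    proof -
      have "int m \<le> int (K * m)" using mult_le_mono1[OF K, of m] unfolding of_nat_le_iff by simp
      then have "V / real K / real m * real_of_int (int m) \<in> grid (V / real K / real m) (K * m)"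
        "V / real K / real m * real_of_int (- int m) \<in> grid (V / real K / real m) (K * m)"
        by (intro grid_memI; simp)+
      then show "V / real K \<in> grid (V / real K / real m) (K * m)" "- V / real K \<in> grid (V / real K / real m) (K * m)"
        using A(1) by simp_all
    qed
    then have "(V / real K) * z - t * F (V / real K) \<le> L z \<and> (- V / real K) * z - t * F (- V / real K) \<le> L z" for z
      unfolding L_def by (intro conjI lam_ge) auto
    ultimately show ?thesis
      using hl(1,2,3,4)
      by (intro exI[of _ W] exI[of _ Um] exI[of _ L]) (auto simp: abs_minus_commute W_def Um_def L_def c_def)
  qed
  have upper: "w x \<le> P (x - c)" for x
  proof (rule field_le_epsilon)
    fix e :: real assume "0 < e"
    then have e2: "0 < e / 2" by simp
    obtain W Um L where A: "\<And>y. \<bar>Um y - P y\<bar> \<le> e / 2" "\<And>x. \<bar>W x - w x\<bar> \<le> e / 2"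
      "\<And>x y. W x \<le> Um y + L (x - y)" "L c = 0"
      using approx[OF order_refl e2] by blast
    have "W x \<le> Um (x - c)" using A(3)[of x "x - c"] A(4) by simp
    moreover have "Um (x - c) \<le> P (x - c) + e / 2" "w x \<le> W x + e / 2"
      using A(1)[of "x - c"] A(2)[of x] unfolding abs_le_iff by linarith+
    ultimately have "w x \<le> P (x - c) + (e / 2 + e / 2)" by linarith
    then show "w x \<le> P (x - c) + e" by simp
  qed
  have lower: "\<exists>\<kappa>>0. \<forall>x. \<forall>\<epsilon>>0. \<exists>y. P y + (if g \<le> \<bar>x - y - c\<bar> then \<kappa> else 0) \<le> w x + \<epsilon>" if g: "0 < g" for g
  proof -
    have lim: "((\<lambda>h. (F (0 + h) - F 0) / h) \<longlongrightarrow> m0) (at 0)"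
      using smooth_fun_derivs(1)[OF sm, of 0] by (simp add: DERIV_def m0_def)
    have gt: "0 < g / (2 * t)" using g t0 by simp
    obtain \<delta> where \<delta>: "0 < \<delta>" "\<And>h. h \<noteq> 0 \<Longrightarrow> \<bar>h\<bar> < \<delta> \<Longrightarrow> \<bar>F h / h - m0\<bar> < g / (2 * t)"
      using LIM_D[OF lim gt] by (auto simp: F0)
    obtain K where K: "V / \<delta> < real K" using reals_Archimedean2 by blast
    have "0 < V / \<delta>" using V \<delta> by simp
    then have K0: "0 < real K" using K by linarith
    define b where "b = V / real K"
    have b: "0 < b" "b < \<delta>" using V K0 K \<delta> by (auto simp: b_def field_simps)
    have near: "\<bar>t * (F h / h) - c\<bar> \<le> g / 2" if "h = b \<or> h = - b" for h
    proof -
      have "\<bar>F h / h - m0\<bar> < g / (2 * t)" using \<delta>(2)[of h] b that by auto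
      then have "t * \<bar>F h / h - m0\<bar> \<le> t * (g / (2 * t))" using t0 by (intro mult_left_mono) auto
      moreover have "\<bar>t * (F h / h) - c\<bar> = t * \<bar>F h / h - m0\<bar>"
      proof -
        have "t * (F h / h) - c = t * (F h / h - m0)" by (simp add: c_def right_diff_distrib)
        then show ?thesis using t0 by (simp only: abs_mult abs_of_pos)
      qed
      ultimately show ?thesis using t0 by simp
    qed
    have n1: "t * F b \<le> b * (c + g / 2)"
    proof -
      have "t * (F b / b) \<le> c + g / 2" using near[OF disjI1[OF refl]] by linarith
      then have "b * (t * (F b / b)) \<le> b * (c + g / 2)" using b by (intro mult_left_mono) auto
      then show ?thesis using b by simp
    qed
    have n2: "t * F (- b) \<le> - b * (c - g / 2)"
    proof -
      have "c - g / 2 \<le> t * (F (- b) / - b)" 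
      proof -
        have "c - g / 2 \<le> y" if "\<bar>y - c\<bar> \<le> g / 2" for y using that by linarith
        then show ?thesis using near[OF disjI2[OF refl]] by blast
      qed
      then have "b * (c - g / 2) \<le> b * (t * (F (- b) / - b))" using b by (intro mult_left_mono) auto
      then show ?thesis using b by simp
    qed
    show ?thesis
    proof (rule exI[of _ "b * (g / 2)"], intro conjI allI impI)
      show "0 < b * (g / 2)" using b g by simp
      fix x \<epsilon> :: real assume "0 < \<epsilon>"
      then have e2: "0 < \<epsilon> / 2" by simp
      have K1: "1 \<le> K" using K0 by simp
      obtain W Um L where A: "\<And>y. \<bar>Um y - P y\<bar> \<le> \<epsilon> / 2" "\<And>x. \<bar>W x - w x\<bar> \<le> \<epsilon> / 2"
        "\<And>x. \<exists>y. Um y + L (x - y) \<le> W x" "\<And>z. 0 \<le> L z"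
        "\<And>z. b * z - t * F b \<le> L z" "\<And>z. - b * z - t * F (- b) \<le> L z"
        using approx[OF K1 e2] unfolding b_def minus_divide_left[symmetric] by metis
      obtain y where y: "Um y + L (x - y) \<le> W x" using A(3) by blast
      have "(if g \<le> \<bar>x - y - c\<bar> then b * (g / 2) else 0) \<le> L (x - y)"
      proof -
        have "b * (g / 2) \<le> L (x - y)" if "c + g \<le> x - y"
        proof -
          have "b * (c + g) \<le> b * (x - y)" using b that by (intro mult_left_mono) auto
          then show ?thesis using A(5)[of "x - y"] n1 by (simp add: algebra_simps)
        qed
        moreover have "b * (g / 2) \<le> L (x - y)" if "x - y \<le> c - g"
        proof -
          have "b * (x - y) \<le> b * (c - g)" using b that by (intro mult_left_mono) auto
          then show ?thesis using A(6)[of "x - y"] n2 by (simp add: algebra_simps)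
        qed
        moreover have "c + g \<le> x - y \<or> x - y \<le> c - g" if "g \<le> \<bar>x - y - c\<bar>" using that by linarith
        ultimately show ?thesis using A(4)[of "x - y"] by auto
      qed
      moreover have "P y \<le> Um y + \<epsilon> / 2" "W x \<le> w x + \<epsilon> / 2"
        using A(1)[of y] A(2)[of x] unfolding abs_le_iff by linarith+
      ultimately have "P y + (if g \<le> \<bar>x - y - c\<bar> then b * (g / 2) else 0) \<le> w x + (\<epsilon> / 2 + \<epsilon> / 2)"
        using y by linarith
      then show "\<exists>y. P y + (if g \<le> \<bar>x - y - c\<bar> then b * (g / 2) else 0) \<le> w x + \<epsilon>"
        unfolding field_sum_of_halves by (rule exI)
    qed
  qed
  have indi: "integrable lborel (\<lambda>z. indicator {..y} z * u0 z)" for y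
    using integrable_mult_indicator[of "{..y}" lborel u0] u0_int by simp
  have P_lip1: "\<bar>P y' - P y\<bar> \<le> V * (y' - y)" if "y \<le> y'" for y y'
  proof -
    have "P y' - P y = (\<integral>z. indicator {..y'} z * u0 z - indicator {..y} z * u0 z \<partial>lborel)"
      unfolding P_def using indi by simp
    also have "\<dots> = (\<integral>z. indicator {y<..y'} z * u0 z \<partial>lborel)"
      using that by (intro Bochner_Integration.integral_cong) (auto simp: indicator_def)
    finally have e: "P y' - P y = (\<integral>z. indicator {y<..y'} z * u0 z \<partial>lborel)" .
    have "\<bar>P y' - P y\<bar> \<le> (\<integral>z. V * indicator {y<..y'} z \<partial>lborel)"
      unfolding e
    proof (rule order_trans[OF integral_abs_bound integral_mono'])
      show "integrable lborel (\<lambda>z. V * indicator {y<..y'} z)"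
        using that by (intro integrable_mult_right) (auto simp: emeasure_lborel_Ioc)
    qed (use u0(2) V in \<open>auto simp: indicator_def\<close>)
    also have "\<dots> = V * (y' - y)" using that by (simp add: measure_def emeasure_lborel_Ioc)
    finally show ?thesis .
  qed
  have P_lip: "P y' \<le> P y + V * \<bar>y' - y\<bar>" for y y'
    using P_lip1[of y y'] P_lip1[of y' y] by (cases "y \<le> y'") auto
  have P_left: "P y = 0" if "y \<le> 0" for y
  proof -
    have "(\<lambda>z. indicator {..y} z * u0 z) = (\<lambda>_. 0)" using u0(3) that by (auto simp: indicator_def)
    then show ?thesis by (simp add: P_def)
  qed
  have P_right: "P y = P 1" if "1 \<le> y" for y
  proof -
    have "(\<lambda>z. indicator {..y} z * u0 z) = (\<lambda>z. indicator {..1} z * u0 z)" using u0(3) that by (auto simp: indicator_def)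
    then show ?thesis by (simp add: P_def)
  qed
  have uz: "AE x in lborel. x \<notin> {0<..<1} \<longrightarrow> u x t = 0" using zout t by (auto simp: zero_outside_def)
  have w_left: "w x = 0" if "x \<le> 0" for x
  proof -
    have "w x = (\<integral>z. 0 \<partial>(lborel :: real measure))"
      unfolding w_def using uz that by (intro integral_cong_AE) (auto simp: indicator_def)
    then show ?thesis by simp
  qed
  have w_right: "w x = w 1" if "1 \<le> x" for x
    unfolding w_def using uz that by (intro integral_cong_AE) (auto simp: indicator_def)
  have squeeze: "P (x - c) \<le> w x" if lb: "\<And>y. w x \<le> P y" for x
  proof (rule field_le_epsilon)
    fix e :: real assume e: "0 < e"
    define g where "g = e / (1 + V)"
    have g: "0 < g" "g + V * g = e"
    proof -
      show "0 < g" using e V(2) by (simp add: g_def)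
      have "g * (1 + V) = e" using V(2) by (simp add: g_def)
      then show "g + V * g = e" by (simp add: algebra_simps)
    qed
    obtain \<kappa> where \<kappa>: "0 < \<kappa>" "\<And>x \<epsilon>. 0 < \<epsilon> \<Longrightarrow> \<exists>y. P y + (if g \<le> \<bar>x - y - c\<bar> then \<kappa> else 0) \<le> w x + \<epsilon>"
      using lower[OF g(1)] by blast
    have "0 < min (\<kappa> / 2) g" using \<kappa> g by simp
    then obtain y where y: "P y + (if g \<le> \<bar>x - y - c\<bar> then \<kappa> else 0) \<le> w x + min (\<kappa> / 2) g" using \<kappa>(2) by blast
    have "\<not> g \<le> \<bar>x - y - c\<bar>"
    proof
      assume "g \<le> \<bar>x - y - c\<bar>"
      then have "P y + \<kappa> \<le> w x + \<kappa> / 2" using y by simp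
      then show False using lb[of y] \<kappa>(1) by (simp add: field_simps)
    qed
    then have n: "\<bar>x - c - y\<bar> < g" "P y \<le> w x + g" using y by auto
    have "V * \<bar>x - c - y\<bar> \<le> V * g" using n V by (intro mult_left_mono) auto
    then show "P (x - c) \<le> w x + e" using P_lip[of "x - c" y] n g(2) by linarith
  qed
  have Pz: "P y = 0" for y
  proof (cases "1 < c")
    case True
    have lb: "w 1 \<le> P y" for y
    proof (cases "0 \<le> y")
      case True
      then show ?thesis using upper[of "y + c"] w_right[of "y + c"] \<open>1 < c\<close> by simp
    next
      case False
      then show ?thesis using upper[of c] w_right[of c] \<open>1 < c\<close> P_left[of 0] P_left[of y] by simp
    qed
    have eq: "P y = w 1" if "0 \<le> y" for y
      using squeeze[of "y + c"] w_right[of "y + c"] lb that True by (force intro: antisym)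
    then have "w 1 = 0" using P_left[of 0] by force
    then show ?thesis using eq P_left by (cases "0 \<le> y") auto
  next
    case False
    then have c: "c < -1" using big by (auto simp: c_def m0_def abs_if split: if_splits)
    have lb1: "0 \<le> P y" if "y \<le> 1" for y
      using upper[of "y + c"] w_left[of "y + c"] that c by simp
    have lb: "0 \<le> P y" for y using lb1[of y] lb1[of 1] P_right[of y] by (cases "y \<le> 1") auto
    have eq: "P y = 0" if "y \<le> 1" for y
    proof -
      have "w (y + c) = 0" using w_left[of "y + c"] that c by simp
      then show ?thesis using squeeze[of "y + c"] lb by (simp add: antisym)
    qed
    then show ?thesis using P_right[of y] by (cases "y \<le> 1") auto
  qed
  have total: "(\<integral>z. u0 z \<partial>lborel) = P 1"
    unfolding P_def using u0(3) by (intro Bochner_Integration.integral_cong) (auto simp: indicator_def)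
  show ?thesis
    by (rule AE_zero_of_lower_integrals[OF u0_int Pz[unfolded P_def]]) (simp add: total Pz)
qed

end

lemma ramp_heav:
  assumes "0 < e"
  shows "integrable lborel (\<lambda>x. heav (x - a) - ramp e (x - a))" "(\<integral>x. \<bar>heav (x - a) - ramp e (x - a)\<bar> \<partial>lborel) \<le> e"
proof -
  have b: "\<bar>heav (x - a) - ramp e (x - a)\<bar> \<le> indicator {a..a+e} x" for x
  proof -
    consider "x < a" | "a \<le> x" "x \<le> a + e" | "a + e < x" by linarith
    then show ?thesis using assms by cases (auto simp: heav_def ramp_def relu_def indicator_def abs_le_iff field_simps)
  qed
  have i: "integrable lborel (\<lambda>x. indicator {a..a+e} x :: real)" by (auto simp: emeasure_lborel_Icc_eq)
  show int: "integrable lborel (\<lambda>x. heav (x - a) - ramp e (x - a))"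
    by (rule Bochner_Integration.integrable_bound[OF i]) (use b in \<open>auto simp: ramp_def intro!: AE_I2\<close>)
  have "(\<integral>x. \<bar>heav (x - a) - ramp e (x - a)\<bar> \<partial>lborel) \<le> (\<integral>x. indicator {a..a+e} x \<partial>lborel)"
    using int i b by (intro integral_mono integrable_abs) auto
  also have "\<dots> = e" using assms by simp
  finally show "(\<integral>x. \<bar>heav (x - a) - ramp e (x - a)\<bar> \<partial>lborel) \<le> e" .
qed

lemma tsum_ramp_heav:
  assumes e: "0 < e"
  shows "integrable lborel (\<lambda>x. tsum heav ts x t - tsum (ramp e) ts x t)"
    "(\<integral>x. \<bar>tsum heav ts x t - tsum (ramp e) ts x t\<bar> \<partial>lborel) \<le> e * (\<Sum>a\<leftarrow>ts. \<bar>fst a\<bar>)"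
proof -
  have "integrable lborel (\<lambda>x. tsum heav ts x t - tsum (ramp e) ts x t) \<and>
    (\<integral>x. \<bar>tsum heav ts x t - tsum (ramp e) ts x t\<bar> \<partial>lborel) \<le> e * (\<Sum>a\<leftarrow>ts. \<bar>fst a\<bar>)"
  proof (induction ts)
    case (Cons a ts)
    obtain c q s \<theta> where a: "a = (c, q, s, \<theta>)" by (cases a) auto
    define b where "b = q + s * relu (t - \<theta>)"
    let ?g = "\<lambda>x. c * (heav (x - b) - ramp e (x - b))"
    let ?f = "\<lambda>x. tsum heav ts x t - tsum (ramp e) ts x t"
    have eq: "tsum heav (a # ts) x t - tsum (ramp e) (a # ts) x t = ?g x + ?f x" for x
      by (simp add: tsum_def a b_def diff_diff_eq right_diff_distrib)
    have gi: "integrable lborel ?g" by (intro integrable_mult_right ramp_heav e)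
    have fi: "integrable lborel ?f" by (rule Cons.IH[THEN conjunct1])
    have "(\<integral>x. \<bar>?g x + ?f x\<bar> \<partial>lborel) \<le> (\<integral>x. \<bar>?g x\<bar> + \<bar>?f x\<bar> \<partial>lborel)"
      using gi fi by (intro integral_mono integrable_abs Bochner_Integration.integrable_add) auto
    also have "\<dots> = (\<integral>x. \<bar>?g x\<bar> \<partial>lborel) + (\<integral>x. \<bar>?f x\<bar> \<partial>lborel)"
      using gi fi by (intro Bochner_Integration.integral_add integrable_abs)
    also have "(\<integral>x. \<bar>?g x\<bar> \<partial>lborel) = \<bar>c\<bar> * (\<integral>x. \<bar>heav (x - b) - ramp e (x - b)\<bar> \<partial>lborel)"
      by (simp add: abs_mult)
    also have "\<dots> \<le> \<bar>c\<bar> * e" by (intro mult_left_mono ramp_heav e) auto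
    also have "(\<integral>x. \<bar>?f x\<bar> \<partial>lborel) \<le> e * (\<Sum>a\<leftarrow>ts. \<bar>fst a\<bar>)" by (rule Cons.IH[THEN conjunct2])
    finally have le: "(\<integral>x. \<bar>?g x + ?f x\<bar> \<partial>lborel) \<le> \<bar>c\<bar> * e + e * (\<Sum>a\<leftarrow>ts. \<bar>fst a\<bar>)" by simp
    show ?case
      unfolding eq
    proof (rule conjI)
      show "integrable lborel (\<lambda>x. ?g x + ?f x)" using gi fi by (rule Bochner_Integration.integrable_add)
      show "(\<integral>x. \<bar>?g x + ?f x\<bar> \<partial>lborel) \<le> e * (\<Sum>a\<leftarrow>a # ts. \<bar>fst a\<bar>)"
        using le by (simp add: a distrib_left mult.commute)
    qed
  qed (simp add: tsum_def)
  then show "integrable lborel (\<lambda>x. tsum heav ts x t - tsum (ramp e) ts x t)"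
    "(\<integral>x. \<bar>tsum heav ts x t - tsum (ramp e) ts x t\<bar> \<partial>lborel) \<le> e * (\<Sum>a\<leftarrow>ts. \<bar>fst a\<bar>)" by auto
qed

lemma L1_triangle:
  fixes f g h :: "real \<Rightarrow> real"
  assumes "integrable lborel (\<lambda>x. f x - g x)" "integrable lborel (\<lambda>x. g x - h x)" "A \<in> sets borel"
  shows "(LINT x:A|lborel. \<bar>f x - h x\<bar>) \<le> (LINT x:A|lborel. \<bar>f x - g x\<bar>) + (LINT x:A|lborel. \<bar>g x - h x\<bar>)"
proof -
  have i: "set_integrable lborel A (\<lambda>x. \<bar>k x\<bar>)" if "integrable lborel k" for k :: "real \<Rightarrow> real"
    unfolding set_integrable_def using that assms(3) by (intro integrable_mult_indicator) auto
  have "integrable lborel (\<lambda>x. (f x - g x) + (g x - h x))" using assms(1,2) by (rule Bochner_Integration.integrable_add)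
  then have fh: "integrable lborel (\<lambda>x. f x - h x)" by simp
  have "(LINT x:A|lborel. \<bar>f x - h x\<bar>) \<le> (LINT x:A|lborel. \<bar>f x - g x\<bar> + \<bar>g x - h x\<bar>)"
    using i[OF fh] i[OF assms(1)] i[OF assms(2)] by (intro set_integral_mono set_integral_add) auto
  also have "\<dots> = (LINT x:A|lborel. \<bar>f x - g x\<bar>) + (LINT x:A|lborel. \<bar>g x - h x\<bar>)"
    by (intro set_integral_add i assms(1,2))
  finally show ?thesis .
qed

lemma set_L1_le:
  fixes f :: "real \<Rightarrow> real"
  assumes "integrable lborel f" "A \<in> sets borel"
  shows "(LINT x:A|lborel. \<bar>f x\<bar>) \<le> (\<integral>x. \<bar>f x\<bar> \<partial>lborel)"
  unfolding set_lebesgue_integral_def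
  using assms by (intro integral_mono integrable_mult_indicator integrable_abs) (auto simp: indicator_def)

lemma F2_norm_nonneg:
  assumes sm: "smooth_fun F" and U: "in_U u0"
  shows "0 \<le> F2_norm F u0"
proof -
  define V where "V = total_variation u0 {0<..<1}"
  note u0 = in_U_props[OF U, folded V_def]
  have "compact ((\<lambda>v. \<bar>deriv (deriv F) v\<bar>) ` {-V..V})"
    by (intro compact_continuous_image continuous_intros smooth_fun_derivs(3)[OF sm]) auto
  then have "bdd_above ((\<lambda>v. \<bar>deriv (deriv F) v\<bar>) ` {-V..V})"
    by (intro bounded_imp_bdd_above compact_imp_bounded)
  moreover have "u0 ` {0<..<1} \<subseteq> {-V..V}"
  proof
    fix y assume "y \<in> u0 ` {0<..<1}"
    then obtain x where "y = u0 x" by auto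
    then show "y \<in> {-V..V}" using u0(2)[of x] by (auto simp: abs_le_iff)
  qed
  ultimately have bdd: "bdd_above ((\<lambda>v. \<bar>deriv (deriv F) v\<bar>) ` (u0 ` {0<..<1}))"
    by (meson bdd_above_mono image_mono)
  have "\<bar>deriv (deriv F) (u0 (1/2))\<bar> \<in> (\<lambda>v. \<bar>deriv (deriv F) v\<bar>) ` (u0 ` {0<..<1})" by auto
  from cSup_upper[OF this bdd] show ?thesis unfolding F2_norm_def by linarith
qed

context entropy_setting
begin

lemma network_approximation:
  assumes sc: "strictly_convex F" and sm: "smooth_fun F" and F0: "F 0 = 0" and U: "in_U u0" and K: "1 \<le> K"
  shows "\<exists>ts e. 0 < e \<and> length ts \<le> 8 * K \<and> (\<forall>t\<in>{0<..<T}.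
      integrable lborel (\<lambda>x. u x t - tsum (ramp e) ts x t) \<and>
      (LINT x:{0<..<1}|lborel. \<bar>u x t - tsum (ramp e) ts x t\<bar>) \<le> 23 / real K * total_variation u0 {0<..<1})"
proof -
  define V where "V = total_variation u0 {0<..<1}"
  note u0 = in_U_props[OF U, folded V_def]
  have K0: "0 < real K" using K by simp
  show ?thesis
  proof (cases "AE x in lborel. u0 x = 0")
    case True
    have "(LINT x:{0<..<1}|lborel. \<bar>u x t - tsum (ramp 1) [] x t\<bar>) \<le> 23 / real K * V" if t: "t \<in> {0<..<T}" for t
    proof -
      have "(LINT x:{0<..<1}|lborel. \<bar>u x t\<bar>) \<le> (\<integral>x. \<bar>u x t\<bar> \<partial>lborel)"
        by (rule set_L1_le[OF u_integrable[OF t]]) simp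
      also have "\<dots> = 0" by (rule solution_vanishes[OF sc sm True t])
      also have "0 \<le> 23 / real K * V" using u0(1) by simp
      finally show ?thesis by (simp add: tsum_def)
    qed
    moreover have "integrable lborel (\<lambda>x. u x t - tsum (ramp 1) [] x t)" if "t \<in> {0<..<T}" for t
      using u_integrable[OF that] by (simp add: tsum_def)
    ultimately show ?thesis unfolding V_def
      by (intro exI[of _ "[]"] exI[of _ 1]) simp
  next
    case False
    have V: "0 < V"
    proof (rule ccontr)
      assume "\<not> 0 < V"
      then have "u0 x = 0" for x using u0(2)[of x] by simp
      then show False using False by simp
    qed
    have drift: "\<bar>t * deriv F 0\<bar> \<le> 1" if "t \<in> {0<..<T}" for t
      using drift_bound[OF sc sm F0 U V_def V that] False by force
    define d where "d = V / real K"
    have d: "0 < d" using V K0 by (simp add: d_def)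
    obtain n p v where st: "valid d K n p v" "n \<le> 2 * K" "\<forall>j\<in>{1..n}. p j \<in> {0..1}"
      "\<And>F. (\<integral>x. \<bar>u0 x - fsum heav F n p v x 0\<bar> \<partial>lborel) \<le> 2 * V / real K"
      using discretize[OF U V_def V K] unfolding d_def by blast
    obtain ex where ex: "ftrack F n p v 0 ex" "length ex \<le> 3 * n" using ftrack_exists[OF sc st(1)] by blast
    obtain bs where bs: "length bs = n" "\<And>k x t. 0 \<le> t \<Longrightarrow> fsum k F n p v x t = tsum k bs x t"
      using fsum_terms by blast
    define ts where "ts = bs @ ex"
    have len: "length ts \<le> 8 * K" using bs(1) ex(2) st(2) by (simp add: ts_def)
    have trk: "trk k F n p v 0 ex x t = tsum k ts x t" if "0 \<le> t" for k x t
      using bs(2)[OF that] by (simp add: trk_def ts_def tsum_append)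
    obtain m n' p' v' ex' where fine: "1 \<le> m" "valid (V / real K / real m) (K * m) n' p' v'" "\<forall>j\<in>{1..n'}. p' j \<in> {0..1}" "ftrack F n' p' v' 0 ex'"
      "(\<integral>x. \<bar>u0 x - fsum heav F n' p' v' x 0\<bar> \<partial>lborel) \<le> d"
      "\<forall>t\<in>{0<..<T}. (\<integral>x. \<bar>u x t - trk heav F n' p' v' 0 ex' x t\<bar> \<partial>lborel) \<le> d"
      using fine_approx[OF sc sm U V_def V K d] by blast
    define s where "s = (\<Sum>a\<leftarrow>ts. \<bar>fst a\<bar>)"
    have s0: "0 \<le> s" unfolding s_def by (intro sum_list_nonneg) auto
    define e where "e = d / (s + 1)"
    have e: "0 < e" "e * s \<le> d" using d s0 by (auto simp: e_def field_simps)
    have init: "(\<integral>x. \<bar>fsum heav F n' p' v' x 0 - fsum heav F n p v x 0\<bar> \<partial>lborel) \<le> 3 * d"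
    proof -
      let ?a = "\<lambda>x. fsum heav F n' p' v' x 0" and ?b = "\<lambda>x. fsum heav F n p v x 0"
      have i: "integrable lborel (\<lambda>x. u0 x - ?a x)" "integrable lborel (\<lambda>x. u0 x - ?b x)" "integrable lborel (\<lambda>x. ?a x - ?b x)"
        using u0_int fsum_integrable[OF st(1)] fsum_integrable[OF fine(2)] by auto
      have "(\<integral>x. \<bar>?a x - ?b x\<bar> \<partial>lborel) \<le> (\<integral>x. \<bar>u0 x - ?a x\<bar> + \<bar>u0 x - ?b x\<bar> \<partial>lborel)"
        using i by (intro integral_mono integrable_abs Bochner_Integration.integrable_add) auto
      also have "\<dots> = (\<integral>x. \<bar>u0 x - ?a x\<bar> \<partial>lborel) + (\<integral>x. \<bar>u0 x - ?b x\<bar> \<partial>lborel)"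
        using i by (intro Bochner_Integration.integral_add integrable_abs)
      also have "\<dots> \<le> d + 2 * d" using fine(5) st(4)[of F] by (intro add_mono) (auto simp: d_def)
      finally show ?thesis by simp
    qed
    have "integrable lborel (\<lambda>x. u x t - tsum (ramp e) ts x t) \<and>
      (LINT x:{0<..<1}|lborel. \<bar>u x t - tsum (ramp e) ts x t\<bar>) \<le> 23 / real K * V" if t: "t \<in> {0<..<T}" for t
    proof -
      have t0: "0 < t" using t by simp
      let ?I = "{0<..<1::real}"
      have iu: "integrable lborel (\<lambda>x. u x t)" by (rule u_integrable[OF t])
      have i1: "integrable lborel (\<lambda>x. trk heav F n' p' v' 0 ex' x t)" using trk_integrable[OF fine(4,2)] t0 by simp
      have i2: "integrable lborel (\<lambda>x. tsum heav ts x t)" using trk_integrable[OF ex(1) st(1), of t] t0 by (simp add: trk)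
      have i3: "integrable lborel (\<lambda>x. tsum heav ts x t - tsum (ramp e) ts x t)" by (rule tsum_ramp_heav[OF e(1)])
      have i4: "integrable lborel (\<lambda>x. trk heav F n' p' v' 0 ex' x t - tsum heav ts x t)" using i1 i2 by simp
      have i5: "integrable lborel (\<lambda>x. u x t - trk heav F n' p' v' 0 ex' x t)" using iu i1 by simp
      have i6: "integrable lborel (\<lambda>x. u x t - tsum heav ts x t)" using iu i2 by simp
      have i7: "integrable lborel (\<lambda>x. u x t - tsum (ramp e) ts x t)"
        using Bochner_Integration.integrable_add[OF i6 i3] by simp
      have "(LINT x:?I|lborel. \<bar>u x t - tsum (ramp e) ts x t\<bar>)
        \<le> (LINT x:?I|lborel. \<bar>u x t - tsum heav ts x t\<bar>) + (LINT x:?I|lborel. \<bar>tsum heav ts x t - tsum (ramp e) ts x t\<bar>)"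
        by (rule L1_triangle[OF i6 i3]) simp
      also have "(LINT x:?I|lborel. \<bar>u x t - tsum heav ts x t\<bar>)
        \<le> (LINT x:?I|lborel. \<bar>u x t - trk heav F n' p' v' 0 ex' x t\<bar>) + (LINT x:?I|lborel. \<bar>trk heav F n' p' v' 0 ex' x t - tsum heav ts x t\<bar>)"
        by (rule L1_triangle[OF i5 i4]) simp
      also have "(LINT x:?I|lborel. \<bar>u x t - trk heav F n' p' v' 0 ex' x t\<bar>) \<le> d"
        using set_L1_le[OF i5, of ?I] fine(6) t by fastforce
      also have "(LINT x:?I|lborel. \<bar>trk heav F n' p' v' 0 ex' x t - tsum heav ts x t\<bar>) \<le> 3 * d + 16 * d"
      proof -
        have pj: "p j \<in> {0..1}" if "j \<in> {1..n}" for j using st(3) that by blast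
        have pj': "p' j \<in> {0..1}" if "j \<in> {1..n'}" for j using fine(3) that by blast
        have vf: "valid (d / real m) (K * m) n' p' v'" using fine(2) by (simp add: d_def)
        show ?thesis
          using fronts_compare[OF sc F0 tangent_below[OF sc sm F0] t0 drift[OF t] d fine(1) st(1) ex(1) pj vf fine(4) pj'] init t0
          by (simp add: trk)
      qed
      also have "(LINT x:?I|lborel. \<bar>tsum heav ts x t - tsum (ramp e) ts x t\<bar>) \<le> d"
        using set_L1_le[OF i3, of ?I] tsum_ramp_heav(2)[OF e(1), of ts t] e(2) by (simp add: s_def)
      finally have "(LINT x:?I|lborel. \<bar>u x t - tsum (ramp e) ts x t\<bar>) \<le> 23 * d" using d by simp
      then show ?thesis using i7 by (simp add: d_def)
    qed
    then show ?thesis using e(1) len unfolding V_def by blast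
  qed
qed

end

theorem theorem5p4:
  "\<exists>C > 0. \<exists>c > 0. \<forall>(u0 :: real \<Rightarrow> real) (F :: real \<Rightarrow> real) (T :: real)
      (u :: real \<Rightarrow> real \<Rightarrow> real) (K :: nat).
     in_U u0 \<and> smooth_fun F \<and> strictly_convex F \<and> 0 < T \<and>
     entropy_solution F u0 T u \<and> L1_time_continuous T u \<and> zero_outside T u \<and> 1 \<le> K \<longrightarrow>
     (\<exists>M U V g0 g1 h0 h1.
        lrnr_basis 5 M 2 U V \<and>
        real (lrnr_dof 5 2 U V) \<le> c * real K \<and>
        real K ^ 2 / c \<le> real (net_width 5 M) \<and> real (net_width 5 M) \<le> c * real K ^ 2 \<and>
        (\<forall>t\<in>{0<..<T}.
           set_integrable lborel {0<..<1}
             (\<lambda>x. u x t - lrnr_eval 5 M 2 U V (\<lambda>l i. g0 l i + g1 l i * t)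
                                           (\<lambda>l i. h0 l i + h1 l i * t) x) \<and>
           (LINT x:{0<..<1}|lborel. \<bar>u x t - lrnr_eval 5 M 2 U V (\<lambda>l i. g0 l i + g1 l i * t)
                                           (\<lambda>l i. h0 l i + h1 l i * t) x\<bar>)
             \<le> C / real K * total_variation u0 {0<..<1} * (1 + total_variation u0 {0<..<1})
                 * (1 + T * F2_norm F u0)))"
proof (rule exI[of _ 23], rule conjI, simp, rule exI[of _ 266], rule conjI, simp, intro allI impI, elim conjE)
  fix u0 F :: "real \<Rightarrow> real" and T :: real and u :: "real \<Rightarrow> real \<Rightarrow> real" and K :: nat
  assume U: "in_U u0" and sm: "smooth_fun F" and sc: "strictly_convex F" and T: "0 < T"
    and ent: "entropy_solution F u0 T u" and tc: "L1_time_continuous T u" and zo: "zero_outside T u" and K: "1 \<le> K"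
  define G where "G = (\<lambda>w. F w - F 0)"
  have dG: "deriv G = deriv F"
  proof
    fix x
    have "(G has_real_derivative deriv F x) (at x)"
      unfolding G_def using smooth_fun_derivs(1)[OF sm, of x] by (auto intro!: derivative_eq_intros)
    then show "deriv G x = deriv F x" by (rule DERIV_imp_deriv)
  qed
  have smG: "smooth_fun G"
    unfolding smooth_fun_def
  proof (intro allI)
    fix k x
    show "((deriv ^^ k) G) differentiable (at x)"
    proof (cases k)
      case 0
      have "F differentiable (at x)" using smooth_fun_derivs(1)[OF sm, of x] real_differentiable_def by blast
      then show ?thesis unfolding 0 G_def by simp
    next
      case (Suc i)
      then have "(deriv ^^ k) G = (deriv ^^ k) F" by (simp add: funpow_Suc_right dG del: funpow.simps)
      then show ?thesis using sm by (simp add: smooth_fun_def)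
    qed
  qed
  have scG: "strictly_convex G"
    using sc unfolding strictly_convex_def G_def by (simp add: algebra_simps)
  have entG: "entropy_solution G u0 T u"
    using ent unfolding entropy_solution_def G_def by simp
  interpret entropy_setting G u0 T u
    using T entG tc zo in_U_props[OF U] smooth_fun_derivs(4)[OF smG]
    by unfold_locales auto
  have G0: "G 0 = 0" by (simp add: G_def)
  obtain ts e where ts: "0 < e" "length ts \<le> 8 * K"
    "\<And>t. t \<in> {0<..<T} \<Longrightarrow> integrable lborel (\<lambda>x. u x t - tsum (ramp e) ts x t)"
    "\<And>t. t \<in> {0<..<T} \<Longrightarrow> (LINT x:{0<..<1}|lborel. \<bar>u x t - tsum (ramp e) ts x t\<bar>) \<le> 23 / real K * total_variation u0 {0<..<1}"
    using network_approximation[OF scG smG G0 U K] by blast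
  have N: "1 \<le> 8 * K" using K by simp
  obtain M NU NV g0 g1 h0 h1 where net: "lrnr_basis 5 M 2 NU NV" "lrnr_dof 5 2 NU NV = 30 * (8 * K) + 6 * K + 20"
    "net_width 5 M = K * (2 * (8 * K))"
    "\<And>t x. t \<in> {0<..<T} \<Longrightarrow> x \<in> {0<..<1} \<Longrightarrow> lrnr_eval 5 M 2 NU NV (\<lambda>l i. g0 l i + g1 l i * t) (\<lambda>l i. h0 l i + h1 l i * t) x = tsum (ramp e) ts x t"
    using network_realizes[OF N K ts(2,1) T] by blast
  let ?V = "total_variation u0 {0<..<1}"
  show "\<exists>M U V g0 g1 h0 h1.
        lrnr_basis 5 M 2 U V \<and>
        real (lrnr_dof 5 2 U V) \<le> 266 * real K \<and>
        real K ^ 2 / 266 \<le> real (net_width 5 M) \<and> real (net_width 5 M) \<le> 266 * real K ^ 2 \<and>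
        (\<forall>t\<in>{0<..<T}.
           set_integrable lborel {0<..<1}
             (\<lambda>x. u x t - lrnr_eval 5 M 2 U V (\<lambda>l i. g0 l i + g1 l i * t) (\<lambda>l i. h0 l i + h1 l i * t) x) \<and>
           (LINT x:{0<..<1}|lborel. \<bar>u x t - lrnr_eval 5 M 2 U V (\<lambda>l i. g0 l i + g1 l i * t) (\<lambda>l i. h0 l i + h1 l i * t) x\<bar>)
             \<le> 23 / real K * ?V * (1 + ?V) * (1 + T * F2_norm F u0))"
  proof (rule exI[of _ M], rule exI[of _ NU], rule exI[of _ NV], rule exI[of _ g0], rule exI[of _ g1],
      rule exI[of _ h0], rule exI[of _ h1], intro conjI ballI)
    show "lrnr_basis 5 M 2 NU NV" by (rule net)
    have K1: "1 \<le> real K" using K by simp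
    then show "real (lrnr_dof 5 2 NU NV) \<le> 266 * real K" unfolding net(2) by simp
    have w: "real (net_width 5 M) = 16 * real K ^ 2" unfolding net(3) by (simp add: power2_eq_square)
    show "real K ^ 2 / 266 \<le> real (net_width 5 M)" "real (net_width 5 M) \<le> 266 * real K ^ 2" unfolding w by simp_all
    fix t assume t: "t \<in> {0<..<T}"
    let ?h = "lrnr_eval 5 M 2 NU NV (\<lambda>l i. g0 l i + g1 l i * t) (\<lambda>l i. h0 l i + h1 l i * t)"
    have "set_integrable lborel {0<..<1} (\<lambda>x. u x t - tsum (ramp e) ts x t)"
      unfolding set_integrable_def using ts(3)[OF t] by (intro integrable_mult_indicator) auto
    then show "set_integrable lborel {0<..<1} (\<lambda>x. u x t - ?h x)"
      unfolding set_integrable_def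
      by (rule Bochner_Integration.integrable_cong[THEN iffD1, rotated 2]) (use net(4)[OF t] in \<open>auto simp: indicator_def\<close>)
    have "(LINT x:{0<..<1}|lborel. \<bar>u x t - ?h x\<bar>) = (LINT x:{0<..<1}|lborel. \<bar>u x t - tsum (ramp e) ts x t\<bar>)"
      using net(4)[OF t] by (intro set_lebesgue_integral_cong) auto
    also have "\<dots> \<le> 23 / real K * ?V" by (rule ts(4)[OF t])
    also have "\<dots> = 23 / real K * ?V * 1 * 1" by simp
    also have "\<dots> \<le> 23 / real K * ?V * (1 + ?V) * (1 + T * F2_norm F u0)"
      using in_U_props(1)[OF U] F2_norm_nonneg[OF sm U] T
      by (intro mult_mono mult_nonneg_nonneg) auto
    finally show "(LINT x:{0<..<1}|lborel. \<bar>u x t - ?h x\<bar>) \<le> 23 / real K * ?V * (1 + ?V) * (1 + T * F2_norm F u0)" .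
  qed
qed

end
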